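(* Let $m\ge2$ be an integer, $p=2m$, $\alpha>-1$, and $a=\frac{\alpha+2}{2m}$. If \[ 0<a\le\frac{m}{2m-1} \] (equivalently, $-1<\alpha\le\frac{2(m-1)^2}{2m-1}$), then \[ \|\mathcal H\|_{A^{2m}_\alpha\to A^{2m}_\alpha}=\mathrm B(a,1-a)=\frac{\pi}{\sin(\pi a)}. \]
   Context: Let $\mathbb D$ be the open unit disk and $dA(z)=\pi^{-1}\,dx\,dy$ normalized area measure. For $\alpha>-1$ put $dA_\alpha(z)=(\alpha+1)(1-|z|^2)^\alpha\,dA(z)$. The weighted Bergman space $A^p_\alpha$ consists of analytic functions $f$ on $\mathbb D$ with $\|f\|_{A^p_\alpha}^p=\int_{\mathbb D}|f|^p\,dA_\alpha<\infty$. The Hilbert matrix operator is, for $f(z)=\sum_{k\ge0}a_kz^k$, \[ \mathcal Hf(z)=\sum_{n=0}^\infty\Big(\sum_{k=0}^\infty\frac{a_k}{n+k+1}\Big)z^n=\int_0^1\frac{f(t)}{1-tz}\,dt, \] (initially for polynomials, which are dense in $A^p_\alpha$), and $\|\mathcal H\|_{A^p_\alpha\to A^p_\alpha}$ denotes its operator norm. $\mathrm B(x,y)=\int_0^1t^{x-1}(1-t)^{y-1}\,dt$ is the beta function. *)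

theory Defs
  imports "HOL-Complex_Analysis.Complex_Analysis" "HOL-Computational_Algebra.Polynomial"
begin

definition disc_area :: "complex measure" where
  "disc_area = scale_measure (ennreal (1 / pi)) (restrict_space lborel (ball 0 1))"

definition bergman_measure :: "real \<Rightarrow> complex measure" where
  "bergman_measure \<alpha> =
     density disc_area (\<lambda>z. ennreal ((\<alpha> + 1) * (1 - (cmod z)\<^sup>2) powr \<alpha>))"

(* Elements are total functions on the complex plane of which only the values on the
   open unit disc matter: two functions that agree there represent the same element. *)
definition bergman_space :: "real \<Rightarrow> real \<Rightarrow> (complex \<Rightarrow> complex) set" where
  "bergman_space p \<alpha> =
     {f. f holomorphic_on ball 0 1 \<and>
         integrable (bergman_measure \<alpha>) (\<lambda>z. cmod (f z) powr p)}"

definition bergman_norm :: "real \<Rightarrow> real \<Rightarrow> (complex \<Rightarrow> complex) \<Rightarrow> real" where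
  "bergman_norm p \<alpha> f = (LINT z|bergman_measure \<alpha>. cmod (f z) powr p) powr (1 / p)"

(* Linearity is required on the disc only; boundedness then makes T f, as a function on
   the disc, depend only on the values of f on the disc. *)
definition bergman_bounded_linear ::
  "real \<Rightarrow> real \<Rightarrow> ((complex \<Rightarrow> complex) \<Rightarrow> complex \<Rightarrow> complex) \<Rightarrow> bool" where
  "bergman_bounded_linear p \<alpha> T \<longleftrightarrow>
     (\<forall>f\<in>bergman_space p \<alpha>. T f \<in> bergman_space p \<alpha>) \<and>
     (\<forall>f\<in>bergman_space p \<alpha>. \<forall>g\<in>bergman_space p \<alpha>. \<forall>z\<in>ball 0 1.
        T (\<lambda>w. f w + g w) z = T f z + T g z) \<and>
     (\<forall>c. \<forall>f\<in>bergman_space p \<alpha>. \<forall>z\<in>ball 0 1. T (\<lambda>w. c * f w) z = c * T f z) \<and>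
     (\<exists>C. \<forall>f\<in>bergman_space p \<alpha>. bergman_norm p \<alpha> (T f) \<le> C * bergman_norm p \<alpha> f)"

(* The analogue of onorm on the carrier bergman_space; as there, x / 0 = 0 takes care of
   f = 0, and the value is meaningful for bounded T. *)
definition bergman_onorm ::
  "real \<Rightarrow> real \<Rightarrow> ((complex \<Rightarrow> complex) \<Rightarrow> complex \<Rightarrow> complex) \<Rightarrow> real" where
  "bergman_onorm p \<alpha> T =
     (SUP f\<in>bergman_space p \<alpha>. bergman_norm p \<alpha> (T f) / bergman_norm p \<alpha> f)"

definition hilbert_matrix :: "(nat \<Rightarrow> complex) \<Rightarrow> complex \<Rightarrow> complex" where
  "hilbert_matrix a z = (\<Sum>n. (\<Sum>k. a k / of_nat (n + k + 1)) * z ^ n)"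

(* T is the Hilbert matrix operator on the Bergman space: the bounded linear extension of
   the operator given by the matrix on polynomials (unique, on the disc, by density). *)
definition is_hilbert_operator ::
  "real \<Rightarrow> real \<Rightarrow> ((complex \<Rightarrow> complex) \<Rightarrow> complex \<Rightarrow> complex) \<Rightarrow> bool" where
  "is_hilbert_operator p \<alpha> T \<longleftrightarrow>
     bergman_bounded_linear p \<alpha> T \<and>
     (\<forall>q :: complex poly. \<forall>z\<in>ball 0 1. T (poly q) z = hilbert_matrix (coeff q) z)"

end

theory Submission
  imports Defs
begin

text \<open>
  Write \<open>w\<^sub>t(z) = 1 / (1 - (1 - t) z)\<close> and \<open>\<phi>\<^sub>t = t w\<^sub>t\<close>, so that \<open>H f\<close> is the integral of
  \<open>w\<^sub>t \<cdot> (f \<circ> \<phi>\<^sub>t)\<close> over \<open>0 < t < 1\<close>. Jensen's inequality with respect to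
  \<open>k(t) = t\<^sup>a\<^sup>-\<^sup>1 (1 - t)\<^sup>-\<^sup>a\<close>, whose integral is \<open>B(a, 1 - a)\<close>, reduces the upper bound to the
  \<open>2m\<close>-norms of the slices \<open>w\<^sub>t \<cdot> (f \<circ> \<phi>\<^sub>t)\<close>. If \<open>a \<le> 1/2\<close>, each slice has norm at most
  \<open>k(t)\<close> times that of \<open>f\<close>: as \<open>f\<^sup>m\<close> lies in a Hilbert space with orthogonal monomials, this is a
  Schur test. If \<open>a > 1/2\<close>, such a bound may fail for single slices, but the average over \<open>t\<close> is
  controlled: after the substitution \<open>w = \<phi>\<^sub>t(z)\<close> it suffices to compare weights pointwise, which
  comes down to \<open>4\<^sup>a B(a, 1 + a) = B(a, 1/2) \<le> B(a, 1 - a)\<close>. The excess exponent is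
  \<open>\<delta> = m (2a - 1)\<close>, and \<open>a \<le> m / (2m - 1)\<close> says that \<open>\<delta> \<le> a\<close>.

  For the lower bound take \<open>f = (1 - z)\<^sup>-\<^sup>\<kappa>\<close> with \<open>\<kappa>\<close> increasing to \<open>a\<close>, whose norm tends to
  infinity. The \<open>n\<close>-th coefficient of \<open>H f\<close> is at least \<open>n / (n + 1) \<cdot> B(\<kappa>, 1 - \<kappa>)\<close> times that of
  \<open>f\<close>, and the \<open>2m\<close>-norm is monotone in the moduli of the coefficients.
\<close>

section \<open>Holomorphic substitution in the plane\<close>

text \<open>The formula with w_t and phi_t comes from substituting s = phi_t(z) in the integral of
  f(s) / (1 - s z): there ds / (1 - s z) = w_t(z) dt. In the variable w = phi_t(z) the 2m-th power
  of a slice becomes k(t)^(2m) times |f(w)|^(2m) times |w|^(-2 delta) and the alpha-th power of D =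
  1 - |w|^2 - |1 - w|^2 / (1 - t). If delta <= 0, the power of |w| is at most 1, but alpha may be
  negative, and then D <= 1 - |w|^2 compares the weights the wrong way; hence the argument with
  coefficients. If delta > 0, then alpha > 0, and the obstacle is the singularity at w = 0. It is
  compensated because w lies in the image of phi_t only for t < c, where c = 1 - |1 - w|^2 / (1 -
  |w|^2): the average over t gains (c / (2 - c))^(2 delta), and c / (2 - c) <= |w|, with equality
  for 0 < w < 1. The inequality with 4^a is the limit case c -> 0, delta = a of the bound for this
  average.\<close>

lemma lborel_complex_eq_distr_vec:
  "(lborel :: complex measure) = distr lborel borel (\<lambda>v::real^2. Complex (v $ 1) (v $ 2))"
proof (rule lborel_eqI)
  fix l u :: complex
  assume le: "\<And>b. b \<in> Basis \<Longrightarrow> l \<bullet> b \<le> u \<bullet> b"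
  have le': "Re l \<le> Re u" "Im l \<le> Im u"
    using le[of 1] le[of \<i>] by (auto simp: Basis_complex_def)
  have m: "(\<lambda>v::real^2. Complex (v $ 1) (v $ 2)) \<in> borel \<rightarrow>\<^sub>M borel"
    by (intro borel_measurable_continuous_onI continuous_intros)
  have vi: "(\<lambda>v::real^2. Complex (v $ 1) (v $ 2)) -` box l u =
      box (vector [Re l, Im l]) (vector [Re u, Im u])"
    by (auto simp: box_def Basis_complex_def Basis_vec_def inner_axis forall_2 UNIV_2
        exhaust_2 vector_def)
  have B2: "(Basis :: (real^2) set) = {axis 1 1, axis 2 1}"
    by (auto simp: Basis_vec_def UNIV_2)
  have ne: "axis 1 (1::real) \<noteq> (axis 2 1 :: real^2)"
    by (simp add: axis_eq_axis)
  have le'': "\<And>b. b \<in> Basis \<Longrightarrow> (vector [Re l, Im l] :: real^2) \<bullet> b \<le> vector [Re u, Im u] \<bullet> b"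
    using le' by (auto simp: B2 inner_axis vector_def)
  have "emeasure (distr lborel borel (\<lambda>v::real^2. Complex (v $ 1) (v $ 2))) (box l u) =
     emeasure lborel (box (vector [Re l, Im l] :: real^2) (vector [Re u, Im u]))"
    using m by (subst emeasure_distr) (auto simp: vi)
  also have "\<dots> = ennreal (\<Prod>b\<in>Basis. ((vector [Re u, Im u] :: real^2) - vector [Re l, Im l]) \<bullet> b)"
    by (rule emeasure_lborel_box) (use le'' in auto)
  also have "(\<Prod>b\<in>Basis. ((vector [Re u, Im u] :: real^2) - vector [Re l, Im l]) \<bullet> b) =
      (Re u - Re l) * (Im u - Im l)"
    using ne by (simp add: B2 inner_axis)
  also have "\<dots> = (\<Prod>b\<in>Basis. (u - l) \<bullet> b)"
    by (simp add: Basis_complex_def)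
  finally show "emeasure (distr lborel borel (\<lambda>v::real^2. Complex (v $ 1) (v $ 2))) (box l u) =
      ennreal (\<Prod>b\<in>Basis. (u - l) \<bullet> b)" .
qed auto

text \<open>The change of variables theorem speaks of absolute integrability together with a
  prescribed value \<open>b\<close> of the integral; for nonnegative Borel functions this is a
  single equation in \<open>ennreal\<close>.\<close>

lemma absolutely_integrable_iff_nn_integral:
  fixes h :: "'a::euclidean_space \<Rightarrow> real"
  assumes [measurable]: "h \<in> borel_measurable borel" "T \<in> sets borel" and nn: "\<And>x. h x \<ge> 0"
  shows "(h absolutely_integrable_on T \<and> integral T h = b) \<longleftrightarrow>
         (b \<ge> 0 \<and> (\<integral>\<^sup>+x. ennreal (indicator T x * h x) \<partial>lborel) = ennreal b)"
proof
  assume A: "h absolutely_integrable_on T \<and> integral T h = b"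
  have *: "integrable lborel (\<lambda>x. indicator T x * h x)"
    using A by (simp add: set_integrable_def integrable_completion)
  have "integral T h = (LINT x|lborel. indicator T x * h x)"
    using A by (subst set_lebesgue_integral_eq_integral(2)[symmetric]) (simp_all add: set_lebesgue_integral_def integral_completion)
  then show "b \<ge> 0 \<and> (\<integral>\<^sup>+x. ennreal (indicator T x * h x) \<partial>lborel) = ennreal b"
    using A nn_integral_eq_integral[OF *] nn by (auto intro!: integral_nonneg_AE)
next
  assume A: "b \<ge> 0 \<and> (\<integral>\<^sup>+x. ennreal (indicator T x * h x) \<partial>lborel) = ennreal b"
  have *: "integrable lborel (\<lambda>x. indicator T x * h x)"
    by (rule integrableI_nn_integral_finite[where x=b]) (use A nn in auto)
  then have I: "h absolutely_integrable_on T"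
    by (simp add: set_integrable_def integrable_completion)
  have "integral T h = (LINT x|lborel. indicator T x * h x)"
    using I by (subst set_lebesgue_integral_eq_integral(2)[symmetric]) (simp_all add: set_lebesgue_integral_def integral_completion)
  also have "\<dots> = b"
    using A nn_integral_eq_integral[OF *] nn by (auto simp: integral_nonneg_AE)
  finally show "h absolutely_integrable_on T \<and> integral T h = b" using I by simp
qed

text \<open>Scalar functions are embedded in \<open>real ^ 1\<close> to fit the vector-valued
  theorem.\<close>

lemma has_absolute_integral_change_of_variables_real_valued:
  fixes f :: "real^'m::{finite,wellorder} \<Rightarrow> real" and g :: "real^'m::_ \<Rightarrow> real^'m::_"
  assumes "S \<in> sets lebesgue"
    and "\<And>x. x \<in> S \<Longrightarrow> (g has_derivative g' x) (at x within S)"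
    and "inj_on g S"
  shows "(\<lambda>x. \<bar>det (matrix (g' x))\<bar> * f(g x)) absolutely_integrable_on S \<and>
           integral S (\<lambda>x. \<bar>det (matrix (g' x))\<bar> * f(g x)) = b
     \<longleftrightarrow> f absolutely_integrable_on (g ` S) \<and> integral (g ` S) f = b"
proof -
  have "(\<lambda>x. \<bar>det (matrix (g' x))\<bar> *\<^sub>R vec (f(g x)) :: real ^ 1) absolutely_integrable_on S \<and>
           integral S (\<lambda>x. \<bar>det (matrix (g' x))\<bar> *\<^sub>R vec (f(g x))) = (vec b :: real ^ 1)
         \<longleftrightarrow> (\<lambda>x. vec (f x) :: real ^ 1) absolutely_integrable_on (g ` S) \<and>
           integral (g ` S) (\<lambda>x. vec (f x)) = (vec b :: real ^ 1)"
    by (intro has_absolute_integral_change_of_variables assms)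
  thus ?thesis
    by (simp add: absolutely_integrable_on_1_iff integral_on_1_eq)
qed

text \<open>By the Cauchy-Riemann equations the real Jacobian of a holomorphic map is the squared
  modulus of its derivative. The change of variables theorem concerns \<open>real^2\<close>, so both
  integrals are carried there by the coordinate maps \<open>C\<close> and \<open>D\<close>.\<close>

theorem nn_integral_holomorphic_substitution:
  fixes f :: "complex \<Rightarrow> real" and \<phi> :: "complex \<Rightarrow> complex"
  assumes S: "open S" and holo: "\<phi> holomorphic_on S" and inj: "inj_on \<phi> S"
    and [measurable]: "f \<in> borel_measurable borel" and nn: "\<And>w. f w \<ge> 0"
  shows "(\<integral>\<^sup>+z. ennreal (indicator S z * ((cmod (deriv \<phi> z))\<^sup>2 * f (\<phi> z))) \<partial>lborel) =
         (\<integral>\<^sup>+w. ennreal (indicator (\<phi> ` S) w * f w) \<partial>lborel)"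
proof -
  define C where "C = (\<lambda>v::real^2. Complex (v $ 1) (v $ 2))"
  define D where "D = (\<lambda>z. vector [Re z, Im z] :: real^2)"
  have DC: "D (C v) = v" for v
    by (simp add: C_def D_def vec_eq_iff forall_2)
  have CD: "C (D v) = v" for v
    by (simp add: C_def D_def complex_eq_iff)
  have blD: "bounded_linear D"
    unfolding D_def
    by (rule linear_conv_bounded_linear[THEN iffD1], rule linearI)
       (auto simp: vec_eq_iff forall_2)
  have blC: "bounded_linear C"
    unfolding C_def
    by (rule linear_conv_bounded_linear[THEN iffD1], rule linearI)
       (auto simp: complex_eq_iff)
  have contD: "continuous_on A D" and contC: "continuous_on B C" for A B
    using blD blC linear_continuous_on by blast+
  have [measurable]: "C \<in> borel \<rightarrow>\<^sub>M borel" "D \<in> borel \<rightarrow>\<^sub>M borel"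
    by (intro borel_measurable_continuous_onI contC contD)+
  \<comment> \<open>\<open>\<phi>\<close> is constrained only on \<open>S\<close>; extending it and
    its derivative by 0 yields Borel functions on the whole plane.\<close>
  define \<psi> where "\<psi> = (\<lambda>z. if z \<in> S then \<phi> z else 0)"
  define d where "d = (\<lambda>z. if z \<in> S then deriv \<phi> z else 0)"
  have [measurable]: "S \<in> sets borel" using S by simp
  have [measurable]: "\<psi> \<in> borel \<rightarrow>\<^sub>M borel" unfolding \<psi>_def
    by (intro borel_measurable_continuous_on_if holomorphic_on_imp_continuous_on holo continuous_intros) auto
  have [measurable]: "d \<in> borel \<rightarrow>\<^sub>M borel" unfolding d_def
    by (intro borel_measurable_continuous_on_if holomorphic_on_imp_continuous_on holomorphic_deriv holo S continuous_intros) auto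
  have opS: "open (\<phi> ` S)"
    using open_mapping_thm3[OF holo S inj] by simp
  then have [measurable]: "\<phi> ` S \<in> sets borel" by simp
  define S' where "S' = C -` S"
  have opS': "open S'" unfolding S'_def
    by (rule open_vimage[OF S]) (auto simp: contC)
  then have [measurable]: "S' \<in> sets borel" by simp
  define g where "g = D \<circ> \<psi> \<circ> C"
  define g' where "g' = (\<lambda>v. D \<circ> (\<lambda>h. deriv \<phi> (C v) * h) \<circ> C)"
  have gS: "g ` S' = C -` (\<phi> ` S)"
  proof -
    have "x \<in> g ` S'" if "C x = \<phi> s" "s \<in> S" for x s
      using that by (intro image_eqI[of _ _ "D s"]) (auto simp: S'_def g_def \<psi>_def CD DC simp flip: that(1))
    then show ?thesis
      by (auto simp: S'_def g_def \<psi>_def CD DC)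
  qed
  have der: "(g has_derivative g' x) (at x within S')" if x: "x \<in> S'" for x
  proof -
    have "(\<phi> has_derivative (\<lambda>h. deriv \<phi> (C x) * h)) (at (C x))"
      using holomorphic_derivI[OF holo S, of "C x"] x
      by (simp add: has_field_derivative_def S'_def)
    then have "(\<phi> has_derivative (\<lambda>h. deriv \<phi> (C x) * h)) (at (C x) within S)"
      by (rule has_derivative_at_withinI)
    then have "(\<psi> has_derivative (\<lambda>h. deriv \<phi> (C x) * h)) (at (C x) within S)"
      by (rule has_derivative_transform[rotated 2]) (use x in \<open>auto simp: S'_def \<psi>_def\<close>)
    moreover have "at (C x) within S = at (C x)"
      using x S by (intro at_within_open) (auto simp: S'_def)
    ultimately have "(\<psi> has_derivative (\<lambda>h. deriv \<phi> (C x) * h)) (at (C x))" by simp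
    moreover have "(C has_derivative C) (at x)"
      using blC bounded_linear_imp_has_derivative by blast
    ultimately have "(\<psi> \<circ> C has_derivative ((\<lambda>h. deriv \<phi> (C x) * h) \<circ> C)) (at x)"
      by (rule diff_chain_at[rotated])
    moreover have "(D has_derivative D) (at ((\<psi> \<circ> C) x))"
      using blD bounded_linear_imp_has_derivative by blast
    ultimately have "(D \<circ> (\<psi> \<circ> C) has_derivative (D \<circ> ((\<lambda>h. deriv \<phi> (C x) * h) \<circ> C))) (at x)"
      by (rule diff_chain_at)
    then show ?thesis
      unfolding g_def g'_def o_assoc by (rule has_derivative_at_withinI)
  qed
  have injg: "inj_on g S'"
  proof (rule inj_onI)
    fix x y assume "x \<in> S'" "y \<in> S'" "g x = g y"
    then have "\<phi> (C x) = \<phi> (C y)" "C x \<in> S" "C y \<in> S"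
      by (auto simp: g_def S'_def \<psi>_def) (metis CD)
    then have "C x = C y" using inj by (auto simp: inj_on_def)
    then show "x = y" by (metis DC)
  qed
  \<comment> \<open>Multiplication by x + i y has the real matrix with rows (x, -y) and (y, x), of
    determinant x^2 + y^2.\<close>
  have det: "det (matrix (g' x)) = (cmod (deriv \<phi> (C x)))\<^sup>2" for x
    by (simp add: det_2 matrix_def g'_def C_def D_def axis_def cmod_power2)
       (simp add: power2_eq_square)
  let ?L = "\<integral>\<^sup>+z. ennreal (indicator S z * ((cmod (deriv \<phi> z))\<^sup>2 * f (\<phi> z))) \<partial>lborel"
  let ?R = "\<integral>\<^sup>+w. ennreal (indicator (\<phi> ` S) w * f w) \<partial>lborel"
  have L: "?L = (\<integral>\<^sup>+v. ennreal (indicator S' v * ((cmod (d (C v)))\<^sup>2 * f (C (g v)))) \<partial>lborel)"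
  proof -
    have "?L = (\<integral>\<^sup>+z. ennreal (indicator S z * ((cmod (d z))\<^sup>2 * f (\<psi> z))) \<partial>lborel)"
      by (intro nn_integral_cong) (auto simp: d_def \<psi>_def indicator_def)
    also have "\<dots> = (\<integral>\<^sup>+z. ennreal (indicator S z * ((cmod (d z))\<^sup>2 * f (\<psi> z))) \<partial>distr lborel borel C)"
      using lborel_complex_eq_distr_vec unfolding C_def by simp
    also have "\<dots> = (\<integral>\<^sup>+v. ennreal (indicator S (C v) * ((cmod (d (C v)))\<^sup>2 * f (\<psi> (C v)))) \<partial>lborel)"
      by (rule nn_integral_distr) measurable
    finally show ?thesis by (simp add: S'_def g_def CD indicator_def)
  qed
  have R: "?R = (\<integral>\<^sup>+v. ennreal (indicator (g ` S') v * f (C v)) \<partial>lborel)"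
  proof -
    have "?R = (\<integral>\<^sup>+w. ennreal (indicator (\<phi> ` S) w * f w) \<partial>distr lborel borel C)"
      using lborel_complex_eq_distr_vec unfolding C_def by simp
    also have "\<dots> = (\<integral>\<^sup>+v. ennreal (indicator (\<phi> ` S) (C v) * f (C v)) \<partial>lborel)"
      by (rule nn_integral_distr) measurable
    finally show ?thesis by (simp add: gS indicator_def)
  qed
  have [measurable]: "g \<in> borel \<rightarrow>\<^sub>M borel" unfolding g_def comp_def by measurable
  have [measurable]: "g ` S' \<in> sets borel" unfolding gS
    by (rule measurable_sets_borel[of C borel]) auto
  have eq: "(b \<ge> 0 \<and> ?L = ennreal b) \<longleftrightarrow> (b \<ge> 0 \<and> ?R = ennreal b)" for b
  proof -
    have "(b \<ge> 0 \<and> ?L = ennreal b) \<longleftrightarrow>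
      ((\<lambda>v. (cmod (d (C v)))\<^sup>2 * f (C (g v))) absolutely_integrable_on S' \<and>
       integral S' (\<lambda>v. (cmod (d (C v)))\<^sup>2 * f (C (g v))) = b)"
      unfolding L by (rule absolutely_integrable_iff_nn_integral[symmetric]) (use nn in auto)
    also have "\<dots> \<longleftrightarrow>
      ((\<lambda>v. \<bar>det (matrix (g' v))\<bar> * f (C (g v))) absolutely_integrable_on S' \<and>
       integral S' (\<lambda>v. \<bar>det (matrix (g' v))\<bar> * f (C (g v))) = b)"
    proof (rule conj_cong)
      show "((\<lambda>v. (cmod (d (C v)))\<^sup>2 * f (C (g v))) absolutely_integrable_on S') =
        ((\<lambda>v. \<bar>det (matrix (g' v))\<bar> * f (C (g v))) absolutely_integrable_on S')"
        by (intro set_integrable_cong) (auto simp: det d_def S'_def)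
      have "integral S' (\<lambda>v. (cmod (d (C v)))\<^sup>2 * f (C (g v))) =
        integral S' (\<lambda>v. \<bar>det (matrix (g' v))\<bar> * f (C (g v)))"
        by (intro integral_cong) (auto simp: det d_def S'_def)
      then show "(integral S' (\<lambda>v. (cmod (d (C v)))\<^sup>2 * f (C (g v))) = b) =
        (integral S' (\<lambda>v. \<bar>det (matrix (g' v))\<bar> * f (C (g v))) = b)" by simp
    qed
    also have "\<dots> \<longleftrightarrow> ((\<lambda>v. f (C v)) absolutely_integrable_on (g ` S') \<and> integral (g ` S') (\<lambda>v. f (C v)) = b)"
      by (rule has_absolute_integral_change_of_variables_real_valued) (use der injg in auto)
    also have "\<dots> \<longleftrightarrow> (b \<ge> 0 \<and> ?R = ennreal b)"
      unfolding R by (rule absolutely_integrable_iff_nn_integral) (use nn in auto)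
    finally show ?thesis .
  qed
  show "?L = ?R"
  proof (cases ?L)
    case (real b)
    then show ?thesis using eq[of b] by auto
  next
    case top
    \<comment> \<open>If \<open>?R\<close> were finite, \<open>eq\<close> at its value would make
      \<open>?L\<close> finite as well.\<close>
    then show ?thesis using eq by (cases ?R) auto
  qed
qed

section \<open>The weighted area measure on the disc\<close>

definition bergman_weight :: "real \<Rightarrow> complex \<Rightarrow> real" where
  "bergman_weight \<alpha> z = (\<alpha> + 1) / pi * (1 - (cmod z)\<^sup>2) powr \<alpha>"

lemma disc_area_eq_density:
  "disc_area = density (restrict_space lborel (ball 0 1)) (\<lambda>_. ennreal (1 / pi))"
  unfolding disc_area_def
  by (rule measure_eqI) (auto simp: emeasure_density_const)

lemma space_disc_area [simp]: "space disc_area = ball 0 1"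
  by (simp add: disc_area_eq_density space_restrict_space)

lemma sets_disc_area [measurable_cong]: "sets disc_area = sets (restrict_space borel (ball 0 1))"
  by (auto simp: disc_area_def sets_restrict_space)

lemma space_bergman_measure [simp]: "space (bergman_measure \<alpha>) = ball 0 1"
  by (simp add: bergman_measure_def)

lemma sets_bergman_measure [measurable_cong]:
  "sets (bergman_measure \<alpha>) = sets (restrict_space borel (ball 0 1))"
  by (simp add: bergman_measure_def sets_disc_area)

lemma borel_measurable_disc_area:
  "f \<in> borel_measurable borel \<Longrightarrow> f \<in> borel_measurable disc_area"
  using measurable_cong_sets[OF sets_disc_area refl] measurable_restrict_space1 by blast

lemma borel_measurable_bergman:
  "f \<in> borel_measurable borel \<Longrightarrow> f \<in> borel_measurable (bergman_measure \<alpha>)"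
  using measurable_cong_sets[OF sets_bergman_measure refl] measurable_restrict_space1 by blast

lemma continuous_on_imp_measurable_bergman:
  "continuous_on (ball 0 1) f \<Longrightarrow> f \<in> borel_measurable (bergman_measure \<alpha>)"
  using measurable_cong_sets[OF sets_bergman_measure refl] borel_measurable_continuous_on_restrict by blast

lemma bergman_weight_nonneg [simp]: "\<alpha> > -1 \<Longrightarrow> bergman_weight \<alpha> z \<ge> 0"
  by (simp add: bergman_weight_def)

lemma bergman_weight_measurable [measurable]: "bergman_weight \<alpha> \<in> borel_measurable borel"
  unfolding bergman_weight_def by measurable

lemma nn_integral_disc_area:
  assumes "f \<in> borel_measurable borel"
  shows "(\<integral>\<^sup>+z. f z \<partial>disc_area) =
    (\<integral>\<^sup>+z. ennreal (1 / pi) * f z * indicator (ball 0 1) z \<partial>lborel)"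
proof -
  have m: "f \<in> borel_measurable (restrict_space lborel (ball 0 1))"
    using assms by (intro measurable_restrict_space1) simp
  have "(\<integral>\<^sup>+z. f z \<partial>disc_area) = (\<integral>\<^sup>+z. ennreal (1 / pi) * f z \<partial>restrict_space lborel (ball 0 1))"
    unfolding disc_area_eq_density using m by (subst nn_integral_density) auto
  also have "\<dots> = (\<integral>\<^sup>+z. ennreal (1 / pi) * f z * indicator (ball 0 1) z \<partial>lborel)"
    by (subst nn_integral_restrict_space) auto
  finally show ?thesis .
qed

lemma nn_integral_bergman:
  assumes "\<alpha> > -1" and [measurable]: "f \<in> borel_measurable borel"
  shows "(\<integral>\<^sup>+z. f z \<partial>bergman_measure \<alpha>) =
    (\<integral>\<^sup>+z. ennreal (bergman_weight \<alpha> z) * f z * indicator (ball 0 1) z \<partial>lborel)"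
proof -
  have "(\<integral>\<^sup>+z. f z \<partial>bergman_measure \<alpha>) =
     (\<integral>\<^sup>+z. ennreal ((\<alpha> + 1) * (1 - (cmod z)\<^sup>2) powr \<alpha>) * f z \<partial>disc_area)"
    unfolding bergman_measure_def by (intro nn_integral_density borel_measurable_disc_area) measurable
  also have "\<dots> = (\<integral>\<^sup>+z. ennreal (1 / pi) * (ennreal ((\<alpha> + 1) * (1 - (cmod z)\<^sup>2) powr \<alpha>) * f z)
        * indicator (ball 0 1) z \<partial>lborel)"
    by (intro nn_integral_disc_area) measurable
  also have "\<dots> = (\<integral>\<^sup>+z. ennreal (bergman_weight \<alpha> z) * f z * indicator (ball 0 1) z \<partial>lborel)"
    using assms
    by (intro nn_integral_cong)
       (simp add: bergman_weight_def ennreal_mult[symmetric] mult.assoc[symmetric])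
  finally show ?thesis .
qed

lemma emeasure_bergman:
  assumes "\<alpha> > -1" "A \<in> sets borel" "A \<subseteq> ball 0 1"
  shows "emeasure (bergman_measure \<alpha>) A =
    (\<integral>\<^sup>+z. ennreal (indicator (ball 0 1) z * (bergman_weight \<alpha> z * indicator A z)) \<partial>lborel)"
proof -
  have A: "A \<in> sets (bergman_measure \<alpha>)"
    using assms by (auto simp: sets_bergman_measure sets_restrict_space)
  have "emeasure (bergman_measure \<alpha>) A = (\<integral>\<^sup>+z. indicator A z \<partial>bergman_measure \<alpha>)"
    using A by simp
  also have "\<dots> = (\<integral>\<^sup>+z. ennreal (bergman_weight \<alpha> z) * indicator A z * indicator (ball 0 1) z \<partial>lborel)"
    using assms by (intro nn_integral_bergman) auto
  also have "\<dots> = (\<integral>\<^sup>+z. ennreal (indicator (ball 0 1) z * (bergman_weight \<alpha> z * indicator A z)) \<partial>lborel)"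
    by (intro nn_integral_cong) (auto simp: indicator_def)
  finally show ?thesis .
qed

text \<open>A rotation has Jacobian 1 and preserves both the disc and the weight. This invariance is
  the source of the orthogonality of the monomials.\<close>

lemma distr_bergman_rotation:
  assumes \<alpha>: "\<alpha> > -1" and c: "cmod c = 1"
  shows "distr (bergman_measure \<alpha>) (bergman_measure \<alpha>) (\<lambda>z. c * z) = bergman_measure \<alpha>"
proof (rule measure_eqI)
  have "(\<lambda>z. c * z) \<in> restrict_space borel (ball 0 1) \<rightarrow>\<^sub>M restrict_space borel (ball 0 1)"
    using c by (intro measurable_restrict_space3) (auto simp: norm_mult)
  then have m: "(\<lambda>z. c * z) \<in> bergman_measure \<alpha> \<rightarrow>\<^sub>M bergman_measure \<alpha>"
    using measurable_cong_sets[OF sets_bergman_measure sets_bergman_measure] by blast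
  fix A assume "A \<in> sets (distr (bergman_measure \<alpha>) (bergman_measure \<alpha>) (\<lambda>z. c * z))"
  then have A': "A \<in> sets (bergman_measure \<alpha>)" by simp
  then have A: "A \<in> sets borel" "A \<subseteq> ball 0 1"
    by (auto simp: sets_bergman_measure sets_restrict_space)
  have A2: "(\<lambda>z. c * z) -` A \<in> sets borel" "(\<lambda>z. c * z) -` A \<subseteq> ball 0 1"
  proof -
    have "(\<lambda>z. c * z) \<in> borel \<rightarrow>\<^sub>M borel" by measurable
    then show "(\<lambda>z. c * z) -` A \<in> sets borel"
      using A(1) by (metis measurable_sets_borel)
    show "(\<lambda>z. c * z) -` A \<subseteq> ball 0 1"
      using A(2) c by (auto simp: norm_mult subset_eq)
  qed
  have "emeasure (distr (bergman_measure \<alpha>) (bergman_measure \<alpha>) (\<lambda>z. c * z)) A =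
     emeasure (bergman_measure \<alpha>) ((\<lambda>z. c * z) -` A)"
    using m A' A2 by (simp add: emeasure_distr Int_absorb2)
  also have "\<dots> = (\<integral>\<^sup>+z. ennreal (indicator (ball 0 1) z * ((cmod (deriv ((*) c) z))\<^sup>2 *
      (bergman_weight \<alpha> (c * z) * indicator A (c * z)))) \<partial>lborel)"
  proof -
    have "deriv ((*) c) z = c" for z
      by (rule DERIV_imp_deriv) (auto intro!: derivative_eq_intros)
    then show ?thesis
      using emeasure_bergman[OF \<alpha> A2] c
      by (simp add: bergman_weight_def norm_mult indicator_def)
  qed
  also have "\<dots> = (\<integral>\<^sup>+w. ennreal (indicator ((*) c ` ball 0 1) w * (bergman_weight \<alpha> w * indicator A w)) \<partial>lborel)"
    using A c \<alpha> by (intro nn_integral_holomorphic_substitution) (auto intro!: holomorphic_intros inj_onI)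
  also have "(*) c ` ball 0 1 = ball 0 1"
  proof -
    have "c \<noteq> 0" using c by auto
    then have "w \<in> (*) c ` ball 0 1" if "cmod w < 1" for w
      using c that by (intro image_eqI[of _ _ "w / c"]) (simp_all add: norm_divide)
    moreover have "(*) c ` ball 0 1 \<subseteq> ball 0 1"
      using c by (simp add: image_subset_iff norm_mult)
    ultimately show ?thesis by auto
  qed
  also have "(\<integral>\<^sup>+w. ennreal (indicator (ball 0 1) w * (bergman_weight \<alpha> w * indicator A w)) \<partial>lborel)
     = emeasure (bergman_measure \<alpha>) A"
    using emeasure_bergman[OF \<alpha> A] by simp
  finally show "emeasure (distr (bergman_measure \<alpha>) (bergman_measure \<alpha>) (\<lambda>z. c * z)) A =
     emeasure (bergman_measure \<alpha>) A" .
qed simp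

text \<open>The annulus x < |z|^2 < 1 has area pi (1 - x), so |z|^2 is uniformly distributed, and
  radial integrals become integrals over [0, 1]. Comparing the measures of half-lines suffices,
  since these are finite.\<close>

lemma distr_disc_area_radial:
  "distr disc_area borel (\<lambda>z. (cmod z)\<^sup>2) = density lborel (indicator {0..1})"
proof (rule measure_eqI_lessThan)
  have m: "(\<lambda>z::complex. (cmod z)\<^sup>2) \<in> disc_area \<rightarrow>\<^sub>M borel"
    by (rule borel_measurable_disc_area) measurable
  have key: "emeasure (distr disc_area borel (\<lambda>z. (cmod z)\<^sup>2)) {x<..} = ennreal (min 1 (max 0 (1 - x)))" for x
  proof -
    have "emeasure (distr disc_area borel (\<lambda>z. (cmod z)\<^sup>2)) {x<..} =
       emeasure disc_area ({z. (cmod z)\<^sup>2 > x} \<inter> ball 0 1)"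
      using m by (subst emeasure_distr) (auto simp: vimage_def)
    also have "\<dots> = ennreal (1 / pi) * emeasure lborel ({z::complex. (cmod z)\<^sup>2 > x} \<inter> ball 0 1)"
      unfolding disc_area_def by (simp add: emeasure_restrict_space)
    also have "emeasure lborel ({z::complex. (cmod z)\<^sup>2 > x} \<inter> ball 0 1) = ennreal (pi * min 1 (max 0 (1 - x)))"
    proof (cases "x < 0")
      case True
      then have "{z::complex. (cmod z)\<^sup>2 > x} \<inter> ball 0 1 = ball 0 1"
        using less_le_trans[OF True zero_le_power2] by auto
      then show ?thesis using True by (simp add: emeasure_ball unit_ball_vol_2)
    next
      case x0: False
      show ?thesis
      proof (cases "x < 1")
        case True
        have s: "sqrt x \<ge> 0" "sqrt x < 1" using x0 True by auto
        have "{z::complex. (cmod z)\<^sup>2 > x} \<inter> ball 0 1 = ball 0 1 - cball 0 (sqrt x)"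
        proof -
          have "x < (cmod z)\<^sup>2 \<longleftrightarrow> \<not> cmod z \<le> sqrt x" for z
            using real_sqrt_less_iff[of x "(cmod z)\<^sup>2"] by (simp add: not_le)
          then show ?thesis by (intro set_eqI) (simp only: Int_iff Diff_iff mem_Collect_eq mem_ball mem_cball dist_0_norm, blast)
        qed
        also have "emeasure lborel \<dots> = emeasure lborel (ball (0::complex) 1) - emeasure lborel (cball (0::complex) (sqrt x))"
          using s le_less_trans[OF _ s(2)]
          by (intro emeasure_Diff) (simp_all add: emeasure_cball subset_iff)
        also have "\<dots> = ennreal (pi * (1 - x))"
          using s x0 by (simp add: emeasure_ball emeasure_cball unit_ball_vol_2 ennreal_minus right_diff_distrib)
        finally show ?thesis using True x0 by simp
      next
        case False
        have "\<not> x < (cmod z)\<^sup>2" if "cmod z < 1" for z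
          using that False power_mono[of "cmod z" 1 2] by simp
        then have "{z::complex. (cmod z)\<^sup>2 > x} \<inter> ball 0 1 = {}"
          by auto
        then show ?thesis using False by simp
      qed
    qed
    also have "ennreal (1 / pi) * ennreal (pi * min 1 (max 0 (1 - x))) = ennreal (min 1 (max 0 (1 - x)))"
      by (subst ennreal_mult[symmetric]) auto
    finally show ?thesis .
  qed
  show "emeasure (distr disc_area borel (\<lambda>z. (cmod z)\<^sup>2)) {x<..} < \<infinity>" for x
    unfolding key by simp
  fix x :: real
  have "emeasure (density lborel (indicator {0..1})) {x<..} = emeasure lborel ({0..1} \<inter> {x<..})"
    by (rule emeasure_restricted) auto
  also have "{0..1} \<inter> {x<..} = (if x < 0 then {0..1} else {x<..1})"
    by auto
  also have "emeasure lborel \<dots> = ennreal (min 1 (max 0 (1 - x)))"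
    by (cases "x < 0"; cases "x \<le> 1") (simp_all add: ennreal_neg max_def min_def)
  finally show "emeasure (distr disc_area borel (\<lambda>z. (cmod z)\<^sup>2)) {x<..} = emeasure (density lborel (indicator {0..1})) {x<..}"
    using key by simp
qed auto

lemma Gamma_plus1_pos: "x > 0 \<Longrightarrow> Gamma (x + 1) = x * Gamma (x::real)"
  by (rule Gamma_plus1) (auto dest: nonpos_Ints_nonpos)

text \<open>The squared norm of z^n in A^2_alpha. The reciprocals are the Taylor coefficients of (1
  - x)^(-(alpha + 2)), which for x = |z|^2 is the reproducing kernel on the diagonal.\<close>

definition bergman_moment :: "real \<Rightarrow> nat \<Rightarrow> real" where
  "bergman_moment \<alpha> n = fact n * Gamma (\<alpha> + 2) / Gamma (real n + \<alpha> + 2)"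

lemma bergman_moment_pos: "\<alpha> > -1 \<Longrightarrow> bergman_moment \<alpha> n > 0"
  by (simp add: bergman_moment_def)

lemma nn_integral_bergman_monomial:
  assumes \<alpha>: "\<alpha> > -1"
  shows "(\<integral>\<^sup>+z. ennreal ((cmod z) ^ (2 * n)) \<partial>bergman_measure \<alpha>) = ennreal (bergman_moment \<alpha> n)"
proof -
  have "(\<integral>\<^sup>+z. ennreal ((cmod z) ^ (2 * n)) \<partial>bergman_measure \<alpha>) =
     (\<integral>\<^sup>+z. ennreal ((\<alpha> + 1) * (1 - (cmod z)\<^sup>2) powr \<alpha>) * ennreal ((cmod z) ^ (2 * n)) \<partial>disc_area)"
    unfolding bergman_measure_def by (intro nn_integral_density borel_measurable_disc_area) measurable
  also have "\<dots> = (\<integral>\<^sup>+z. ennreal ((\<alpha> + 1) * (1 - (cmod z)\<^sup>2) powr \<alpha> * ((cmod z)\<^sup>2) ^ n) \<partial>disc_area)"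
    using \<alpha> by (intro nn_integral_cong) (simp add: ennreal_mult[symmetric] power_mult)
  also have "\<dots> = (\<integral>\<^sup>+x. ennreal ((\<alpha> + 1) * (1 - x) powr \<alpha> * x ^ n) \<partial>distr disc_area borel (\<lambda>z. (cmod z)\<^sup>2))"
    by (subst nn_integral_distr) (auto intro!: borel_measurable_disc_area)
  also have "\<dots> = (\<integral>\<^sup>+x. indicator {0..1} x * ennreal ((\<alpha> + 1) * (1 - x) powr \<alpha> * x ^ n) \<partial>lborel)"
    unfolding distr_disc_area_radial by (subst nn_integral_density) auto
  also have "\<dots> = (\<integral>\<^sup>+x. ennreal (indicator {0..1} x * ((\<alpha> + 1) * (x powr (real (Suc n) - 1) * (1 - x) powr (\<alpha> + 1 - 1)))) \<partial>lborel)"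
  \<comment> \<open>For n = 0 the two integrands differ at x = 0, since \<open>0 ^ 0 = 1\<close> but
    \<open>0 powr 0 = 0\<close>.\<close>
  proof (rule nn_integral_cong_AE, use AE_lborel_singleton[of 0] in eventually_elim)
    case (elim x)
    then show ?case
      by (auto simp: indicator_def powr_realpow mult_ac)
  qed
  also have "\<dots> = ennreal ((\<alpha> + 1) * Beta (real (Suc n)) (\<alpha> + 1))"
    using \<alpha>
    by (intro nn_integral_has_integral_lebesgue has_integral_mult_right has_integral_Beta_real) auto
  also have "(\<alpha> + 1) * Beta (real (Suc n)) (\<alpha> + 1) = bergman_moment \<alpha> n"
  proof -
    have "Gamma (\<alpha> + 2) = (\<alpha> + 1) * Gamma (\<alpha> + 1)"
      using Gamma_plus1_pos[of "\<alpha> + 1"] \<alpha> by (simp add: add.assoc)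
    moreover have "Gamma (real (Suc n)) = fact n"
      using Gamma_fact[of n, where 'a=real] by (simp add: add.commute)
    ultimately show ?thesis
      by (simp add: Beta_def bergman_moment_def add_ac)
  qed
  finally show ?thesis .
qed

lemma bergman_moment_0: "\<alpha> > -1 \<Longrightarrow> bergman_moment \<alpha> 0 = 1"
  using Gamma_real_pos[of "\<alpha> + 2"] by (simp add: bergman_moment_def less_imp_neq[symmetric])

lemma emeasure_bergman_space: "\<alpha> > -1 \<Longrightarrow> emeasure (bergman_measure \<alpha>) (ball 0 1) = 1"
  using nn_integral_bergman_monomial[of \<alpha> 0]
  by (simp add: bergman_moment_0)

lemma finite_measure_bergman: "\<alpha> > -1 \<Longrightarrow> finite_measure (bergman_measure \<alpha>)"
  by (rule finite_measureI) (simp add: emeasure_bergman_space)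

lemma integrable_bergman_bounded:
  fixes f :: "complex \<Rightarrow> 'a::{banach, second_countable_topology}"
  assumes "\<alpha> > -1" "f \<in> borel_measurable (bergman_measure \<alpha>)"
    and "\<And>z. cmod z < 1 \<Longrightarrow> norm (f z) \<le> C"
  shows "integrable (bergman_measure \<alpha>) f"
proof -
  interpret finite_measure "bergman_measure \<alpha>"
    using assms(1) by (rule finite_measure_bergman)
  show ?thesis
    by (rule integrable_const_bound[of _ C]) (use assms in auto)
qed

section \<open>Parseval's identity\<close>

text \<open>Coefficients are kept in the type of formal power series because those of f^m are then
  the coefficients of the ring power \<open>F ^ m\<close>.\<close>

definition has_disc_fps :: "complex fps \<Rightarrow> (complex \<Rightarrow> complex) \<Rightarrow> bool" where
  "has_disc_fps F f \<longleftrightarrow> (\<forall>z. cmod z < 1 \<longrightarrow> (\<lambda>n. fps_nth F n * z ^ n) sums f z)"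

lemma has_disc_fps_conv_radius:
  assumes "has_disc_fps F f"
  shows "fps_conv_radius F \<ge> 1"
  unfolding fps_conv_radius_def
proof (rule conv_radius_geI_ex)
  fix r :: real assume "0 < r" "ereal r < 1"
  then show "\<exists>z. norm z = r \<and> summable (\<lambda>n. fps_nth F n * z ^ n)"
    using assms unfolding has_disc_fps_def
    by (intro exI[of _ "of_real r"]) (auto simp: sums_iff)
qed

lemma has_disc_fps_norm_less_conv_radius:
  assumes "has_disc_fps F f" "cmod z < 1"
  shows "ereal (norm z) < fps_conv_radius F"
  by (rule less_le_trans[OF _ has_disc_fps_conv_radius[OF assms(1)]]) (use assms(2) in simp)

lemma has_disc_fps_eval:
  assumes "has_disc_fps F f" "cmod z < 1"
  shows "eval_fps F z = f z"
  using assms unfolding has_disc_fps_def eval_fps_def by (auto simp: sums_iff)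

lemma has_disc_fps_eval_fps:
  assumes "fps_conv_radius F \<ge> 1"
  shows "has_disc_fps F (eval_fps F)"
  unfolding has_disc_fps_def
  by (intro allI impI sums_eval_fps) (rule less_le_trans[OF _ assms], simp)

lemma has_disc_fps_cong:
  assumes "has_disc_fps F f" "\<And>z. cmod z < 1 \<Longrightarrow> f z = g z"
  shows "has_disc_fps F g"
  using assms unfolding has_disc_fps_def by simp

lemma has_disc_fps_holomorphic:
  assumes "has_disc_fps F f"
  shows "f holomorphic_on ball 0 1"
proof -
  have "eval_fps F holomorphic_on ball 0 1"
    by (rule holomorphic_on_eval_fps)
       (use has_disc_fps_norm_less_conv_radius[OF assms] in auto)
  then show ?thesis
    by (rule holomorphic_transform) (use has_disc_fps_eval[OF assms] in auto)
qed

lemma holomorphic_has_disc_fps: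
  assumes "f holomorphic_on ball 0 1"
  obtains F where "has_disc_fps F f"
proof
  have h: "f holomorphic_on eball 0 (ereal 1)" using assms by simp
  have "fps_conv_radius (fps_expansion f 0) \<ge> 1"
    using conv_radius_fps_expansion[OF h] by (simp add: one_ereal_def)
  then have "has_disc_fps (fps_expansion f 0) (eval_fps (fps_expansion f 0))"
    by (rule has_disc_fps_eval_fps)
  then show "has_disc_fps (fps_expansion f 0) f"
    by (rule has_disc_fps_cong) (use eval_fps_expansion'[OF h] in auto)
qed

lemma has_disc_fps_power:
  assumes "has_disc_fps F f"
  shows "has_disc_fps (F ^ m) (\<lambda>z. f z ^ m)"
proof -
  have "fps_conv_radius (F ^ m) \<ge> 1"
    using has_disc_fps_conv_radius[OF assms] fps_conv_radius_power[of F m] by (rule order_trans)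
  then show ?thesis
    by (rule has_disc_fps_cong[OF has_disc_fps_eval_fps])
       (simp add: eval_fps_power has_disc_fps_norm_less_conv_radius[OF assms] has_disc_fps_eval[OF assms])
qed

lemma has_disc_fps_poly: "has_disc_fps (fps_of_poly q) (poly q)"
  by (rule has_disc_fps_cong[OF has_disc_fps_eval_fps]) simp_all

lemma has_disc_fps_dilate:
  assumes "has_disc_fps F f" "0 \<le> r" "r \<le> 1"
  shows "has_disc_fps (Abs_fps (\<lambda>n. fps_nth F n * of_real r ^ n)) (\<lambda>z. f (of_real r * z))"
  unfolding has_disc_fps_def
proof (intro allI impI)
  fix z :: complex assume z: "cmod z < 1"
  have "cmod (of_real r * z) \<le> 1 * cmod z"
    unfolding norm_mult using assms by (intro mult_right_mono) auto
  then have "(\<lambda>n. fps_nth F n * (of_real r * z) ^ n) sums f (of_real r * z)"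
    using assms(1) z unfolding has_disc_fps_def by auto
  then show "(\<lambda>n. fps_nth (Abs_fps (\<lambda>n. fps_nth F n * of_real r ^ n)) n * z ^ n) sums f (of_real r * z)"
    by (simp add: power_mult_distrib mult.assoc)
qed

lemma pred_mem_ball [measurable]: "Measurable.pred borel (\<lambda>x::complex. x \<in> ball c r)"
  by (rule pred_sets2[of "ball c r" borel]) auto

lemma cnj_borel_measurable [measurable]: "cnj \<in> borel_measurable borel"
  by (intro borel_measurable_continuous_onI continuous_intros)

lemma integral_bergman_rotation:
  fixes f :: "complex \<Rightarrow> complex"
  assumes "\<alpha> > -1" "cmod c = 1" "f \<in> borel_measurable (bergman_measure \<alpha>)"
  shows "(LINT z|bergman_measure \<alpha>. f (c * z)) = (LINT z|bergman_measure \<alpha>. f z)"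
proof -
  have "(\<lambda>z. c * z) \<in> restrict_space borel (ball 0 1) \<rightarrow>\<^sub>M restrict_space borel (ball 0 1)"
    using assms(2) by (intro measurable_restrict_space3) (auto simp: norm_mult)
  then have "(\<lambda>z. c * z) \<in> bergman_measure \<alpha> \<rightarrow>\<^sub>M bergman_measure \<alpha>"
    using measurable_cong_sets[OF sets_bergman_measure sets_bergman_measure] by blast
  then show ?thesis
    using integral_distr[OF _ assms(3)] distr_bergman_rotation[OF assms(1,2)] by metis
qed

text \<open>Rotation by a unimodular c multiplies the integrand by c^(n - k); for the angle pi / (n
  - k) this is -1, so the integral equals its own negative. The cut-off to a concentric ball is
  rotation invariant.\<close>

lemma bergman_monomials_orthogonal:
  assumes "\<alpha> > -1" "n \<noteq> k"
  shows "(LINT z|bergman_measure \<alpha>. of_real (indicator (ball 0 r) z) * (z ^ n * cnj z ^ k)) = 0"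
proof -
  define c where "c = cis (pi / (real n - real k))"
  define f where "f = (\<lambda>z::complex. complex_of_real (indicator (ball 0 r) z) * (z ^ n * cnj z ^ k))"
  have nk: "real n - real k \<noteq> 0" using assms(2) by simp
  have "c ^ n * cnj c ^ k = cis (real n * (pi / (real n - real k)) + real k * (- (pi / (real n - real k))))"
    unfolding c_def by (simp only: Complex.DeMoivre cis_mult cis_cnj)
  also have "real n * (pi / (real n - real k)) + real k * (- (pi / (real n - real k))) = pi"
    using nk by (simp only: mult_minus_right times_divide_eq_right diff_divide_distrib[symmetric]
        left_diff_distrib[symmetric] add_uminus_conv_diff) simp
  finally have ck: "c ^ n * cnj c ^ k = -1" by simp
  have c1: "cmod c = 1" by (simp add: c_def)
  have "f (c * z) = - f z" for z
  proof -
    have "f (c * z) = (c ^ n * cnj c ^ k) * f z"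
      by (simp add: f_def indicator_def norm_mult c1 power_mult_distrib mult_ac)
    then show ?thesis by (simp add: ck)
  qed
  moreover have "f \<in> borel_measurable (bergman_measure \<alpha>)"
    unfolding f_def by (rule borel_measurable_bergman) measurable
  ultimately have "- (LINT z|bergman_measure \<alpha>. f z) = (LINT z|bergman_measure \<alpha>. f z)"
    using integral_bergman_rotation[OF assms(1) c1, of f] by simp
  then show ?thesis
    unfolding f_def by (simp add: equal_neg_zero)
qed

text \<open>On |z| < r < 1 all partial sums are bounded by the absolutely convergent series at r, so
  the finite identity, which is orthogonality, passes to the limit by dominated convergence.\<close>

lemma bergman_parseval_ball:
  fixes F :: "complex fps"
  assumes \<alpha>: "\<alpha> > -1" and F: "has_disc_fps F f" and r: "0 < r" "r < 1"
  shows "(\<lambda>n. (cmod (fps_nth F n))\<^sup>2 * (LINT z|bergman_measure \<alpha>. indicator (ball 0 r) z * cmod z ^ (2 * n)))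
    sums (LINT z|bergman_measure \<alpha>. indicator (ball 0 r) z * (cmod (f z))\<^sup>2)"
proof -
  let ?M = "bergman_measure \<alpha>"
  let ?I = "\<lambda>z::complex. indicator (ball 0 r) z :: real"
  define u where "u = (\<lambda>N z. \<Sum>n<N. fps_nth F n * z ^ n)"
  define K where "K = (\<Sum>n. cmod (fps_nth F n * of_real r ^ n))"
  have sK: "summable (\<lambda>n. cmod (fps_nth F n * of_real r ^ n))"
    by (rule norm_summable_fps) (use has_disc_fps_norm_less_conv_radius[OF F, of "of_real r"] r in auto)
  have uK: "cmod (u N z) \<le> K" if "cmod z < r" for N z
  proof -
    have "cmod (u N z) \<le> (\<Sum>n<N. cmod (fps_nth F n * z ^ n))"
      unfolding u_def by (rule norm_sum)
    also have "\<dots> \<le> (\<Sum>n<N. cmod (fps_nth F n * of_real r ^ n))"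
      using that by (intro sum_mono) (auto simp: norm_mult norm_power intro!: mult_left_mono power_mono)
    also have "\<dots> \<le> K"
      unfolding K_def by (rule sum_le_suminf[OF sK]) auto
    finally show ?thesis .
  qed
  have fin: "(LINT z|?M. ?I z * (cmod (u N z))\<^sup>2) =
     (\<Sum>n<N. (cmod (fps_nth F n))\<^sup>2 * (LINT z|?M. ?I z * cmod z ^ (2 * n)))" for N
  proof -
    have int: "integrable ?M (\<lambda>z. complex_of_real (?I z) * (z ^ n * cnj z ^ k))" for n k
    proof (rule integrable_bergman_bounded[OF \<alpha>, of _ 1])
      show "(\<lambda>z. complex_of_real (?I z) * (z ^ n * cnj z ^ k)) \<in> borel_measurable ?M"
        by (rule borel_measurable_bergman) measurable
      fix z :: complex assume z: "cmod z < 1"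
      have "cmod z ^ n * cmod z ^ k \<le> 1 * 1"
        using z by (intro mult_mono power_le_one) auto
      then show "cmod (complex_of_real (?I z) * (z ^ n * cnj z ^ k)) \<le> 1"
        by (simp add: norm_mult norm_power indicator_def)
    qed
    have "complex_of_real (LINT z|?M. ?I z * (cmod (u N z))\<^sup>2) =
       (LINT z|?M. complex_of_real (?I z * (cmod (u N z))\<^sup>2))"
      by (rule integral_complex_of_real[symmetric])
    also have "\<dots> = (LINT z|?M. (\<Sum>n<N. \<Sum>k<N. fps_nth F n * cnj (fps_nth F k) *
        (complex_of_real (?I z) * (z ^ n * cnj z ^ k))))"
    proof (rule Bochner_Integration.integral_cong[OF refl])
      fix z
      have "complex_of_real ((cmod (u N z))\<^sup>2) = u N z * cnj (u N z)"
        using complex_norm_square[of "u N z"] by simp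
      also have "\<dots> = (\<Sum>n<N. \<Sum>k<N. (fps_nth F n * z ^ n) * (cnj (fps_nth F k) * cnj z ^ k))"
        unfolding u_def cnj_sum complex_cnj_mult complex_cnj_power by (rule sum_product)
      finally show "complex_of_real (?I z * (cmod (u N z))\<^sup>2) =
        (\<Sum>n<N. \<Sum>k<N. fps_nth F n * cnj (fps_nth F k) * (complex_of_real (?I z) * (z ^ n * cnj z ^ k)))"
        by (simp add: sum_distrib_left mult_ac)
    qed
    also have "\<dots> = (\<Sum>n<N. \<Sum>k<N. fps_nth F n * cnj (fps_nth F k) *
        (LINT z|?M. complex_of_real (?I z) * (z ^ n * cnj z ^ k)))"
      using int by (simp add: Bochner_Integration.integral_sum integrable_mult_right Bochner_Integration.integrable_sum)
    also have "\<dots> = (\<Sum>n<N. \<Sum>k<N. if k = n then fps_nth F n * cnj (fps_nth F n) *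
        (LINT z|?M. complex_of_real (?I z) * (z ^ n * cnj z ^ n)) else 0)"
      by (intro sum.cong refl) (auto simp: bergman_monomials_orthogonal[OF \<alpha>])
    also have "\<dots> = (\<Sum>n<N. fps_nth F n * cnj (fps_nth F n) *
        (LINT z|?M. complex_of_real (?I z) * (z ^ n * cnj z ^ n)))"
      by (intro sum.cong refl) (simp add: sum.delta)
    also have "\<dots> = (\<Sum>n<N. complex_of_real ((cmod (fps_nth F n))\<^sup>2 * (LINT z|?M. ?I z * cmod z ^ (2 * n))))"
    proof (intro sum.cong refl)
      fix n
      have "z ^ n * cnj z ^ n = complex_of_real (cmod z ^ (2 * n))" for z
        using complex_norm_square[of z] by (simp add: power_mult power_mult_distrib)
      then have "(LINT z|?M. complex_of_real (?I z) * (z ^ n * cnj z ^ n)) =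
          (LINT z|?M. complex_of_real (?I z * cmod z ^ (2 * n)))"
        by simp
      also have "\<dots> = complex_of_real (LINT z|?M. ?I z * cmod z ^ (2 * n))"
        by (rule integral_complex_of_real)
      finally show "fps_nth F n * cnj (fps_nth F n) *
        (LINT z|?M. complex_of_real (?I z) * (z ^ n * cnj z ^ n)) =
        complex_of_real ((cmod (fps_nth F n))\<^sup>2 * (LINT z|?M. ?I z * cmod z ^ (2 * n)))"
        using complex_norm_square[of "fps_nth F n"] by simp
    qed
    finally show ?thesis
      by (simp only: of_real_sum[symmetric] of_real_eq_iff)
  qed
  have cf: "continuous_on (ball 0 1) f"
    using has_disc_fps_holomorphic[OF F] by (rule holomorphic_on_imp_continuous_on)
  have "(\<lambda>N. LINT z|?M. ?I z * (cmod (u N z))\<^sup>2) \<longlonglongrightarrow> (LINT z|?M. ?I z * (cmod (f z))\<^sup>2)"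
  proof (rule integral_dominated_convergence[where w="\<lambda>_. K\<^sup>2"])
    have mI: "?I \<in> borel_measurable ?M"
      by (rule borel_measurable_bergman) measurable
    have "(\<lambda>z. (cmod (f z))\<^sup>2) \<in> borel_measurable ?M"
      by (rule continuous_on_imp_measurable_bergman) (intro continuous_intros cf)
    then show "(\<lambda>z. ?I z * (cmod (f z))\<^sup>2) \<in> borel_measurable ?M"
      by (rule borel_measurable_times[OF mI])
    show "(\<lambda>z. ?I z * (cmod (u N z))\<^sup>2) \<in> borel_measurable ?M" for N
      unfolding u_def by (rule borel_measurable_bergman) measurable
    show "integrable ?M (\<lambda>_. K\<^sup>2)"
      by (rule integrable_bergman_bounded[OF \<alpha>, of _ "K\<^sup>2"]) auto
    show "AE z in ?M. (\<lambda>N. ?I z * (cmod (u N z))\<^sup>2) \<longlonglongrightarrow> ?I z * (cmod (f z))\<^sup>2"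
    proof (rule AE_I2)
      fix z assume "z \<in> space ?M"
      then have "(\<lambda>N. u N z) \<longlonglongrightarrow> f z"
        using F unfolding has_disc_fps_def u_def sums_def by auto
      then show "(\<lambda>N. ?I z * (cmod (u N z))\<^sup>2) \<longlonglongrightarrow> ?I z * (cmod (f z))\<^sup>2"
        by (intro tendsto_intros)
    qed
    show "AE z in ?M. norm (?I z * (cmod (u N z))\<^sup>2) \<le> K\<^sup>2" for N
    proof (rule AE_I2)
      fix z
      show "norm (?I z * (cmod (u N z))\<^sup>2) \<le> K\<^sup>2"
      proof (cases "cmod z < r")
        case True
        then show ?thesis using power_mono[OF uK[OF True, of N], of 2] by simp
      qed simp
    qed
  qed
  then show ?thesis
    unfolding sums_def fin .
qed

text \<open>Exhaustion of the disc by concentric balls. The radii start at 1/2, so that each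
  satisfies the condition 0 < r < 1 of \<open>bergman_parseval_ball\<close>.\<close>

lemma nn_integral_bergman_SUP:
  fixes g :: "complex \<Rightarrow> real"
  assumes "g \<in> borel_measurable (bergman_measure \<alpha>)" "\<And>z. g z \<ge> 0"
  shows "(\<integral>\<^sup>+z. ennreal (g z) \<partial>bergman_measure \<alpha>) =
    (SUP j. \<integral>\<^sup>+z. ennreal (indicator (ball 0 (1 - 1 / real (j + 2))) z * g z) \<partial>bergman_measure \<alpha>)"
    and "incseq (\<lambda>j. \<integral>\<^sup>+z. ennreal (indicator (ball 0 (1 - 1 / real (j + 2))) z * g z) \<partial>bergman_measure \<alpha>)"
proof -
  let ?f = "\<lambda>j z. ennreal (indicator (ball 0 (1 - 1 / real (j + 2))) z * g z)"
  have inc: "incseq ?f"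
  proof (intro incseq_SucI le_funI ennreal_leI mult_right_mono)
    fix j z
    have "1 - 1 / real (j + 2) \<le> 1 - 1 / real (Suc j + 2)"
      by (simp add: frac_le)
    then show "indicator (ball 0 (1 - 1 / real (j + 2))) z \<le> (indicator (ball 0 (1 - 1 / real (Suc j + 2))) z :: real)"
      by (auto simp: indicator_def)
  qed (use assms in auto)
  have m: "?f j \<in> borel_measurable (bergman_measure \<alpha>)" for j
  proof -
    have "(indicator (ball 0 (1 - 1 / real (j + 2))) :: complex \<Rightarrow> real) \<in> borel_measurable (bergman_measure \<alpha>)"
      by (rule borel_measurable_bergman) measurable
    then have "(\<lambda>z. indicator (ball 0 (1 - 1 / real (j + 2))) z * g z) \<in> borel_measurable (bergman_measure \<alpha>)"
      using assms(1) by (rule borel_measurable_times)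
    then show ?thesis by measurable
  qed
  have "(\<integral>\<^sup>+z. ennreal (g z) \<partial>bergman_measure \<alpha>) = (\<integral>\<^sup>+z. (SUP j. ?f j z) \<partial>bergman_measure \<alpha>)"
  proof (rule nn_integral_cong)
    fix z assume "z \<in> space (bergman_measure \<alpha>)"
    then have z: "cmod z < 1" by simp
    then obtain j where j: "inverse (real (Suc j)) < 1 - cmod z"
      using reals_Archimedean[of "1 - cmod z"] by auto
    have "1 / real (j + 2) \<le> inverse (real (Suc j))"
      by (simp add: field_simps)
    then have *: "?f j z = ennreal (g z)"
      using j by (simp add: indicator_def)
    show "ennreal (g z) = (SUP j. ?f j z)"
    proof (rule antisym)
      show "ennreal (g z) \<le> (SUP j. ?f j z)"
        unfolding *[symmetric] by (rule SUP_upper) simp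
      show "(SUP j. ?f j z) \<le> ennreal (g z)"
        by (rule SUP_least) (use assms in \<open>auto simp: indicator_def\<close>)
    qed
  qed
  also have "\<dots> = (SUP j. \<integral>\<^sup>+z. ?f j z \<partial>bergman_measure \<alpha>)"
    by (rule nn_integral_monotone_convergence_SUP[OF inc m])
  finally show "(\<integral>\<^sup>+z. ennreal (g z) \<partial>bergman_measure \<alpha>) = (SUP j. \<integral>\<^sup>+z. ?f j z \<partial>bergman_measure \<alpha>)" .
  show "incseq (\<lambda>j. \<integral>\<^sup>+z. ?f j z \<partial>bergman_measure \<alpha>)"
    using inc by (auto simp: incseq_def le_fun_def intro!: nn_integral_mono)
qed

text \<open>Every moment over a ball increases with the radius, so the supremum may be exchanged
  with the series. Since both sides live in \<open>ennreal\<close> and may be infinite, the identity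
  also serves to establish membership in the space.\<close>

theorem bergman_parseval:
  assumes \<alpha>: "\<alpha> > -1" and F: "has_disc_fps F f"
  shows "(\<integral>\<^sup>+z. ennreal ((cmod (f z))\<^sup>2) \<partial>bergman_measure \<alpha>) =
    (\<Sum>n. ennreal ((cmod (fps_nth F n))\<^sup>2 * bergman_moment \<alpha> n))"
proof -
  let ?M = "bergman_measure \<alpha>"
  let ?r = "\<lambda>j::nat. 1 - 1 / real (j + 2)"
  have cf: "continuous_on (ball 0 1) f"
    using has_disc_fps_holomorphic[OF F] by (rule holomorphic_on_imp_continuous_on)
  have mf: "(\<lambda>z. (cmod (f z))\<^sup>2) \<in> borel_measurable ?M"
    by (rule continuous_on_imp_measurable_bergman) (intro continuous_intros cf)
  have mz: "(\<lambda>z. cmod z ^ (2 * n)) \<in> borel_measurable ?M" for n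
    by (rule borel_measurable_bergman) measurable
  have mI: "(indicator (ball 0 (?r j)) :: complex \<Rightarrow> real) \<in> borel_measurable ?M" for j
    by (rule borel_measurable_bergman) measurable
  have r: "0 < ?r j" "?r j < 1" for j by (simp_all add: field_simps)
  obtain B where B: "cmod (f z) \<le> B j" if "z \<in> ball 0 (?r j)" for j z
  proof -
    have "\<exists>b. \<forall>z\<in>ball 0 (?r j). cmod (f z) \<le> b" for j
    proof -
      have "compact (f ` cball 0 (?r j))"
        using le_less_trans[OF _ r(2)[of j]]
        by (intro compact_continuous_image continuous_on_subset[OF cf]) (simp_all add: subset_iff)
      then have "bounded (f ` cball 0 (?r j))" by (rule compact_imp_bounded)
      then show ?thesis unfolding bounded_iff by fastforce
    qed
    then show ?thesis using that by metis
  qed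
  have J: "(\<integral>\<^sup>+z. ennreal (indicator (ball 0 (?r j)) z * (cmod (f z))\<^sup>2) \<partial>?M) =
     (\<Sum>n. ennreal ((cmod (fps_nth F n))\<^sup>2) * (\<integral>\<^sup>+z. ennreal (indicator (ball 0 (?r j)) z * cmod z ^ (2 * n)) \<partial>?M))" for j
  proof -
    have i1: "integrable ?M (\<lambda>z. indicator (ball 0 (?r j)) z * (cmod (f z))\<^sup>2)"
    proof (rule integrable_bergman_bounded[OF \<alpha>, of _ "(B j)\<^sup>2"])
      show "(\<lambda>z. indicator (ball 0 (?r j)) z * (cmod (f z))\<^sup>2) \<in> borel_measurable ?M"
        by (rule borel_measurable_times[OF mI mf])
      fix z
      show "norm (indicator (ball 0 (?r j)) z * (cmod (f z))\<^sup>2) \<le> (B j)\<^sup>2"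
      proof (cases "z \<in> ball 0 (?r j)")
        case True
        then show ?thesis using power_mono[OF B[OF True], of 2] by simp
      qed simp
    qed
    have i2: "integrable ?M (\<lambda>z. indicator (ball 0 (?r j)) z * cmod z ^ (2 * n))" for n
    proof (rule integrable_bergman_bounded[OF \<alpha>, of _ 1])
      show "(\<lambda>z. indicator (ball 0 (?r j)) z * cmod z ^ (2 * n)) \<in> borel_measurable ?M"
        by (rule borel_measurable_times[OF mI mz])
      fix z :: complex assume "cmod z < 1"
      then show "norm (indicator (ball 0 (?r j)) z * cmod z ^ (2 * n)) \<le> 1"
        by (auto simp: indicator_def power_le_one)
    qed
    have "(\<integral>\<^sup>+z. ennreal (indicator (ball 0 (?r j)) z * (cmod (f z))\<^sup>2) \<partial>?M) =
       ennreal (LINT z|?M. indicator (ball 0 (?r j)) z * (cmod (f z))\<^sup>2)"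
      by (rule nn_integral_eq_integral[OF i1]) simp
    also have "\<dots> = (\<Sum>n. ennreal ((cmod (fps_nth F n))\<^sup>2 * (LINT z|?M. indicator (ball 0 (?r j)) z * cmod z ^ (2 * n))))"
      by (rule suminf_ennreal_eq[symmetric, OF _ bergman_parseval_ball[OF \<alpha> F r]]) simp
    also have "\<dots> = (\<Sum>n. ennreal ((cmod (fps_nth F n))\<^sup>2) * (\<integral>\<^sup>+z. ennreal (indicator (ball 0 (?r j)) z * cmod z ^ (2 * n)) \<partial>?M))"
    proof (rule arg_cong[where f=suminf], rule ext)
      fix n
      show "ennreal ((cmod (fps_nth F n))\<^sup>2 * (LINT z|?M. indicator (ball 0 (?r j)) z * cmod z ^ (2 * n))) =
        ennreal ((cmod (fps_nth F n))\<^sup>2) * (\<integral>\<^sup>+z. ennreal (indicator (ball 0 (?r j)) z * cmod z ^ (2 * n)) \<partial>?M)"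
        by (subst nn_integral_eq_integral[OF i2]) (auto simp: ennreal_mult' )
    qed
    finally show ?thesis .
  qed
  have "(\<integral>\<^sup>+z. ennreal ((cmod (f z))\<^sup>2) \<partial>?M) =
    (SUP j. \<integral>\<^sup>+z. ennreal (indicator (ball 0 (?r j)) z * (cmod (f z))\<^sup>2) \<partial>?M)"
    by (rule nn_integral_bergman_SUP(1)[OF mf]) simp
  also have "\<dots> = (SUP j. \<Sum>n. ennreal ((cmod (fps_nth F n))\<^sup>2) * (\<integral>\<^sup>+z. ennreal (indicator (ball 0 (?r j)) z * cmod z ^ (2 * n)) \<partial>?M))"
    unfolding J ..
  also have "\<dots> = (\<Sum>n. SUP j. ennreal ((cmod (fps_nth F n))\<^sup>2) * (\<integral>\<^sup>+z. ennreal (indicator (ball 0 (?r j)) z * cmod z ^ (2 * n)) \<partial>?M))"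
  proof (rule ennreal_suminf_SUP_eq[symmetric])
    fix n
    have "incseq (\<lambda>j. \<integral>\<^sup>+z. ennreal (indicator (ball 0 (?r j)) z * cmod z ^ (2 * n)) \<partial>?M)"
      by (rule nn_integral_bergman_SUP(2)[OF mz]) simp
    then show "incseq (\<lambda>j. ennreal ((cmod (fps_nth F n))\<^sup>2) * (\<integral>\<^sup>+z. ennreal (indicator (ball 0 (?r j)) z * cmod z ^ (2 * n)) \<partial>?M))"
      by (auto simp: incseq_def intro!: mult_left_mono)
  qed
  also have "\<dots> = (\<Sum>n. ennreal ((cmod (fps_nth F n))\<^sup>2 * bergman_moment \<alpha> n))"
  proof (rule arg_cong[where f=suminf], rule ext)
    fix n
    have "(SUP j. \<integral>\<^sup>+z. ennreal (indicator (ball 0 (?r j)) z * cmod z ^ (2 * n)) \<partial>?M) = ennreal (bergman_moment \<alpha> n)"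
      using nn_integral_bergman_SUP(1)[OF mz[of n]] nn_integral_bergman_monomial[OF \<alpha>, of n] by simp
    then show "(SUP j. ennreal ((cmod (fps_nth F n))\<^sup>2) * (\<integral>\<^sup>+z. ennreal (indicator (ball 0 (?r j)) z * cmod z ^ (2 * n)) \<partial>?M)) =
      ennreal ((cmod (fps_nth F n))\<^sup>2 * bergman_moment \<alpha> n)"
      using bergman_moment_pos[OF \<alpha>, of n] by (simp add: SUP_mult_left_ennreal[symmetric] ennreal_mult)
  qed
  finally show ?thesis .
qed

section \<open>Bergman spaces with even exponent\<close>

lemma one_minus_powr_real_sums:
  fixes x s :: real
  assumes "\<bar>x\<bar> < 1"
  shows "(\<lambda>n. pochhammer s n / fact n * x ^ n) sums (1 - x) powr (- s)"
proof -
  have "(\<lambda>n. (- s gchoose n) * (- x) ^ n) sums (1 + (- x)) powr (- s)"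
    by (rule gen_binomial_real) (use assms in simp)
  moreover have "(- s gchoose n) * (- x) ^ n = pochhammer s n / fact n * x ^ n" for n
    by (cases "even n") (simp_all add: gbinomial_pochhammer)
  ultimately show ?thesis by simp
qed

lemma one_minus_powr_complex_sums:
  fixes x s :: complex
  assumes "norm x < 1"
  shows "(\<lambda>n. pochhammer s n / fact n * x ^ n) sums (1 - x) powr (- s)"
proof -
  have "(\<lambda>n. (- s gchoose n) * (- x) ^ n) sums (1 + (- x)) powr (- s)"
    by (rule gen_binomial_complex) (use assms in simp)
  moreover have "(- s gchoose n) * (- x) ^ n = pochhammer s n / fact n * x ^ n" for n
    by (cases "even n") (simp_all add: gbinomial_pochhammer)
  ultimately show ?thesis by simp
qed

lemma pochhammer_eq_Gamma_quotient:
  fixes x :: real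
  assumes "x > 0"
  shows "pochhammer x n = Gamma (x + real n) / Gamma x"
  by (rule pochhammer_Gamma) (use assms in auto)

lemma bergman_moment_eq_pochhammer:
  assumes "\<alpha> > -1"
  shows "bergman_moment \<alpha> n = fact n / pochhammer (\<alpha> + 2) n"
  using assms by (simp add: bergman_moment_def pochhammer_eq_Gamma_quotient add_ac)

text \<open>(x + y) / (A + B) is the convex combination of x / A and y / B with weights A / (A + B)
  and B / (A + B). Integrated with A and B close to the two norms, this yields Minkowski's
  inequality.\<close>

lemma add_power_le_weighted:
  fixes x y A B :: real
  assumes "x \<ge> 0" "y \<ge> 0" "A > 0" "B > 0"
  shows "(x + y) ^ k \<le> (A + B) ^ k * (A / (A + B) * (x / A) ^ k + B / (A + B) * (y / B) ^ k)"
proof -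
  have "convex_on {0::real..} (\<lambda>x. x ^ k)"
    by (cases "even k") (auto intro: convex_power_odd convex_on_subset[OF convex_power_even])
  then have "((1 - B / (A + B)) *\<^sub>R (x / A) + (B / (A + B)) *\<^sub>R (y / B)) ^ k \<le>
     (1 - B / (A + B)) * (x / A) ^ k + B / (A + B) * (y / B) ^ k"
    by (rule convex_onD) (use assms in auto)
  moreover have "1 - B / (A + B) = A / (A + B)"
    using assms by (simp add: field_simps)
  moreover have "A / (A + B) * (x / A) + B / (A + B) * (y / B) = (x + y) / (A + B)"
    using assms by (simp add: add_divide_distrib)
  ultimately have "((x + y) / (A + B)) ^ k \<le> A / (A + B) * (x / A) ^ k + B / (A + B) * (y / B) ^ k"
    by simp
  then have "(A + B) ^ k * ((x + y) / (A + B)) ^ k \<le>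
      (A + B) ^ k * (A / (A + B) * (x / A) ^ k + B / (A + B) * (y / B) ^ k)"
    using assms by (intro mult_left_mono) auto
  moreover have "(A + B) ^ k * ((x + y) / (A + B)) ^ k = (x + y) ^ k"
    using assms by (simp add: power_divide)
  ultimately show ?thesis by simp
qed

lemma powr_root_power:
  fixes x :: real
  assumes "x \<ge> 0" "m \<ge> 1"
  shows "(x powr (1 / (2 * real m))) ^ (2 * m) = x"
proof (cases "x = 0")
  case True
  then show ?thesis using assms by (simp add: power_0_left)
next
  case False
  then have "(x powr (1 / (2 * real m))) ^ (2 * m) = x powr (1 / (2 * real m) * real (2 * m))"
    by (simp add: powr_power)
  then show ?thesis using assms False by simp
qed

section \<open>Norm, Parseval identity and growth for the exponent 2m\<close>

locale even_bergman =
  fixes m :: nat and \<alpha> :: real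
  assumes m1: "m \<ge> 1" and \<alpha>: "\<alpha> > -1"
begin

abbreviation M :: "complex measure" where "M \<equiv> bergman_measure \<alpha>"
abbreviation S :: "(complex \<Rightarrow> complex) set" where "S \<equiv> bergman_space (2 * real m) \<alpha>"
abbreviation N :: "(complex \<Rightarrow> complex) \<Rightarrow> real" where "N \<equiv> bergman_norm (2 * real m) \<alpha>"

lemma powr_even: "cmod w powr (2 * real m) = cmod w ^ (2 * m)"
proof (cases "w = 0")
  case False
  then show ?thesis using powr_realpow[of "cmod w" "2 * m"] by simp
qed (use m1 in \<open>simp add: power_0_left\<close>)

lemma space_iff: "f \<in> S \<longleftrightarrow> f holomorphic_on ball 0 1 \<and> integrable M (\<lambda>z. cmod (f z) ^ (2 * m))"
  by (simp add: bergman_space_def powr_even)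

lemma space_holomorphic: "f \<in> S \<Longrightarrow> f holomorphic_on ball 0 1"
  by (simp add: space_iff)

lemma bnorm_nonneg [simp]: "N f \<ge> 0"
  by (simp add: bergman_norm_def)

lemma bnorm_power: "N f ^ (2 * m) = (LINT z|M. cmod (f z) ^ (2 * m))"
  unfolding bergman_norm_def powr_even by (rule powr_root_power[OF _ m1]) simp

lemma nn_integral_eq_norm_power:
  assumes "f \<in> S"
  shows "(\<integral>\<^sup>+z. ennreal (cmod (f z) ^ (2 * m)) \<partial>M) = ennreal (N f ^ (2 * m))"
  unfolding bnorm_power by (rule nn_integral_eq_integral) (use assms space_iff in auto)

lemma spaceI:
  assumes "f holomorphic_on ball 0 1" "(\<integral>\<^sup>+z. ennreal (cmod (f z) ^ (2 * m)) \<partial>M) \<le> ennreal (C ^ (2 * m))" "C \<ge> 0"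
  shows "f \<in> S" "N f \<le> C"
proof -
  have mf: "(\<lambda>z. cmod (f z) ^ (2 * m)) \<in> borel_measurable M"
    using assms(1) by (intro continuous_on_imp_measurable_bergman continuous_intros holomorphic_on_imp_continuous_on)
  have "integrable M (\<lambda>z. cmod (f z) ^ (2 * m))"
    unfolding integrable_iff_bounded using mf assms(2) by (auto intro: le_less_trans)
  then show f: "f \<in> S"
    using assms(1) by (simp add: space_iff)
  have "N f ^ (2 * m) \<le> C ^ (2 * m)"
    using assms(2,3) nn_integral_eq_norm_power[OF f] by simp
  then show "N f \<le> C"
    using assms(3) m1 by (subst (asm) power_mono_iff) auto
qed

lemma spaceI_bounded:
  assumes "f holomorphic_on ball 0 1" "\<And>z. cmod z < 1 \<Longrightarrow> cmod (f z) \<le> C" "C \<ge> 0"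
  shows "f \<in> S" "N f \<le> C"
proof -
  have "(\<integral>\<^sup>+z. ennreal (cmod (f z) ^ (2 * m)) \<partial>M) \<le> (\<integral>\<^sup>+z. ennreal (C ^ (2 * m)) \<partial>M)"
    using assms by (intro nn_integral_mono ennreal_leI power_mono) auto
  also have "\<dots> = ennreal (C ^ (2 * m))"
    using emeasure_bergman_space[OF \<alpha>] by simp
  finally show "f \<in> S" "N f \<le> C"
    using spaceI[of f C] assms by auto
qed

lemma poly_in_space: "poly q \<in> S"
proof -
  have "continuous_on (cball 0 1) (poly q)" by (intro continuous_intros)
  then have "bounded (poly q ` cball 0 1)"
    by (intro compact_imp_bounded compact_continuous_image) auto
  then obtain C where C: "\<And>z. z \<in> cball 0 1 \<Longrightarrow> cmod (poly q z) \<le> C"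
    unfolding bounded_iff by blast
  then have "C \<ge> 0" using norm_ge_zero[of "poly q 0"] order_trans by (metis centre_in_cball zero_le_one)
  then show ?thesis
    using C by (intro spaceI_bounded[of _ C] holomorphic_intros) auto
qed

lemma bnorm_cong: "(\<And>z. cmod z < 1 \<Longrightarrow> f z = g z) \<Longrightarrow> N f = N g"
  unfolding bergman_norm_def by (intro arg_cong2[where f="(powr)"] Bochner_Integration.integral_cong) auto

lemma bnorm_cmult:
  assumes "f \<in> S"
  shows "(\<lambda>z. c * f z) \<in> S" "N (\<lambda>z. c * f z) = cmod c * N f"
proof -
  show "(\<lambda>z. c * f z) \<in> S"
    using assms unfolding space_iff
    by (auto simp: norm_mult power_mult_distrib intro!: holomorphic_intros)
  have "N (\<lambda>z. c * f z) ^ (2 * m) = (cmod c * N f) ^ (2 * m)"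
    by (simp add: bnorm_power norm_mult power_mult_distrib)
  then show "N (\<lambda>z. c * f z) = cmod c * N f"
    using m1 by (subst (asm) power_eq_iff_eq_base) auto
qed

lemma bnorm_add:
  assumes f: "f \<in> S" and g: "g \<in> S"
  shows "(\<lambda>z. f z + g z) \<in> S" "N (\<lambda>z. f z + g z) \<le> N f + N g"
proof -
  \<comment> \<open>The strict bounds A and B keep the denominators positive even if a norm
    vanishes; at the end they are lowered to the norms.\<close>
  have key: "(\<lambda>z. f z + g z) \<in> S \<and> N (\<lambda>z. f z + g z) \<le> A + B" if A: "N f < A" and B: "N g < B" for A B
  proof -
    have pos: "A > 0" "B > 0" using A B bnorm_nonneg[of f] bnorm_nonneg[of g] by linarith+
    let ?b = "\<lambda>z. (A + B) ^ (2 * m) * (A / (A + B) * (cmod (f z) / A) ^ (2 * m) + B / (A + B) * (cmod (g z) / B) ^ (2 * m))"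
    have i: "integrable M (\<lambda>z. cmod (f z) ^ (2 * m))" "integrable M (\<lambda>z. cmod (g z) ^ (2 * m))"
      using f g by (auto simp: space_iff)
    have ib: "integrable M ?b"
      unfolding power_divide by (intro integrable_mult_right Bochner_Integration.integrable_add integrable_divide i)
    have "(LINT z|M. ?b z) = (A + B) ^ (2 * m) * (A / (A + B) * (N f ^ (2 * m) / A ^ (2 * m)) + B / (A + B) * (N g ^ (2 * m) / B ^ (2 * m)))"
      unfolding bnorm_power power_divide using i by simp
    also have "\<dots> \<le> (A + B) ^ (2 * m) * (A / (A + B) * 1 + B / (A + B) * 1)"
    proof (intro mult_left_mono add_mono)
      show "N f ^ (2 * m) / A ^ (2 * m) \<le> 1"
        using pos A by (simp add: power_mono divide_le_eq)
      show "N g ^ (2 * m) / B ^ (2 * m) \<le> 1"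
        using pos B by (simp add: power_mono divide_le_eq)
    qed (use pos in auto)
    also have "A / (A + B) * 1 + B / (A + B) * 1 = 1"
      using pos by (simp add: add_divide_distrib[symmetric])
    finally have le: "(LINT z|M. ?b z) \<le> (A + B) ^ (2 * m)" by simp
    have "(\<integral>\<^sup>+z. ennreal (cmod (f z + g z) ^ (2 * m)) \<partial>M) \<le> (\<integral>\<^sup>+z. ennreal (?b z) \<partial>M)"
    proof (intro nn_integral_mono ennreal_leI)
      fix z
      have "cmod (f z + g z) ^ (2 * m) \<le> (cmod (f z) + cmod (g z)) ^ (2 * m)"
        by (intro power_mono norm_triangle_ineq) auto
      also have "\<dots> \<le> ?b z" by (rule add_power_le_weighted) (use pos in auto)
      finally show "cmod (f z + g z) ^ (2 * m) \<le> ?b z" .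
    qed
    also have "\<dots> = ennreal (LINT z|M. ?b z)"
      by (rule nn_integral_eq_integral[OF ib]) (use pos in auto)
    also have "\<dots> \<le> ennreal ((A + B) ^ (2 * m))"
      using le by (rule ennreal_leI)
    finally show ?thesis
      using spaceI[of "\<lambda>z. f z + g z" "A + B"] pos holomorphic_on_add[OF space_holomorphic[OF f] space_holomorphic[OF g]]
      by simp
  qed
  show "(\<lambda>z. f z + g z) \<in> S"
    using key[of "N f + 1" "N g + 1"] by simp
  show "N (\<lambda>z. f z + g z) \<le> N f + N g"
  proof (rule field_le_epsilon)
    fix e :: real assume "e > 0"
    then show "N (\<lambda>z. f z + g z) \<le> N f + N g + e"
      using key[of "N f + e / 2" "N g + e / 2"] by simp
  qed
qed

lemma bnorm_diff:
  assumes f: "f \<in> S" and g: "g \<in> S"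
  shows "(\<lambda>z. f z - g z) \<in> S" "N (\<lambda>z. f z - g z) \<le> N f + N g"
  using bnorm_add[OF f bnorm_cmult(1)[OF g, of "-1"]] bnorm_cmult(2)[OF g, of "-1"] by auto

lemma parseval_power:
  assumes "has_disc_fps F f"
  shows "(\<integral>\<^sup>+z. ennreal (cmod (f z) ^ (2 * m)) \<partial>M) =
    (\<Sum>n. ennreal ((cmod (fps_nth (F ^ m) n))\<^sup>2 * bergman_moment \<alpha> n))"
proof -
  have "cmod (f z) ^ (2 * m) = (cmod (f z ^ m))\<^sup>2" for z
    by (simp add: norm_power power_mult[symmetric] mult.commute)
  then show ?thesis
    using bergman_parseval[OF \<alpha> has_disc_fps_power[OF assms, of m]] by simp
qed

lemma parseval_power_sums:
  assumes "has_disc_fps F f" "f \<in> S"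
  shows "(\<lambda>n. (cmod (fps_nth (F ^ m) n))\<^sup>2 * bergman_moment \<alpha> n) sums (N f ^ (2 * m))"
proof -
  have e: "(\<Sum>n. ennreal ((cmod (fps_nth (F ^ m) n))\<^sup>2 * bergman_moment \<alpha> n)) = ennreal (N f ^ (2 * m))"
    using parseval_power[OF assms(1)] nn_integral_eq_norm_power[OF assms(2)] by simp
  have nn: "(cmod (fps_nth (F ^ m) n))\<^sup>2 * bergman_moment \<alpha> n \<ge> 0" for n
    using bergman_moment_pos[OF \<alpha>, of n] by simp
  have s: "summable (\<lambda>n. (cmod (fps_nth (F ^ m) n))\<^sup>2 * bergman_moment \<alpha> n)"
    by (rule summable_suminf_not_top[OF nn]) (simp add: e)
  then show ?thesis
    using suminf_ennreal_eq[OF nn summable_sums[OF s]] e suminf_nonneg[OF s nn]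
    by (simp add: sums_iff)
qed

text \<open>Cauchy-Schwarz for the power series of f^m with weights \<open>bergman_moment\<close>:
  the first factor is the norm by Parseval, the second sums to the reproducing kernel (1 -
  |z|^2)^(-(\<alpha> + 2)). The exponent results from taking the 2m-th root.\<close>

lemma growth:
  assumes "f \<in> S" "cmod z < 1"
  shows "cmod (f z) \<le> N f * (1 - (cmod z)\<^sup>2) powr (- ((\<alpha> + 2) / (2 * real m)))"
proof -
  obtain F where F: "has_disc_fps F f"
    using holomorphic_has_disc_fps[OF space_holomorphic[OF assms(1)]] .
  define b where "b = fps_nth (F ^ m)"
  define A where "A = N f ^ (2 * m)"
  define D where "D = (1 - (cmod z)\<^sup>2) powr (- (\<alpha> + 2))"
  have z2: "(cmod z)\<^sup>2 < 1" using assms(2) by (simp add: abs_square_less_1)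
  have bs: "(\<lambda>n. (cmod (b n))\<^sup>2 * bergman_moment \<alpha> n) sums A"
    unfolding b_def A_def by (rule parseval_power_sums[OF F assms(1)])
  have ds: "(\<lambda>n. ((cmod z)\<^sup>2) ^ n / bergman_moment \<alpha> n) sums D"
    using one_minus_powr_real_sums[of "(cmod z)\<^sup>2" "\<alpha> + 2"] z2
    by (simp add: D_def bergman_moment_eq_pochhammer[OF \<alpha>] mult_ac)
  have mp: "bergman_moment \<alpha> n > 0" for n by (rule bergman_moment_pos[OF \<alpha>])
  have part: "(cmod (\<Sum>n<k. b n * z ^ n))\<^sup>2 \<le> A * D" for k
  proof -
    have "cmod (\<Sum>n<k. b n * z ^ n) \<le> (\<Sum>n<k. cmod (b n * z ^ n))" by (rule norm_sum)
    also have "\<dots> = (\<Sum>n<k. (cmod (b n) * sqrt (bergman_moment \<alpha> n)) * (cmod z ^ n / sqrt (bergman_moment \<alpha> n)))"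
      using mp by (intro sum.cong) (auto simp: norm_mult norm_power less_imp_neq[symmetric])
    finally have "(cmod (\<Sum>n<k. b n * z ^ n))\<^sup>2 \<le> \<dots>\<^sup>2"
      by (intro power_mono) auto
    also have "\<dots> \<le> (\<Sum>n<k. (cmod (b n) * sqrt (bergman_moment \<alpha> n))\<^sup>2) * (\<Sum>n<k. (cmod z ^ n / sqrt (bergman_moment \<alpha> n))\<^sup>2)"
      by (rule Cauchy_Schwarz_ineq_sum)
    also have "\<dots> = (\<Sum>n<k. (cmod (b n))\<^sup>2 * bergman_moment \<alpha> n) * (\<Sum>n<k. ((cmod z)\<^sup>2) ^ n / bergman_moment \<alpha> n)"
      using mp by (simp add: power_mult_distrib power_divide less_imp_le power_mult[symmetric] mult.commute)
    also have "\<dots> \<le> A * D"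
    proof (rule mult_mono)
      show "(\<Sum>n<k. (cmod (b n))\<^sup>2 * bergman_moment \<alpha> n) \<le> A"
        using bs mp by (subst sums_unique[OF bs], intro sum_le_suminf) (auto simp: sums_iff less_imp_le)
      show "(\<Sum>n<k. ((cmod z)\<^sup>2) ^ n / bergman_moment \<alpha> n) \<le> D"
        using ds mp by (subst sums_unique[OF ds], intro sum_le_suminf) (auto simp: sums_iff less_imp_le)
    qed (use mp in \<open>auto intro!: sum_nonneg simp: A_def less_imp_le\<close>)
    finally show ?thesis .
  qed
  have "(\<lambda>k. (cmod (\<Sum>n<k. b n * z ^ n))\<^sup>2) \<longlonglongrightarrow> (cmod (f z ^ m))\<^sup>2"
    using has_disc_fps_power[OF F, of m] assms(2)
    unfolding has_disc_fps_def sums_def b_def by (intro tendsto_intros) auto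
  then have "(cmod (f z ^ m))\<^sup>2 \<le> A * D"
    by (rule LIMSEQ_le_const2) (use part in blast)
  also have "(cmod (f z ^ m))\<^sup>2 = cmod (f z) ^ (2 * m)"
    by (simp add: norm_power power_mult[symmetric] mult.commute)
  also have "A * D = (N f * (1 - (cmod z)\<^sup>2) powr (- ((\<alpha> + 2) / (2 * real m)))) ^ (2 * m)"
  proof -
    have "((1 - (cmod z)\<^sup>2) powr (- ((\<alpha> + 2) / (2 * real m)))) ^ (2 * m) =
       (1 - (cmod z)\<^sup>2) powr (- ((\<alpha> + 2) / (2 * real m)) * real (2 * m))"
      using z2 by (simp add: powr_power)
    also have "\<dots> = D" using m1 by (simp add: D_def)
    finally show ?thesis by (simp add: A_def power_mult_distrib)
  qed
  finally show ?thesis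
    using m1 by (subst (asm) power_mono_iff) auto
qed

end

section \<open>Dilations and density of the polynomials\<close>

lemma norm_diff_power_le:
  "cmod (x - y) ^ k \<le> 2 ^ k * (cmod x ^ k + cmod y ^ k)"
proof -
  have "cmod (x - y) \<le> 2 * max (cmod x) (cmod y)"
    using norm_triangle_ineq4[of x y] by (auto simp: max_def)
  then have "cmod (x - y) ^ k \<le> (2 * max (cmod x) (cmod y)) ^ k"
    by (intro power_mono) auto
  also have "\<dots> \<le> 2 ^ k * (cmod x ^ k + cmod y ^ k)"
    by (auto simp: power_mult_distrib max_def)
  finally show ?thesis .
qed

context even_bergman
begin

text \<open>The n-th coefficient of the m-th power of f(r z) is r^n times that of f^m, so no term of
  the Parseval sum grows.\<close>

lemma dilation_in_space:
  assumes f: "f \<in> S" and r: "0 \<le> r" "r \<le> 1"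
  shows "(\<lambda>z. f (of_real r * z)) \<in> S" "N (\<lambda>z. f (of_real r * z)) \<le> N f"
proof -
  obtain F where F: "has_disc_fps F f"
    using holomorphic_has_disc_fps[OF space_holomorphic[OF f]] .
  define b where "b = fps_nth (F ^ m)"
  have e: "cmod w ^ (2 * m) = (cmod (w ^ m))\<^sup>2" for w
    by (simp add: norm_power power_mult[symmetric] mult.commute)
  have D: "has_disc_fps (Abs_fps (\<lambda>n. b n * of_real r ^ n)) (\<lambda>z. f (of_real r * z) ^ m)"
    unfolding b_def using has_disc_fps_dilate[OF has_disc_fps_power[OF F] r] .
  have "(\<integral>\<^sup>+z. ennreal (cmod (f (of_real r * z)) ^ (2 * m)) \<partial>M) =
    (\<Sum>n. ennreal ((cmod (b n * of_real r ^ n))\<^sup>2 * bergman_moment \<alpha> n))"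
    unfolding e using bergman_parseval[OF \<alpha> D] by simp
  also have "\<dots> \<le> (\<Sum>n. ennreal ((cmod (b n))\<^sup>2 * bergman_moment \<alpha> n))"
  proof (intro suminf_le ennreal_leI mult_right_mono power_mono)
    fix n
    have "cmod (b n) * r ^ n \<le> cmod (b n) * 1"
      using r by (intro mult_left_mono power_le_one) auto
    then show "cmod (b n * of_real r ^ n) \<le> cmod (b n)"
      using r by (simp add: norm_mult norm_power)
  qed (use bergman_moment_pos[OF \<alpha>] in \<open>auto simp: less_imp_le\<close>)
  also have "\<dots> = ennreal (N f ^ (2 * m))"
    unfolding b_def using parseval_power[OF F] nn_integral_eq_norm_power[OF f] by simp
  finally have le: "(\<integral>\<^sup>+z. ennreal (cmod (f (of_real r * z)) ^ (2 * m)) \<partial>M) \<le> ennreal (N f ^ (2 * m))" .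
  have h: "(\<lambda>z. f (of_real r * z)) holomorphic_on ball 0 1"
    by (rule has_disc_fps_holomorphic[OF has_disc_fps_dilate[OF F r]])
  show "(\<lambda>z. f (of_real r * z)) \<in> S" "N (\<lambda>z. f (of_real r * z)) \<le> N f"
    using spaceI[OF h le] by auto
qed

text \<open>Norm convergence follows from pointwise convergence and \<open>norm f\<^sub>r \<le> norm f\<close> by applying
  Fatou's lemma to \<open>2\<^sup>p (|f\<^sub>r|\<^sup>p + |f|\<^sup>p) - |f\<^sub>r - f|\<^sup>p \<ge> 0\<close>.\<close>

lemma dilation_approx:
  assumes f: "f \<in> S" and e: "e > 0"
  shows "\<exists>r. 0 < r \<and> r < 1 \<and> N (\<lambda>z. f (of_real r * z) - f z) < e"
proof (rule ccontr)
  assume contr: "\<not> ?thesis"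
  let ?r = "\<lambda>j::nat. 1 - 1 / real (j + 2)"
  define h where "h = (\<lambda>j z. f (of_real (?r j) * z))"
  define c :: real where "c = 2 ^ (2 * m)"
  define A where "A = N f ^ (2 * m)"
  define g where "g = (\<lambda>j z. c * (cmod (h j z) ^ (2 * m) + cmod (f z) ^ (2 * m)) - cmod (h j z - f z) ^ (2 * m))"
  have c0: "c > 0" by (simp add: c_def)
  have r: "0 < ?r j" "?r j < 1" for j by (simp_all add: field_simps)
  have hS: "h j \<in> S" and hN: "N (h j) \<le> N f" for j
    unfolding h_def using dilation_in_space[OF f, of "?r j"] r[of j] by auto
  have dS: "(\<lambda>z. h j z - f z) \<in> S" for j by (rule bnorm_diff(1)[OF hS f])
  have dN: "e \<le> N (\<lambda>z. h j z - f z)" for j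
    unfolding h_def using contr r[of j] not_le by blast
  have i: "integrable M (\<lambda>z. cmod (u z) ^ (2 * m))" if "u \<in> S" for u
    using that by (simp add: space_iff)
  have gi: "integrable M (g j)" for j
    unfolding g_def by (intro Bochner_Integration.integrable_diff integrable_mult_right Bochner_Integration.integrable_add i hS f dS)
  have g0: "g j z \<ge> 0" for j z
    unfolding g_def c_def using norm_diff_power_le[of "h j z" "f z" "2 * m"] by simp
  have gI: "(LINT z|M. g j z) = c * (N (h j) ^ (2 * m) + A) - N (\<lambda>z. h j z - f z) ^ (2 * m)" for j
    unfolding g_def bnorm_power A_def using i[OF hS[of j]] i[OF f] i[OF dS[of j]] by simp
  have gle: "(LINT z|M. g j z) \<le> 2 * c * A - e ^ (2 * m)" for j
  proof -
    have "c * (N (h j) ^ (2 * m) + A) \<le> c * (A + A)"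
      unfolding A_def using c0 hN[of j] by (intro mult_left_mono add_mono power_mono) auto
    moreover have "e ^ (2 * m) \<le> N (\<lambda>z. h j z - f z) ^ (2 * m)"
      using dN[of j] e by (intro power_mono) auto
    ultimately show ?thesis unfolding gI by simp
  qed
  have "ennreal (2 * c * A) = (\<integral>\<^sup>+z. ennreal (2 * c * cmod (f z) ^ (2 * m)) \<partial>M)"
    unfolding A_def using nn_integral_eq_integral[of M "\<lambda>z. 2 * c * cmod (f z) ^ (2 * m)"] i[OF f] c0
    by (simp add: bnorm_power)
  also have "\<dots> = (\<integral>\<^sup>+z. liminf (\<lambda>j. ennreal (g j z)) \<partial>M)"
  proof (rule nn_integral_cong)
    fix z assume "z \<in> space M"
    then have z: "z \<in> ball 0 1" by simp
    have cont: "isCont f z"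
      using holomorphic_on_imp_continuous_on[OF space_holomorphic[OF f]] z
      by (simp add: continuous_on_eq_continuous_at)
    have "(\<lambda>j. 1 / real (j + 2)) \<longlonglongrightarrow> 0"
      using LIMSEQ_ignore_initial_segment[OF lim_1_over_n, of 2] by simp
    then have "(\<lambda>j. ?r j) \<longlonglongrightarrow> 1 - 0" by (intro tendsto_intros)
    then have "(\<lambda>j. of_real (?r j) * z) \<longlonglongrightarrow> of_real 1 * z"
      by (intro tendsto_intros) simp
    then have "(\<lambda>j. h j z) \<longlonglongrightarrow> f z"
      unfolding h_def using isCont_tendsto_compose[OF cont] by simp
    then have "(\<lambda>j. g j z) \<longlonglongrightarrow> c * (cmod (f z) ^ (2 * m) + cmod (f z) ^ (2 * m)) - cmod (f z - f z) ^ (2 * m)"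
      unfolding g_def by (intro tendsto_intros)
    also have "c * (cmod (f z) ^ (2 * m) + cmod (f z) ^ (2 * m)) - cmod (f z - f z) ^ (2 * m) = 2 * c * cmod (f z) ^ (2 * m)"
      using m1 by (simp add: power_0_left)
    finally have "(\<lambda>j. ennreal (g j z)) \<longlonglongrightarrow> ennreal (2 * c * cmod (f z) ^ (2 * m))"
      by (rule tendsto_ennrealI)
    then show "ennreal (2 * c * cmod (f z) ^ (2 * m)) = liminf (\<lambda>j. ennreal (g j z))"
      using lim_imp_Liminf[OF sequentially_bot] by metis
  qed
  also have "\<dots> \<le> liminf (\<lambda>j. \<integral>\<^sup>+z. ennreal (g j z) \<partial>M)"
    by (rule nn_integral_liminf) (use borel_measurable_integrable[OF gi] in measurable)
  also have "\<dots> \<le> liminf (\<lambda>j::nat. ennreal (2 * c * A - e ^ (2 * m)))"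
  proof (intro Liminf_mono always_eventually allI)
    fix j
    have "(\<integral>\<^sup>+z. ennreal (g j z) \<partial>M) = ennreal (LINT z|M. g j z)"
      by (rule nn_integral_eq_integral[OF gi]) (use g0 in simp)
    then show "(\<integral>\<^sup>+z. ennreal (g j z) \<partial>M) \<le> ennreal (2 * c * A - e ^ (2 * m))"
      using gle[of j] by (simp add: ennreal_leI)
  qed
  also have "\<dots> = ennreal (2 * c * A - e ^ (2 * m))"
    by (simp add: Liminf_const)
  finally have "ennreal (2 * c * A) \<le> ennreal (2 * c * A - e ^ (2 * m))" .
  \<comment> \<open>\<open>ennreal\<close> sends negative reals to 0, so the right-hand side must be
    known to be nonnegative before the bound can be read in the reals.\<close>
  moreover have "0 \<le> (LINT z|M. g 0 z)"
    by (intro integral_nonneg_AE) (use g0 in simp)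
  then have "0 \<le> 2 * c * A - e ^ (2 * m)"
    using gle[of 0] by linarith
  ultimately have "e ^ (2 * m) \<le> 0" by simp
  then show False using zero_less_power[OF e, of "2 * m"] by linarith
qed

text \<open>For r < 1 the Taylor series of f(r z) converges absolutely and uniformly on the disc,
  and the measure has total mass 1, so uniform closeness gives closeness in norm.\<close>

lemma poly_approx_dilation:
  assumes f: "f \<in> S" and r: "0 < r" "r < 1" and e: "e > 0"
  shows "\<exists>q. N (\<lambda>z. f (of_real r * z) - poly q z) < e"
proof -
  obtain F where F: "has_disc_fps F f"
    using holomorphic_has_disc_fps[OF space_holomorphic[OF f]] .
  have s: "summable (\<lambda>n. cmod (fps_nth F n * of_real r ^ n))"
    by (rule norm_summable_fps) (use has_disc_fps_norm_less_conv_radius[OF F, of "of_real r"] r in auto)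
  obtain k where k: "norm (\<Sum>i. cmod (fps_nth F (i + k) * of_real r ^ (i + k))) < e / 2"
    using suminf_exist_split[OF _ s, of "e / 2"] e by auto
  define q where "q = (\<Sum>n<k. monom (fps_nth F n * of_real r ^ n) n)"
  have le: "cmod (f (of_real r * z) - poly q z) \<le> e / 2" if z: "cmod z < 1" for z
  proof -
    have ss: "(\<lambda>n. fps_nth F n * of_real r ^ n * z ^ n) sums f (of_real r * z)"
      using has_disc_fps_dilate[OF F, of r] r z unfolding has_disc_fps_def by auto
    have "poly q z = (\<Sum>n<k. fps_nth F n * of_real r ^ n * z ^ n)"
      by (simp add: q_def poly_sum poly_monom)
    then have "(\<lambda>n. fps_nth F (n + k) * of_real r ^ (n + k) * z ^ (n + k)) sums (f (of_real r * z) - poly q z)"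
      using sums_split_initial_segment[OF ss, of k] by simp
    then have "cmod (f (of_real r * z) - poly q z) = cmod (\<Sum>n. fps_nth F (n + k) * of_real r ^ (n + k) * z ^ (n + k))"
      by (simp add: sums_iff)
    also have "\<dots> \<le> (\<Sum>i. cmod (fps_nth F (i + k) * of_real r ^ (i + k)))"
    proof (rule norm_suminf_le)
      fix n
      have "cmod z ^ (n + k) \<le> 1" using z by (intro power_le_one) auto
      then have "cmod (fps_nth F (n + k) * of_real r ^ (n + k)) * cmod z ^ (n + k) \<le>
         cmod (fps_nth F (n + k) * of_real r ^ (n + k)) * 1"
        by (intro mult_left_mono) auto
      then show "norm (fps_nth F (n + k) * of_real r ^ (n + k) * z ^ (n + k)) \<le>
         cmod (fps_nth F (n + k) * of_real r ^ (n + k))"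
        by (simp add: norm_mult norm_power)
    next
      show "summable (\<lambda>i. cmod (fps_nth F (i + k) * of_real r ^ (i + k)))"
        using summable_ignore_initial_segment[OF s, of k] .
    qed
    also have "\<dots> \<le> e / 2" using k by simp
    finally show ?thesis .
  qed
  have "(\<lambda>z. f (of_real r * z) - poly q z) holomorphic_on ball 0 1"
    using bnorm_diff(1)[OF dilation_in_space(1)[OF f] poly_in_space, of r q] r by (simp add: space_iff)
  then have "N (\<lambda>z. f (of_real r * z) - poly q z) \<le> e / 2"
    by (rule spaceI_bounded(2)) (use le e in auto)
  then show ?thesis using e by (intro exI[of _ q]) auto
qed

lemma polys_dense:
  assumes f: "f \<in> S" and e: "e > 0"
  shows "\<exists>q. N (\<lambda>z. f z - poly q z) < e"
proof -
  obtain r where r: "0 < r" "r < 1" and 1: "N (\<lambda>z. f (of_real r * z) - f z) < e / 2"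
    using dilation_approx[OF f, of "e / 2"] e by auto
  obtain q where 2: "N (\<lambda>z. f (of_real r * z) - poly q z) < e / 2"
    using poly_approx_dilation[OF f r, of "e / 2"] e by auto
  have d: "(\<lambda>z. f (of_real r * z)) \<in> S" using dilation_in_space(1)[OF f, of r] r by auto
  have "N (\<lambda>z. (f (of_real r * z) - poly q z) - (f (of_real r * z) - f z)) \<le>
     N (\<lambda>z. f (of_real r * z) - poly q z) + N (\<lambda>z. f (of_real r * z) - f z)"
    by (rule bnorm_diff(2)) (intro bnorm_diff(1) d f poly_in_space)+
  then show ?thesis using 1 2 by (intro exI[of _ q]) simp
qed

end

text \<open>The inner matrix sum over k, rewritten with 1 / (n + k + 1) as the integral of t^(n +
  k). In this form it makes sense for every f that is integrable along the radius, which gives the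
  operator on the whole space by a formula.\<close>

definition radial_moment :: "(complex \<Rightarrow> complex) \<Rightarrow> nat \<Rightarrow> complex" where
  "radial_moment f n = (LINT t:{0<..<1}|lborel. of_real t ^ n * f (of_real t))"

definition hilbert_ext :: "(complex \<Rightarrow> complex) \<Rightarrow> complex \<Rightarrow> complex" where
  "hilbert_ext f z = (\<Sum>n. radial_moment f n * z ^ n)"

lemma has_disc_fps_bounded_coeffs:
  assumes "\<And>n. cmod (c n) \<le> C"
  shows "has_disc_fps (Abs_fps c) (\<lambda>z. \<Sum>n. c n * z ^ n)"
    and "cmod z < 1 \<Longrightarrow> cmod (\<Sum>n. c n * z ^ n) \<le> C / (1 - cmod z)"
proof -
  have *: "summable (\<lambda>n. c n * z ^ n) \<and> cmod (\<Sum>n. c n * z ^ n) \<le> C / (1 - cmod z)"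
    if z: "cmod z < 1" for z
  proof -
    have g: "(\<lambda>n. C * cmod z ^ n) sums (C * (1 / (1 - cmod z)))"
      by (intro sums_mult geometric_sums) (use z in simp)
    have b: "norm (c n * z ^ n) \<le> C * cmod z ^ n" for n
      using assms[of n] by (simp add: norm_mult norm_power mult_right_mono)
    have "summable (\<lambda>n. c n * z ^ n)"
      by (rule summable_comparison_test'[OF sums_summable[OF g], of 0]) (use b in auto)
    moreover have "cmod (\<Sum>n. c n * z ^ n) \<le> (\<Sum>n. C * cmod z ^ n)"
      by (rule norm_suminf_le[OF b sums_summable[OF g]])
    ultimately show ?thesis using g by (simp add: sums_iff)
  qed
  show "has_disc_fps (Abs_fps c) (\<lambda>z. \<Sum>n. c n * z ^ n)"
    unfolding has_disc_fps_def using * by auto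
  show "cmod z < 1 \<Longrightarrow> cmod (\<Sum>n. c n * z ^ n) \<le> C / (1 - cmod z)" using * by blast
qed

lemma integral_power_01:
  "(LINT t:{0<..<1}|lborel. complex_of_real t ^ n) = 1 / of_nat (n + 1)"
  "set_integrable lborel {0<..<1} (\<lambda>t. complex_of_real t ^ n)"
proof -
  have si: "set_integrable lborel {0..1} (\<lambda>t. complex_of_real t ^ n)"
    by (rule borel_integrable_atLeastAtMost') (intro continuous_intros)
  then show si': "set_integrable lborel {0<..<1} (\<lambda>t. complex_of_real t ^ n)"
    by (rule set_integrable_subset) auto
  have hi: "((\<lambda>t. t ^ n) has_integral (1 ^ Suc n / real (Suc n) - 0 ^ Suc n / real (Suc n))) {0..1::real}"
  proof (rule fundamental_theorem_of_calculus)
    fix x :: real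
    have "((\<lambda>t. t ^ Suc n / real (Suc n)) has_real_derivative (real (Suc n) * x ^ n / real (Suc n))) (at x within {0..1})"
      using DERIV_cdivide[OF DERIV_pow[of "Suc n" x], of "real (Suc n)"] by simp
    then show "((\<lambda>t. t ^ Suc n / real (Suc n)) has_vector_derivative x ^ n) (at x within {0..1})"
      by (simp add: has_real_derivative_iff_has_vector_derivative)
  qed simp
  then have "((\<lambda>t. t ^ n) has_integral (1 / real (n + 1))) {0<..<1::real}"
    by (subst has_integral_Icc_iff_Ioo[symmetric]) simp
  then have "((\<lambda>t. of_real (t ^ n)) has_integral complex_of_real (1 / real (n + 1))) {0<..<1::real}"
    by (rule has_integral_of_real)
  then have "integral {0<..<1} (\<lambda>t. complex_of_real t ^ n) = complex_of_real (1 / real (n + 1))"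
    by (simp add: integral_unique)
  then show "(LINT t:{0<..<1}|lborel. complex_of_real t ^ n) = 1 / of_nat (n + 1)"
    by (simp add: set_borel_integral_eq_integral(2)[OF si'])
qed

lemma hilbert_ext_poly: "hilbert_ext (poly q) z = hilbert_matrix (coeff q) z"
proof -
  have "radial_moment (poly q) n = (\<Sum>k. coeff q k / of_nat (n + k + 1))" for n
  proof -
    have "radial_moment (poly q) n = (LINT t:{0<..<1}|lborel. (\<Sum>k\<le>degree q. coeff q k * complex_of_real t ^ (n + k)))"
      unfolding radial_moment_def by (simp add: poly_altdef sum_distrib_left power_add mult_ac)
    also have "\<dots> = (\<Sum>k\<le>degree q. LINT t:{0<..<1}|lborel. coeff q k * complex_of_real t ^ (n + k))"
      unfolding set_lebesgue_integral_def scaleR_sum_right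
      by (rule Bochner_Integration.integral_sum)
         (use integral_power_01(2) in \<open>auto simp: set_integrable_def mult.left_commute scaleR_conv_of_real intro!: integrable_mult_right\<close>)
    also have "\<dots> = (\<Sum>k\<le>degree q. coeff q k / of_nat (n + k + 1))"
      by (simp add: integral_power_01(1))
    also have "\<dots> = (\<Sum>k. coeff q k / of_nat (n + k + 1))"
      by (rule suminf_finite[symmetric]) (auto simp: coeff_eq_0)
    finally show ?thesis .
  qed
  then show ?thesis unfolding hilbert_ext_def hilbert_matrix_def by simp
qed

section \<open>The extended Hilbert matrix operator\<close>

text \<open>The assumption says a < 1, which is the condition for the growth bound (1 - t)^(-a) to
  be integrable up to t = 1.\<close>

locale hilbert_bergman = even_bergman +
  assumes lt: "\<alpha> + 2 < 2 * real m"
begin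

abbreviation a :: real where "a \<equiv> (\<alpha> + 2) / (2 * real m)"

lemma a_bounds: "0 < a" "a < 1"
  using lt m1 \<alpha> by (auto simp: divide_less_eq)

definition radial_const :: real where
  "radial_const = (LINT t:{0<..<1}|lborel. (1 - t) powr (- a))"

lemma radial_const_integrable: "set_integrable lborel {0<..<1} (\<lambda>t. (1 - t) powr (- a))"
proof -
  have "set_integrable lborel {0..1} (\<lambda>t. t powr (1 - 1) * (1 - t) powr ((1 - a) - 1))"
    by (rule integrable_Beta) (use a_bounds in auto)
  then have "set_integrable lborel {0<..<1} (\<lambda>t. t powr (1 - 1) * (1 - t) powr ((1 - a) - 1))"
    by (rule set_integrable_subset) auto
  then show ?thesis
    by (rule set_integrable_cong[THEN iffD1, rotated -1]) auto
qed

lemma radial_const_nonneg: "radial_const \<ge> 0"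
  unfolding radial_const_def set_lebesgue_integral_def by (intro integral_nonneg_AE) (simp add: indicator_def)

lemma radial_bound:
  assumes f: "f \<in> S" and t: "0 < t" "t < 1"
  shows "cmod (of_real t ^ n * f (of_real t)) \<le> N f * (1 - t) powr (- a)"
proof -
  have "cmod (of_real t ^ n * f (of_real t)) \<le> 1 * cmod (f (of_real t))"
    unfolding norm_mult using t by (intro mult_right_mono) (auto simp: norm_power power_le_one)
  also have "\<dots> \<le> N f * (1 - t\<^sup>2) powr (- a)"
    using growth[OF f, of "of_real t"] t by simp
  also have "\<dots> \<le> N f * (1 - t) powr (- a)"
  proof (intro mult_left_mono powr_mono2')
    have "t\<^sup>2 \<le> t * 1" unfolding power2_eq_square using t by (intro mult_left_mono) auto
    then show "1 - t \<le> 1 - t\<^sup>2" by simp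
  qed (use a_bounds t in auto)
  finally show ?thesis .
qed

lemma radial_integrable:
  assumes f: "f \<in> S"
  shows "set_integrable lborel {0<..<1} (\<lambda>t. of_real t ^ n * f (of_real t))"
proof (rule set_integrable_bound)
  show "set_integrable lborel {0<..<1} (\<lambda>t. N f * (1 - t) powr (- a))"
    by (rule set_integrable_mult_right) (use radial_const_integrable in auto)
  have "continuous_on {0<..<1} (\<lambda>t. complex_of_real t ^ n * f (complex_of_real t))"
    by (intro continuous_intros continuous_on_compose2[OF holomorphic_on_imp_continuous_on[OF space_holomorphic[OF f]]]) auto
  then show "set_borel_measurable lborel {0<..<1} (\<lambda>t. of_real t ^ n * f (of_real t))"
    unfolding set_borel_measurable_def
    using borel_measurable_continuous_on_indicator[of "{0<..<1::real}"] by simp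
  show "AE t in lborel. t \<in> {0<..<1} \<longrightarrow> norm (complex_of_real t ^ n * f (complex_of_real t)) \<le> norm (N f * (1 - t) powr (- a))"
    using radial_bound[OF f] by (auto intro!: AE_I2 simp: abs_mult)
qed

lemma radial_moment_bound:
  assumes f: "f \<in> S"
  shows "cmod (radial_moment f n) \<le> N f * radial_const"
proof -
  have "cmod (radial_moment f n) \<le> (LINT t:{0<..<1}|lborel. N f * (1 - t) powr (- a))"
    unfolding radial_moment_def set_lebesgue_integral_def
  proof (rule Bochner_Integration.integral_norm_bound_integral)
    show "integrable lborel (\<lambda>t. indicator {0<..<1} t *\<^sub>R (complex_of_real t ^ n * f (complex_of_real t)))"
      using radial_integrable[OF f] by (simp add: set_integrable_def)
    show "integrable lborel (\<lambda>t. indicator {0<..<1} t *\<^sub>R (N f * (1 - t) powr (- a)))"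
      using set_integrable_mult_right[OF radial_const_integrable, of "N f"] by (simp add: set_integrable_def)
    show "norm (indicator {0<..<1} t *\<^sub>R (complex_of_real t ^ n * f (complex_of_real t))) \<le> indicator {0<..<1} t *\<^sub>R (N f * (1 - t) powr (- a))" for t
      using radial_bound[OF f, of t n] by (cases "t \<in> {0<..<1}") auto
  qed
  also have "\<dots> = N f * radial_const" by (simp add: radial_const_def)
  finally show ?thesis .
qed

lemma hilbert_ext_fps:
  assumes f: "f \<in> S"
  shows "has_disc_fps (Abs_fps (radial_moment f)) (hilbert_ext f)"
  unfolding hilbert_ext_def by (rule has_disc_fps_bounded_coeffs(1)[OF radial_moment_bound[OF f]])

lemma hilbert_ext_bound:
  assumes f: "f \<in> S" and z: "cmod z < 1"
  shows "cmod (hilbert_ext f z) \<le> N f * radial_const / (1 - cmod z)"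
  unfolding hilbert_ext_def by (rule has_disc_fps_bounded_coeffs(2)[OF radial_moment_bound[OF f] z])

lemma hilbert_ext_add:
  assumes f: "f \<in> S" and g: "g \<in> S" and z: "cmod z < 1"
  shows "hilbert_ext (\<lambda>w. f w + g w) z = hilbert_ext f z + hilbert_ext g z"
proof -
  have "radial_moment (\<lambda>w. f w + g w) n = radial_moment f n + radial_moment g n" for n
    unfolding radial_moment_def distrib_left
    by (rule set_integral_add(2)[OF radial_integrable[OF f] radial_integrable[OF g]])
  moreover have "(\<lambda>n. radial_moment f n * z ^ n + radial_moment g n * z ^ n) sums (hilbert_ext f z + hilbert_ext g z)"
    using hilbert_ext_fps[OF f] hilbert_ext_fps[OF g] z unfolding has_disc_fps_def
    by (intro sums_add) auto
  ultimately show ?thesis unfolding hilbert_ext_def[of "\<lambda>w. f w + g w"]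
    by (simp add: sums_iff distrib_right)
qed

lemma hilbert_ext_cmult:
  assumes f: "f \<in> S" and z: "cmod z < 1"
  shows "hilbert_ext (\<lambda>w. c * f w) z = c * hilbert_ext f z"
proof -
  have "radial_moment (\<lambda>w. c * f w) n = c * radial_moment f n" for n
    unfolding radial_moment_def by (simp add: mult.left_commute)
  moreover have "(\<lambda>n. c * (radial_moment f n * z ^ n)) sums (c * hilbert_ext f z)"
    using hilbert_ext_fps[OF f] z unfolding has_disc_fps_def
    by (intro sums_mult) auto
  ultimately show ?thesis unfolding hilbert_ext_def[of "\<lambda>w. c * f w"]
    by (simp add: sums_iff mult.assoc)
qed

text \<open>At a fixed z both sides are continuous functionals of f: for T by boundedness together
  with \<open>growth\<close>, for the moment series by \<open>hilbert_ext_bound\<close>. They agree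
  on the dense set of polynomials.\<close>

lemma hilbert_operator_unique:
  assumes T: "is_hilbert_operator (2 * real m) \<alpha> T" and f: "f \<in> S" and z: "cmod z < 1"
  shows "T f z = hilbert_ext f z"
proof -
  from T have bl: "bergman_bounded_linear (2 * real m) \<alpha> T"
    and Tq: "\<And>q. T (poly q) z = hilbert_ext (poly q) z"
    using z by (auto simp: is_hilbert_operator_def hilbert_ext_poly)
  from bl obtain C where C: "\<And>g. g \<in> S \<Longrightarrow> N (T g) \<le> C * N g"
    unfolding bergman_bounded_linear_def by blast
  from bl have TS: "\<And>g. g \<in> S \<Longrightarrow> T g \<in> S"
    and Tadd: "\<And>g h. g \<in> S \<Longrightarrow> h \<in> S \<Longrightarrow> T (\<lambda>w. g w + h w) z = T g z + T h z"
    unfolding bergman_bounded_linear_def using z by auto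
  define D where "D = (1 - (cmod z)\<^sup>2) powr (- a)"
  \<comment> \<open>Bounds the difference of the two functionals at z, relative to the norm of the
    argument.\<close>
  define E where "E = \<bar>C\<bar> * D + radial_const / (1 - cmod z)"
  have E: "E \<ge> 0" unfolding E_def D_def using z radial_const_nonneg by simp
  have "cmod (T f z - hilbert_ext f z) \<le> 0"
  proof (rule field_le_epsilon)
    fix e :: real assume e: "e > 0"
    obtain q where q: "N (\<lambda>w. f w - poly q w) < e / (E + 1)"
      using polys_dense[OF f, of "e / (E + 1)"] e E by auto
    define g where "g = (\<lambda>w. f w - poly q w)"
    have g: "g \<in> S" unfolding g_def by (rule bnorm_diff(1)[OF f poly_in_space])
    have fg: "f = (\<lambda>w. g w + poly q w)" by (simp add: g_def)
    have "T f z - hilbert_ext f z = T g z - hilbert_ext g z"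
      using Tadd[OF g poly_in_space[of q]] hilbert_ext_add[OF g poly_in_space[of q] z] Tq[of q]
      by (simp add: fg[symmetric])
    also have "cmod \<dots> \<le> cmod (T g z) + cmod (hilbert_ext g z)" by (rule norm_triangle_ineq4)
    also have "\<dots> \<le> N (T g) * D + N g * radial_const / (1 - cmod z)"
      unfolding D_def by (intro add_mono growth TS g z hilbert_ext_bound)
    also have "\<dots> \<le> (\<bar>C\<bar> * N g) * D + N g * radial_const / (1 - cmod z)"
    proof (intro add_right_mono mult_right_mono)
      show "N (T g) \<le> \<bar>C\<bar> * N g"
        using C[OF g] mult_right_mono[OF abs_ge_self[of C] bnorm_nonneg[of g]] by linarith
    qed (simp add: D_def)
    also have "\<dots> = N g * E" by (simp add: E_def algebra_simps)
    also have "\<dots> \<le> e / (E + 1) * E"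
      using q E unfolding g_def by (intro mult_right_mono) auto
    also have "\<dots> \<le> e" using e E by (simp add: field_simps)
    finally show "cmod (T f z - hilbert_ext f z) \<le> 0 + e" by simp
  qed
  then show ?thesis by simp
qed

text \<open>If polynomials converge to f in norm, their images converge pointwise by
  \<open>hilbert_ext_bound\<close>, and Fatou's lemma transfers the bound. A slack e is carried
  along because the approximating norms are only known to be at most N f + e.\<close>

lemma hilbert_ext_norm_le:
  assumes B: "B \<ge> 0"
    and polys: "\<And>q. (\<integral>\<^sup>+z. ennreal (cmod (hilbert_ext (poly q) z) ^ (2 * m)) \<partial>M) \<le> ennreal ((B * N (poly q)) ^ (2 * m))"
    and f: "f \<in> S"
  shows "hilbert_ext f \<in> S" "N (hilbert_ext f) \<le> B * N f"
proof -
  have key: "hilbert_ext f \<in> S \<and> N (hilbert_ext f) \<le> B * (N f + e)" if e: "e > 0" for e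
  proof -
    have "\<exists>q. N (\<lambda>w. f w - poly q w) < min e (1 / real (Suc j))" for j
      by (rule polys_dense[OF f]) (use e in auto)
    then obtain q where q: "\<And>j. N (\<lambda>w. f w - poly (q j) w) < min e (1 / real (Suc j))" by metis
    have qN: "N (poly (q j)) \<le> N f + e" for j
    proof -
      have "N (\<lambda>w. f w - (f w - poly (q j) w)) \<le> N f + N (\<lambda>w. f w - poly (q j) w)"
        by (intro bnorm_diff(2) f bnorm_diff(1) poly_in_space)
      then show ?thesis using q[of j] by simp
    qed
    have lim: "(\<lambda>j. hilbert_ext (poly (q j)) z) \<longlonglongrightarrow> hilbert_ext f z" if z: "cmod z < 1" for z
    proof -
      define E where "E = radial_const / (1 - cmod z)"
      have E: "E \<ge> 0" unfolding E_def using z radial_const_nonneg by simp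
      have le: "cmod (hilbert_ext (poly (q j)) z - hilbert_ext f z) \<le> 1 / real (Suc j) * E" for j
      proof -
        have g: "(\<lambda>w. f w - poly (q j) w) \<in> S" by (rule bnorm_diff(1)[OF f poly_in_space])
        have "hilbert_ext f z = hilbert_ext (\<lambda>w. f w - poly (q j) w) z + hilbert_ext (poly (q j)) z"
          using hilbert_ext_add[OF g poly_in_space[of "q j"] z] by simp
        then have "cmod (hilbert_ext (poly (q j)) z - hilbert_ext f z) = cmod (hilbert_ext (\<lambda>w. f w - poly (q j) w) z)"
          by (simp add: norm_minus_commute)
        also have "\<dots> \<le> N (\<lambda>w. f w - poly (q j) w) * E"
          using hilbert_ext_bound[OF g z] by (simp add: E_def)
        also have "\<dots> \<le> 1 / real (Suc j) * E"
          using q[of j] E by (intro mult_right_mono) auto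
        finally show ?thesis .
      qed
      have "(\<lambda>j. 1 / real (Suc j) * E) \<longlonglongrightarrow> 0 * E"
        by (intro tendsto_intros LIMSEQ_Suc[OF lim_1_over_n])
      then have "(\<lambda>j. hilbert_ext (poly (q j)) z - hilbert_ext f z) \<longlonglongrightarrow> 0"
        by (intro Lim_null_comparison[OF always_eventually[OF allI[OF le]]]) simp
      then show ?thesis by (simp add: LIM_zero_iff)
    qed
    have "(\<integral>\<^sup>+z. ennreal (cmod (hilbert_ext f z) ^ (2 * m)) \<partial>M) =
      (\<integral>\<^sup>+z. liminf (\<lambda>j. ennreal (cmod (hilbert_ext (poly (q j)) z) ^ (2 * m))) \<partial>M)"
    proof (rule nn_integral_cong)
      fix z assume "z \<in> space M"
      then have "(\<lambda>j. ennreal (cmod (hilbert_ext (poly (q j)) z) ^ (2 * m))) \<longlonglongrightarrow> ennreal (cmod (hilbert_ext f z) ^ (2 * m))"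
        by (intro tendsto_ennrealI tendsto_intros lim) simp
      then show "ennreal (cmod (hilbert_ext f z) ^ (2 * m)) = liminf (\<lambda>j. ennreal (cmod (hilbert_ext (poly (q j)) z) ^ (2 * m)))"
        using lim_imp_Liminf[OF sequentially_bot] by metis
    qed
    also have "\<dots> \<le> liminf (\<lambda>j. \<integral>\<^sup>+z. ennreal (cmod (hilbert_ext (poly (q j)) z) ^ (2 * m)) \<partial>M)"
    proof (rule nn_integral_liminf)
      fix j
      have "(\<lambda>z. cmod (hilbert_ext (poly (q j)) z) ^ (2 * m)) \<in> borel_measurable M"
        by (intro continuous_on_imp_measurable_bergman continuous_intros holomorphic_on_imp_continuous_on
              has_disc_fps_holomorphic[OF hilbert_ext_fps[OF poly_in_space]])
      then show "(\<lambda>z. ennreal (cmod (hilbert_ext (poly (q j)) z) ^ (2 * m))) \<in> borel_measurable M"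
        by measurable
    qed
    also have "\<dots> \<le> liminf (\<lambda>j::nat. ennreal ((B * (N f + e)) ^ (2 * m)))"
    proof (intro Liminf_mono always_eventually allI)
      fix j
      show "(\<integral>\<^sup>+z. ennreal (cmod (hilbert_ext (poly (q j)) z) ^ (2 * m)) \<partial>M) \<le> ennreal ((B * (N f + e)) ^ (2 * m))"
        by (rule order_trans[OF polys]) (use B qN[of j] in \<open>auto intro!: ennreal_leI power_mono mult_left_mono\<close>)
    qed
    also have "\<dots> = ennreal ((B * (N f + e)) ^ (2 * m))"
      by (simp add: Liminf_const)
    finally have "(\<integral>\<^sup>+z. ennreal (cmod (hilbert_ext f z) ^ (2 * m)) \<partial>M) \<le> ennreal ((B * (N f + e)) ^ (2 * m))" .
    then show ?thesis
      using spaceI[OF has_disc_fps_holomorphic[OF hilbert_ext_fps[OF f]]] B e by simp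
  qed
  show "hilbert_ext f \<in> S" using key[of 1] by simp
  show "N (hilbert_ext f) \<le> B * N f"
  \<comment> \<open>For B > 0 the slack is used as e / B.\<close>
  proof (cases "B = 0")
    case True
    then show ?thesis using key[of 1] by simp
  next
    case False
    show ?thesis
    proof (rule field_le_epsilon)
      fix e :: real assume "e > 0"
      then show "N (hilbert_ext f) \<le> B * N f + e"
        using key[of "e / B"] B False by (simp add: distrib_left)
    qed
  qed
qed

lemma is_hilbert_operator_hilbert_ext:
  assumes "\<And>f. f \<in> S \<Longrightarrow> hilbert_ext f \<in> S" "\<And>f. f \<in> S \<Longrightarrow> N (hilbert_ext f) \<le> B * N f"
  shows "is_hilbert_operator (2 * real m) \<alpha> hilbert_ext"
  unfolding is_hilbert_operator_def bergman_bounded_linear_def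
  using assms hilbert_ext_add hilbert_ext_cmult hilbert_ext_poly by auto

end

section \<open>Averaging over linear fractional maps\<close>

definition hilbert_mult :: "real \<Rightarrow> complex \<Rightarrow> complex" where
  "hilbert_mult t z = 1 / (1 - of_real (1 - t) * z)"

definition hilbert_map :: "real \<Rightarrow> complex \<Rightarrow> complex" where
  "hilbert_map t z = of_real t * hilbert_mult t z"

definition hilbert_kernel :: "real \<Rightarrow> real \<Rightarrow> real" where
  "hilbert_kernel a t = t powr (a - 1) * (1 - t) powr (- a)"

lemma hilbert_kernel_pos: "0 < t \<Longrightarrow> t < 1 \<Longrightarrow> hilbert_kernel a t > 0"
  by (simp add: hilbert_kernel_def)

lemma hilbert_kernel_measurable [measurable]: "hilbert_kernel a \<in> borel_measurable borel"
  unfolding hilbert_kernel_def by measurable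

lemma nn_integral_Beta:
  assumes "x > 0" "y > 0"
  shows "(\<integral>\<^sup>+t. ennreal (indicator {0<..<1} t * (t powr (x - 1) * (1 - t) powr (y - 1))) \<partial>lborel) = ennreal (Beta x y)"
  using has_integral_Beta_real[OF assms]
  by (intro nn_integral_has_integral_lebesgue) (auto simp: has_integral_Icc_iff_Ioo)

lemma nn_integral_hilbert_kernel:
  assumes "0 < a" "a < 1"
  shows "(\<integral>\<^sup>+t. ennreal (indicator {0<..<1} t * hilbert_kernel a t) \<partial>lborel) = ennreal (Beta a (1 - a))"
  using nn_integral_Beta[of a "1 - a"] assms by (simp add: hilbert_kernel_def)

lemma integral_power_Beta:
  shows "set_integrable lborel {0<..<1} (\<lambda>t. t ^ k * (1 - t) ^ n :: real)"
    and "(LINT t:{0<..<1}|lborel. t ^ k * (1 - t) ^ n :: real) = fact k * fact n / fact (n + k + 1)"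
proof -
  have "set_integrable lborel {0..1} (\<lambda>t. t ^ k * (1 - t) ^ n :: real)"
    by (rule borel_integrable_atLeastAtMost') (intro continuous_intros)
  then show si: "set_integrable lborel {0<..<1} (\<lambda>t. t ^ k * (1 - t) ^ n :: real)"
    by (rule set_integrable_subset) auto
  have "Beta (real (Suc k)) (real (Suc n)) = fact k * fact n / fact (n + k + 1)"
  proof -
    have "Gamma (real (Suc k) + real (Suc n)) = fact (n + k + 1)"
      using Gamma_fact[of "n + k + 1", where 'a=real] by (simp add: add_ac)
    then show ?thesis
      using Gamma_fact[of k, where 'a=real] Gamma_fact[of n, where 'a=real]
      by (simp add: Beta_def add.commute)
  qed
  moreover have "((\<lambda>t. t powr (real (Suc k) - 1) * (1 - t) powr (real (Suc n) - 1)) has_integral Beta (real (Suc k)) (real (Suc n))) {0<..<1::real}"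
    using has_integral_Beta_real[of "real (Suc k)" "real (Suc n)"] by (simp add: has_integral_Icc_iff_Ioo)
  then have "((\<lambda>t. t ^ k * (1 - t) ^ n) has_integral Beta (real (Suc k)) (real (Suc n))) {0<..<1::real}"
    by (rule has_integral_eq[rotated]) (simp add: powr_realpow)
  then have "integral {0<..<1::real} (\<lambda>t. t ^ k * (1 - t) ^ n) = Beta (real (Suc k)) (real (Suc n))"
    by (rule integral_unique)
  ultimately show "(LINT t:{0<..<1}|lborel. t ^ k * (1 - t) ^ n :: real) = fact k * fact n / fact (n + k + 1)"
    by (simp add: set_borel_integral_eq_integral(2)[OF si])
qed

lemma hilbert_mult_denom_nonzero:
  assumes "cmod z < 1" "0 \<le> t" "t \<le> 1"
  shows "1 - of_real (1 - t) * z \<noteq> 0" "cmod (of_real (1 - t) * z) < 1"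
proof -
  have "cmod (of_real (1 - t) * z) \<le> 1 * cmod z"
    unfolding norm_mult using assms by (intro mult_right_mono) (auto simp del: of_real_diff)
  then show l: "cmod (of_real (1 - t) * z) < 1" using assms by simp
  then show "1 - of_real (1 - t) * z \<noteq> 0" by auto
qed

text \<open>The integrand is t^k (1 - (1 - t) z)^(-(k + 1)); its binomial expansion in powers of (1
  - t) z is integrated term by term. This verifies the averaging formula on coefficients, with no
  deformation of a path of integration.\<close>

lemma hilbert_monomial_integral:
  assumes z: "cmod z < 1"
  shows "set_integrable lborel {0<..<1} (\<lambda>t. hilbert_mult t z * hilbert_map t z ^ k)"
    and "(\<lambda>n. z ^ n / of_nat (n + k + 1)) sums (LINT t:{0<..<1}|lborel. hilbert_mult t z * hilbert_map t z ^ k)"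
proof -
  define P where "P = (\<lambda>n. pochhammer (real (k + 1)) n / fact n)"
  define f where "f = (\<lambda>n t. of_real (indicator {0<..<1} t * (t ^ k * (1 - t) ^ n)) * (of_real (P n) * z ^ n))"
  have P0: "P n \<ge> 0" for n by (simp add: P_def pochhammer_nonneg)
  \<comment> \<open>The Beta integral of t^k (1 - t)^n cancels the binomial coefficient
    \<open>P n\<close> up to 1 / (n + k + 1), the entry of the Hilbert matrix.\<close>
  have Pv: "P n * (fact k * fact n / fact (n + k + 1)) = 1 / real (n + k + 1)" for n
  proof -
    have "pochhammer (real (k + 1)) n = fact (n + k) / fact k"
      using pochhammer_eq_Gamma_quotient[of "real (k + 1)" n] Gamma_fact[of k, where 'a=real] Gamma_fact[of "n + k", where 'a=real]
      by (simp add: add_ac)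
    then show ?thesis by (simp add: P_def)
  qed
  have si: "integrable lborel (\<lambda>t. indicator {0<..<1} t * (t ^ k * (1 - t) ^ n :: real))" for n
    using integral_power_Beta(1)[of k n] by (simp add: set_integrable_def)
  have sI: "(LINT t|lborel. indicator {0<..<1} t * (t ^ k * (1 - t) ^ n :: real)) = fact k * fact n / fact (n + k + 1)" for n
    using integral_power_Beta(2)[of k n] by (simp add: set_lebesgue_integral_def)
  have fi: "integrable lborel (f n)" for n
    unfolding f_def by (intro integrable_mult_left integrable_of_real si)
  have fI: "(LINT t|lborel. f n t) = z ^ n / of_nat (n + k + 1)" for n
  proof -
    have "(LINT t|lborel. f n t) = of_real (LINT t|lborel. indicator {0<..<1} t * (t ^ k * (1 - t) ^ n :: real)) * (of_real (P n) * z ^ n)"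
      unfolding f_def by (simp only: integral_mult_left_zero integral_complex_of_real)
    also have "\<dots> = of_real (P n * (fact k * fact n / fact (n + k + 1))) * z ^ n"
      unfolding sI by simp
    also have "\<dots> = z ^ n / of_nat (n + k + 1)"
      unfolding Pv by simp
    finally show ?thesis .
  qed
  have fN: "norm (f n t) = (indicator {0<..<1} t * (t ^ k * (1 - t) ^ n)) * (P n * cmod z ^ n)" for n t
    using P0[of n] by (simp add: f_def norm_mult norm_power indicator_def del: of_real_mult of_real_power of_real_diff)
  have fNI: "(LINT t|lborel. norm (f n t)) = cmod z ^ n / real (n + k + 1)" for n
  proof -
    have "(LINT t|lborel. norm (f n t)) = P n * (fact k * fact n / fact (n + k + 1)) * cmod z ^ n"
      unfolding fN by (simp add: sI)
    then show ?thesis unfolding Pv by simp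
  qed
  have sums_f: "(\<lambda>n. f n t) sums (indicator {0<..<1} t *\<^sub>R (hilbert_mult t z * hilbert_map t z ^ k))" for t
  proof (cases "t \<in> {0<..<1}")
    case True
    define x where "x = of_real (1 - t) * z"
    have x: "cmod x < 1" "1 - x \<noteq> 0"
      unfolding x_def using hilbert_mult_denom_nonzero[OF z, of t] True by auto
    have "(\<lambda>n. pochhammer (of_nat (k + 1)) n / fact n * x ^ n) sums (1 - x) powr (- of_nat (k + 1))"
      by (rule one_minus_powr_complex_sums[OF x(1)])
    also have "(1 - x) powr (- of_nat (k + 1)) = 1 / (1 - x) ^ (k + 1)"
      unfolding powr_minus_divide using powr_nat'[of "1 - x" "k + 1"] by simp
    finally have "(\<lambda>n. of_real t ^ k * (pochhammer (of_nat (k + 1)) n / fact n * x ^ n)) sums (of_real t ^ k * (1 / (1 - x) ^ (k + 1)))"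
      by (rule sums_mult)
    moreover have "of_real t ^ k * (pochhammer (of_nat (k + 1)) n / fact n * x ^ n) = f n t" for n
    proof -
      have "complex_of_real (P n) = pochhammer (of_nat (k + 1)) n / fact n"
        using pochhammer_of_real[of "real (k + 1)" n, where 'a=complex] by (simp add: P_def)
      then show ?thesis using True by (simp add: f_def x_def power_mult_distrib)
    qed
    moreover have "of_real t ^ k * (1 / (1 - x) ^ (k + 1)) = hilbert_mult t z * hilbert_map t z ^ k"
      by (simp add: hilbert_map_def hilbert_mult_def x_def power_divide)
    ultimately show ?thesis using True by simp
  qed (simp add: f_def)
  have summable_norm: "summable (\<lambda>n. norm (f n t))" for t
  proof (cases "t \<in> {0<..<1}")
    case True
    have "cmod (of_real (1 - t) * z) < 1" using hilbert_mult_denom_nonzero(2)[OF z, of t] True by auto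
    then have "\<bar>(1 - t) * cmod z\<bar> < 1" using True by (simp add: norm_mult del: of_real_diff)
    from one_minus_powr_real_sums[OF this, of "real (k + 1)"]
    have "summable (\<lambda>n. t ^ k * (P n * ((1 - t) * cmod z) ^ n))"
      unfolding P_def by (intro summable_mult) (rule sums_summable)
    then show ?thesis unfolding fN using True by (simp add: power_mult_distrib mult_ac)
  qed (simp add: f_def)
  have sI': "summable (\<lambda>n. LINT t|lborel. norm (f n t))"
    unfolding fNI
  proof (rule summable_comparison_test'[where g="\<lambda>n. cmod z ^ n" and N=0])
    show "summable (\<lambda>n. cmod z ^ n)" using z by (simp add: summable_geometric)
    show "norm (cmod z ^ n / real (n + k + 1)) \<le> cmod z ^ n" for n
      by (simp add: divide_le_eq mult_le_cancel_left1)
  qed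
  have e: "(\<Sum>n. f n t) = indicator {0<..<1} t *\<^sub>R (hilbert_mult t z * hilbert_map t z ^ k)" for t
    using sums_f[of t] by (simp add: sums_iff)
  show "set_integrable lborel {0<..<1} (\<lambda>t. hilbert_mult t z * hilbert_map t z ^ k)"
    using integrable_suminf[OF fi _ sI'] summable_norm unfolding e set_integrable_def by auto
  show "(\<lambda>n. z ^ n / of_nat (n + k + 1)) sums (LINT t:{0<..<1}|lborel. hilbert_mult t z * hilbert_map t z ^ k)"
    using sums_integral[OF fi _ sI'] summable_norm unfolding e fI set_lebesgue_integral_def by auto
qed

lemma hilbert_ext_poly_integral:
  assumes z: "cmod z < 1"
  shows "set_integrable lborel {0<..<1} (\<lambda>t. hilbert_mult t z * poly q (hilbert_map t z))"
    and "hilbert_ext (poly q) z = (LINT t:{0<..<1}|lborel. hilbert_mult t z * poly q (hilbert_map t z))"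
proof -
  have e: "hilbert_mult t z * poly q (hilbert_map t z) =
     (\<Sum>k\<le>degree q. coeff q k * (hilbert_mult t z * hilbert_map t z ^ k))" for t
    by (simp add: poly_altdef sum_distrib_left mult_ac)
  have i: "integrable lborel (\<lambda>t. indicator {0<..<1} t *\<^sub>R (coeff q k * (hilbert_mult t z * hilbert_map t z ^ k)))" for k
    using set_integrable_mult_right[OF hilbert_monomial_integral(1)[OF z, of k], of "coeff q k"]
    by (simp add: set_integrable_def)
  show "set_integrable lborel {0<..<1} (\<lambda>t. hilbert_mult t z * poly q (hilbert_map t z))"
    unfolding e set_integrable_def scaleR_sum_right by (intro Bochner_Integration.integrable_sum i)
  have "(\<lambda>n. \<Sum>k\<le>degree q. coeff q k * (z ^ n / of_nat (n + k + 1))) sums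
     (\<Sum>k\<le>degree q. coeff q k * (LINT t:{0<..<1}|lborel. hilbert_mult t z * hilbert_map t z ^ k))"
    by (intro sums_sum sums_mult hilbert_monomial_integral(2) z)
  also have "(\<Sum>k\<le>degree q. coeff q k * (LINT t:{0<..<1}|lborel. hilbert_mult t z * hilbert_map t z ^ k)) =
     (LINT t:{0<..<1}|lborel. hilbert_mult t z * poly q (hilbert_map t z))"
    unfolding e set_lebesgue_integral_def scaleR_sum_right
    by (subst Bochner_Integration.integral_sum[OF i]) (simp del: mult_scaleR_right add: mult_scaleR_right[symmetric])
  finally have "(LINT t:{0<..<1}|lborel. hilbert_mult t z * poly q (hilbert_map t z)) =
     (\<Sum>n. \<Sum>k\<le>degree q. coeff q k * (z ^ n / of_nat (n + k + 1)))"
    by (simp add: sums_iff)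
  also have "\<dots> = hilbert_matrix (coeff q) z"
  proof -
    have "(\<Sum>k\<le>degree q. coeff q k * (z ^ n / of_nat (n + k + 1))) = (\<Sum>k. coeff q k / of_nat (n + k + 1)) * z ^ n" for n
    proof -
      have "(\<Sum>k. coeff q k / of_nat (n + k + 1)) = (\<Sum>k\<le>degree q. coeff q k / of_nat (n + k + 1))"
        by (rule suminf_finite) (auto simp: coeff_eq_0)
      then show ?thesis by (simp add: sum_distrib_right)
    qed
    then show ?thesis by (simp add: hilbert_matrix_def)
  qed
  finally show "hilbert_ext (poly q) z = (LINT t:{0<..<1}|lborel. hilbert_mult t z * poly q (hilbert_map t z))"
    by (simp add: hilbert_ext_poly)
qed

section \<open>Jensen's inequality for a power\<close>

lemma power_ge_tangent:
  fixes x y :: real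
  assumes "x \<ge> 0" "y \<ge> 0" "k \<ge> 1"
  shows "y ^ k + real k * y ^ (k - 1) * (x - y) \<le> x ^ k"
proof (cases "y = 0")
  case True
  then show ?thesis using assms by (cases "k = 1") (auto simp: power_0_left)
next
  case False
  then have y: "y > 0" using assms by simp
  have "y ^ k * (1 + real k * (x / y - 1)) \<le> y ^ k * (1 + (x / y - 1)) ^ k"
    using y assms by (intro mult_left_mono Bernoulli_inequality) auto
  also have "\<dots> = x ^ k" using y by (simp add: power_divide)
  also have "y ^ k * (1 + real k * (x / y - 1)) = y ^ k + real k * y ^ (k - 1) * (x - y)"
    using y assms(3) by (cases k) (simp_all add: field_simps)
  finally show ?thesis .
qed

text \<open>The power is minorised by its tangent at the weighted mean y = I / B: integrated against
  \<kappa>, the linear term vanishes and y^k B remains. The factor B^(k - 1) appears because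
  \<kappa> has mass B instead of 1.\<close>

lemma integral_power_le_weighted:
  fixes \<kappa> X :: "'a \<Rightarrow> real"
  assumes \<kappa>: "integrable \<mu> \<kappa>" "\<And>t. \<kappa> t \<ge> 0" "(LINT t|\<mu>. \<kappa> t) = B" "B > 0"
    and X: "integrable \<mu> (\<lambda>t. \<kappa> t * X t)" "\<And>t. X t \<ge> 0" and k: "k \<ge> 1"
  shows "ennreal ((LINT t|\<mu>. \<kappa> t * X t) ^ k) \<le> ennreal (B ^ (k - 1)) * (\<integral>\<^sup>+t. ennreal (\<kappa> t * X t ^ k) \<partial>\<mu>)"
proof -
  define I where "I = (LINT t|\<mu>. \<kappa> t * X t)"
  define y where "y = I / B"
  have I0: "I \<ge> 0" unfolding I_def using \<kappa>(2) X(2) by (intro integral_nonneg_AE) auto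
  have y0: "y \<ge> 0" unfolding y_def using I0 \<kappa>(4) by simp
  define g where "g = (\<lambda>t. (y ^ k - real k * y ^ (k - 1) * y) * \<kappa> t + real k * y ^ (k - 1) * (\<kappa> t * X t))"
  have gi: "integrable \<mu> g" unfolding g_def using \<kappa>(1) X(1) by (intro Bochner_Integration.integrable_add integrable_mult_right)
  have "(LINT t|\<mu>. g t) = (y ^ k - real k * y ^ (k - 1) * y) * B + real k * y ^ (k - 1) * I"
    unfolding g_def I_def using \<kappa>(1,3) X(1) by simp
  also have "I = y * B" using \<kappa>(4) by (simp add: y_def)
  finally have gI: "(LINT t|\<mu>. g t) = y ^ k * B" by (simp add: algebra_simps)
  have gle: "g t \<le> \<kappa> t * X t ^ k" for t
  proof -
    have "\<kappa> t * (y ^ k + real k * y ^ (k - 1) * (X t - y)) \<le> \<kappa> t * X t ^ k"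
      using \<kappa>(2) X(2) y0 k by (intro mult_left_mono power_ge_tangent)
    then show ?thesis by (simp add: g_def algebra_simps)
  qed
  \<comment> \<open>The weighted tangent may be negative while its upper bound is not, so it is
    replaced by its positive part before the passage to \<open>ennreal\<close>.\<close>
  have "ennreal (y ^ k * B) \<le> ennreal (LINT t|\<mu>. max 0 (g t))"
    unfolding gI[symmetric] by (intro ennreal_leI integral_mono gi) (use gi in auto)
  also have "\<dots> = (\<integral>\<^sup>+t. ennreal (max 0 (g t)) \<partial>\<mu>)"
    by (rule nn_integral_eq_integral[symmetric]) (use gi in auto)
  also have "\<dots> \<le> (\<integral>\<^sup>+t. ennreal (\<kappa> t * X t ^ k) \<partial>\<mu>)"
    using gle \<kappa>(2) X(2) by (intro nn_integral_mono ennreal_leI) auto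
  finally have "ennreal (B ^ (k - 1)) * ennreal (y ^ k * B) \<le> ennreal (B ^ (k - 1)) * (\<integral>\<^sup>+t. ennreal (\<kappa> t * X t ^ k) \<partial>\<mu>)"
    by (rule mult_left_mono) simp
  moreover have "ennreal (B ^ (k - 1)) * ennreal (y ^ k * B) = ennreal (I ^ k)"
  proof -
    have "B ^ (k - 1) * (y ^ k * B) = (y * B) ^ k"
      using k by (cases k) (auto simp: power_mult_distrib)
    also have "y * B = I" using \<kappa>(4) by (simp add: y_def)
    finally show ?thesis using \<kappa>(4) y0 by (simp add: ennreal_mult[symmetric])
  qed
  ultimately show ?thesis by (simp add: I_def)
qed

lemma poly_borel_measurable [measurable]: "poly (q :: complex poly) \<in> borel_measurable borel"
  by (intro borel_measurable_continuous_onI continuous_intros)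

context hilbert_bergman
begin

text \<open>Jensen with weight k and values |w_t q(phi_t)| / k(t), whose product with the weight is
  the modulus of the integrand in the averaging formula; then Tonelli, so that whole slices are
  integrated first.\<close>

lemma hilbert_ext_power_le:
  "(\<integral>\<^sup>+z. ennreal (cmod (hilbert_ext (poly q) z) ^ (2 * m)) \<partial>M) \<le>
   ennreal (Beta a (1 - a) ^ (2 * m - 1)) *
   (\<integral>\<^sup>+t. \<integral>\<^sup>+z. ennreal (indicator {0<..<1} t * (hilbert_kernel a t *
      (cmod (hilbert_mult t z * poly q (hilbert_map t z)) / hilbert_kernel a t) ^ (2 * m))) \<partial>M \<partial>lborel)"
proof -
  let ?\<kappa> = "\<lambda>t. indicator {0<..<1} t * hilbert_kernel a t"
  let ?g = "\<lambda>z t. cmod (hilbert_mult t z * poly q (hilbert_map t z))"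
  let ?X = "\<lambda>z t. indicator {0<..<1} t * (?g z t / hilbert_kernel a t)"
  let ?h = "\<lambda>z t. ennreal (indicator {0<..<1} t * (hilbert_kernel a t * (?g z t / hilbert_kernel a t) ^ (2 * m)))"
  have B: "Beta a (1 - a) > 0" using a_bounds by (simp add: Beta_def)
  have k0: "?\<kappa> t \<ge> 0" for t by (auto simp: indicator_def hilbert_kernel_def)
  have ki: "integrable lborel ?\<kappa>"
    by (rule integrableI_nn_integral_finite[where x="Beta a (1 - a)"])
       (use nn_integral_hilbert_kernel[OF a_bounds] k0 B in auto)
  have kI: "(LINT t|lborel. ?\<kappa> t) = Beta a (1 - a)"
    using nn_integral_eq_integral[OF ki] nn_integral_hilbert_kernel[OF a_bounds] k0 B
    by (auto simp: integral_nonneg_AE)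
  have pt: "ennreal (cmod (hilbert_ext (poly q) z) ^ (2 * m)) \<le>
     ennreal (Beta a (1 - a) ^ (2 * m - 1)) * (\<integral>\<^sup>+t. ?h z t \<partial>lborel)" if z: "cmod z < 1" for z
  proof -
    have kX: "?\<kappa> t * ?X z t = indicator {0<..<1} t * ?g z t" for t
      using hilbert_kernel_pos[of t a] by (auto simp: indicator_def)
    have gi: "integrable lborel (\<lambda>t. indicator {0<..<1} t *\<^sub>R (hilbert_mult t z * poly q (hilbert_map t z)))"
      using hilbert_ext_poly_integral(1)[OF z, of q] by (simp add: set_integrable_def)
    have Xi: "integrable lborel (\<lambda>t. ?\<kappa> t * ?X z t)"
      unfolding kX using integrable_norm[OF gi] by simp
    have "cmod (hilbert_ext (poly q) z) \<le> (LINT t|lborel. norm (indicator {0<..<1} t *\<^sub>R (hilbert_mult t z * poly q (hilbert_map t z))))"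
      unfolding hilbert_ext_poly_integral(2)[OF z] set_lebesgue_integral_def by (rule integral_norm_bound)
    also have "\<dots> = (LINT t|lborel. ?\<kappa> t * ?X z t)"
      unfolding kX by simp
    finally have "ennreal (cmod (hilbert_ext (poly q) z) ^ (2 * m)) \<le> ennreal ((LINT t|lborel. ?\<kappa> t * ?X z t) ^ (2 * m))"
      by (intro ennreal_leI power_mono) auto
    also have "\<dots> \<le> ennreal (Beta a (1 - a) ^ (2 * m - 1)) * (\<integral>\<^sup>+t. ennreal (?\<kappa> t * ?X z t ^ (2 * m)) \<partial>lborel)"
      by (rule integral_power_le_weighted[OF ki k0 kI B Xi]) (use m1 hilbert_kernel_pos[of _ a] in \<open>auto simp: indicator_def less_imp_le\<close>)
    also have "(\<integral>\<^sup>+t. ennreal (?\<kappa> t * ?X z t ^ (2 * m)) \<partial>lborel) = (\<integral>\<^sup>+t. ?h z t \<partial>lborel)"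
      by (intro nn_integral_cong arg_cong[where f=ennreal]) (auto simp: indicator_def)
    finally show ?thesis .
  qed
  interpret F: finite_measure M using finite_measure_bergman[OF \<alpha>] .
  interpret P: pair_sigma_finite M lborel ..
  \<comment> \<open>\<open>M\<close> is a measure on the disc, so its coordinate has to be
    recognised as a Borel map into the plane before joint measurability can be derived.\<close>
  have id: "(\<lambda>z. z) \<in> M \<rightarrow>\<^sub>M borel"
    by (rule borel_measurable_bergman) simp
  have [measurable]: "fst \<in> M \<Otimes>\<^sub>M lborel \<rightarrow>\<^sub>M borel"
    by (rule measurable_compose[OF measurable_fst id])
  have [measurable]: "snd \<in> M \<Otimes>\<^sub>M lborel \<rightarrow>\<^sub>M (borel :: real measure)"
    using measurable_snd[of M lborel] by simp
  have mh: "case_prod ?h \<in> borel_measurable (M \<Otimes>\<^sub>M lborel)"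
    unfolding hilbert_mult_def hilbert_map_def case_prod_beta by measurable
  have "(\<integral>\<^sup>+z. ennreal (cmod (hilbert_ext (poly q) z) ^ (2 * m)) \<partial>M) \<le>
     (\<integral>\<^sup>+z. ennreal (Beta a (1 - a) ^ (2 * m - 1)) * (\<integral>\<^sup>+t. ?h z t \<partial>lborel) \<partial>M)"
    by (intro nn_integral_mono pt) simp
  also have "\<dots> = ennreal (Beta a (1 - a) ^ (2 * m - 1)) * (\<integral>\<^sup>+z. \<integral>\<^sup>+t. ?h z t \<partial>lborel \<partial>M)"
    by (rule nn_integral_cmult) (use lborel.borel_measurable_nn_integral[OF mh] in simp)
  also have "(\<integral>\<^sup>+z. \<integral>\<^sup>+t. ?h z t \<partial>lborel \<partial>M) = (\<integral>\<^sup>+t. \<integral>\<^sup>+z. ?h z t \<partial>M \<partial>lborel)"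
    by (rule P.Fubini'[symmetric, OF mh])
  finally show ?thesis .
qed

end

section \<open>The case \<open>a \<le> 1/2\<close>\<close>

lemma norm_hilbert_mult_le:
  assumes "cmod z < 1" "0 < t" "t \<le> 1"
  shows "cmod (hilbert_mult t z) \<le> 1 / t"
proof -
  have "cmod (of_real (1 - t) * z) \<le> (1 - t) * 1"
    unfolding norm_mult using assms by (intro mult_mono) (auto simp del: of_real_diff)
  then have "t \<le> cmod (1 - of_real (1 - t) * z)"
    using norm_triangle_ineq2[of 1 "of_real (1 - t) * z"] by simp
  then show ?thesis
    using assms by (simp add: hilbert_mult_def norm_divide frac_le)
qed

text \<open>Each entry c is split as sqrt (c p) times sqrt (c / p). In the Schur test p is the
  weight, and the first factor on the right is a weighted row sum.\<close>

lemma weighted_Cauchy_Schwarz: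
  fixes c p x :: "'a \<Rightarrow> real"
  assumes "\<And>n. n \<in> I \<Longrightarrow> c n \<ge> 0" "\<And>n. n \<in> I \<Longrightarrow> p n > 0"
  shows "(\<Sum>n\<in>I. c n * x n)\<^sup>2 \<le> (\<Sum>n\<in>I. c n * p n) * (\<Sum>n\<in>I. c n * (x n)\<^sup>2 / p n)"
proof -
  have "(\<Sum>n\<in>I. c n * x n) = (\<Sum>n\<in>I. sqrt (c n * p n) * (sqrt (c n / p n) * x n))"
  proof (intro sum.cong refl)
    fix n assume n: "n \<in> I"
    have "sqrt (c n * p n) * sqrt (c n / p n) = c n"
      using assms[OF n] by (simp add: real_sqrt_mult real_sqrt_divide)
    then show "c n * x n = sqrt (c n * p n) * (sqrt (c n / p n) * x n)"
      by (simp only: mult.assoc[symmetric])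
  qed
  also have "\<dots>\<^sup>2 \<le> (\<Sum>n\<in>I. (sqrt (c n * p n))\<^sup>2) * (\<Sum>n\<in>I. (sqrt (c n / p n) * x n)\<^sup>2)"
    by (rule Cauchy_Schwarz_ineq_sum)
  also have "(\<Sum>n\<in>I. (sqrt (c n * p n))\<^sup>2) = (\<Sum>n\<in>I. c n * p n)"
    using assms by (intro sum.cong) (auto simp: less_imp_le)
  also have "(\<Sum>n\<in>I. (sqrt (c n / p n) * x n)\<^sup>2) = (\<Sum>n\<in>I. c n * (x n)\<^sup>2 / p n)"
    using assms by (intro sum.cong) (auto simp: less_imp_le power_mult_distrib)
  finally show ?thesis .
qed

text \<open>Schur test: the coefficients of the composition arise from those of \<open>L\<close> by a matrix \<open>C\<close> with
  nonnegative entries, and with the weights \<open>1 / \<gamma> n\<close> its row and column sums are binomial series.\<close>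

lemma bergman_composition_le:
  fixes L :: "complex poly"
  assumes \<alpha>: "\<alpha> > -1" and t: "0 < t" "t < 1"
  defines "\<beta> \<equiv> \<alpha> + 2"
  shows "(\<integral>\<^sup>+z. ennreal ((cmod (1 - of_real (1 - t) * z) powr (- \<beta>) * cmod (poly L (hilbert_map t z)))\<^sup>2) \<partial>bergman_measure \<alpha>)
    \<le> ennreal ((t * (1 - t)) powr (- \<beta>)) * (\<integral>\<^sup>+z. ennreal ((cmod (poly L z))\<^sup>2) \<partial>bergman_measure \<alpha>)"
proof -
  define b where "b = coeff L"
  define d where "d = degree L"
  define \<gamma> where "\<gamma> = bergman_moment \<alpha>"
  \<comment> \<open>\<open>C j n\<close> is the coefficient of z^j in (1 - (1 - t) z)^(-\<beta>)
    phi_t^n = t^n (1 - (1 - t) z)^(-(\<beta> + n)).\<close>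
  define C where "C = (\<lambda>j n. t ^ n * (1 - t) ^ j * (pochhammer (\<beta> + real n) j / fact j))"
  define g where "g = (\<lambda>j. \<Sum>n\<le>d. of_real (C j n) * b n)"
  have \<beta>: "\<beta> > 0" using \<alpha> by (simp add: \<beta>_def)
  have \<gamma>p: "\<gamma> n > 0" for n unfolding \<gamma>_def by (rule bergman_moment_pos[OF \<alpha>])
  have \<gamma>: "1 / \<gamma> n = pochhammer \<beta> n / fact n" for n
    by (simp add: \<gamma>_def \<beta>_def bergman_moment_eq_pochhammer[OF \<alpha>])
  have C0: "C j n \<ge> 0" for j n
    unfolding C_def using t \<beta> by (intro mult_nonneg_nonneg divide_nonneg_nonneg pochhammer_nonneg) auto
  \<comment> \<open>The sum over j is t^n times a binomial series at 1 - t, with value t^(-(\<beta>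
    + n)); the powers t^n cancel, so the result does not depend on n.\<close>
  have col: "(\<lambda>j. C j n) sums (t powr (- \<beta>))" for n
  proof -
    have "(\<lambda>j. t ^ n * (pochhammer (\<beta> + real n) j / fact j * (1 - t) ^ j)) sums (t ^ n * (1 - (1 - t)) powr (- (\<beta> + real n)))"
      by (intro sums_mult one_minus_powr_real_sums) (use t in auto)
    moreover have "t ^ n * (1 - (1 - t)) powr (- (\<beta> + real n)) = t powr (- \<beta>)"
      using t by (simp add: powr_diff powr_realpow)
    ultimately show ?thesis by (simp add: C_def mult_ac)
  qed
  \<comment> \<open>The Pochhammer symbols satisfy (\<beta>)_n (\<beta> + n)_j = (\<beta>)_j
    (\<beta> + j)_n, both being (\<beta>)_(n + j). With the weights 1 / \<gamma> this turns the row
    into a binomial series at t, truncated at the degree.\<close>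
  have row: "(\<Sum>n\<le>d. C j n * (1 / \<gamma> n)) \<le> (1 - t) powr (- \<beta>) / \<gamma> j" for j
  proof -
    have e: "C j n * (1 / \<gamma> n) = (1 - t) ^ j / \<gamma> j * (pochhammer (\<beta> + real j) n / fact n * t ^ n)" for n
    proof -
      have "pochhammer \<beta> n * pochhammer (\<beta> + real n) j = pochhammer \<beta> j * pochhammer (\<beta> + real j) n"
        using pochhammer_product'[of \<beta> n j] pochhammer_product'[of \<beta> j n] by (simp add: add.commute)
      moreover have "C j n * (1 / \<gamma> n) = t ^ n * (1 - t) ^ j / (fact j * fact n) * (pochhammer \<beta> n * pochhammer (\<beta> + real n) j)"
        unfolding \<gamma> by (simp add: C_def)
      moreover have "(1 - t) ^ j / \<gamma> j * (pochhammer (\<beta> + real j) n / fact n * t ^ n) =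
         (1 - t) ^ j * (1 / \<gamma> j) * (pochhammer (\<beta> + real j) n / fact n * t ^ n)" by simp
      moreover have "\<dots> = t ^ n * (1 - t) ^ j / (fact j * fact n) * (pochhammer \<beta> j * pochhammer (\<beta> + real j) n)"
        unfolding \<gamma> by simp
      ultimately show ?thesis by simp
    qed
    have s: "(\<lambda>n. (1 - t) ^ j / \<gamma> j * (pochhammer (\<beta> + real j) n / fact n * t ^ n)) sums
       ((1 - t) ^ j / \<gamma> j * (1 - t) powr (- (\<beta> + real j)))"
      by (intro sums_mult one_minus_powr_real_sums) (use t in auto)
    have "(\<Sum>n\<le>d. C j n * (1 / \<gamma> n)) \<le> (1 - t) ^ j / \<gamma> j * (1 - t) powr (- (\<beta> + real j))"
      unfolding e sums_unique[OF s]
      using s t \<beta> \<gamma>p[of j] by (intro sum_le_suminf) (auto simp: sums_iff intro!: mult_nonneg_nonneg divide_nonneg_nonneg pochhammer_nonneg)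
    also have "\<dots> = (1 - t) powr (- \<beta>) / \<gamma> j"
      using t by (simp add: powr_diff powr_realpow)
    finally show ?thesis .
  qed
  have gj: "(cmod (g j))\<^sup>2 * \<gamma> j \<le> (1 - t) powr (- \<beta>) * (\<Sum>n\<le>d. C j n * ((cmod (b n))\<^sup>2 * \<gamma> n))" for j
  proof -
    have "cmod (g j) \<le> (\<Sum>n\<le>d. C j n * cmod (b n))"
      unfolding g_def by (rule order_trans[OF norm_sum]) (use C0 in \<open>simp add: norm_mult\<close>)
    then have "(cmod (g j))\<^sup>2 \<le> (\<Sum>n\<le>d. C j n * cmod (b n))\<^sup>2"
      by (intro power_mono) auto
    also have "\<dots> \<le> (\<Sum>n\<le>d. C j n * (1 / \<gamma> n)) * (\<Sum>n\<le>d. C j n * (cmod (b n))\<^sup>2 / (1 / \<gamma> n))"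
      by (rule weighted_Cauchy_Schwarz) (use C0 \<gamma>p in auto)
    also have "\<dots> \<le> ((1 - t) powr (- \<beta>) / \<gamma> j) * (\<Sum>n\<le>d. C j n * (cmod (b n))\<^sup>2 / (1 / \<gamma> n))"
      by (intro mult_right_mono row sum_nonneg) (use C0 \<gamma>p in \<open>auto simp: less_imp_le\<close>)
    also have "(\<Sum>n\<le>d. C j n * (cmod (b n))\<^sup>2 / (1 / \<gamma> n)) = (\<Sum>n\<le>d. C j n * ((cmod (b n))\<^sup>2 * \<gamma> n))"
      by (simp add: mult.assoc)
    finally show ?thesis using \<gamma>p[of j] by (simp add: field_simps)
  qed
  have fps: "has_disc_fps (Abs_fps g) (\<lambda>z. (1 - of_real (1 - t) * z) powr (- of_real \<beta>) * poly L (hilbert_map t z))"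
    unfolding has_disc_fps_def
  proof (intro allI impI)
    fix z :: complex assume z: "cmod z < 1"
    define x where "x = of_real (1 - t) * z"
    have x: "cmod x < 1" "1 - x \<noteq> 0"
      unfolding x_def using hilbert_mult_denom_nonzero[OF z, of t] t by auto
    have "(\<lambda>j. of_real (C j n) * b n * z ^ j) sums (b n * (of_real t ^ n * (1 - x) powr (- (of_real \<beta> + of_nat n))))" for n
    proof -
      have "(\<lambda>j. b n * (of_real t ^ n * (pochhammer (of_real \<beta> + of_nat n) j / fact j * x ^ j))) sums (b n * (of_real t ^ n * (1 - x) powr (- (of_real \<beta> + of_nat n))))"
        by (intro sums_mult one_minus_powr_complex_sums x)
      moreover have "b n * (of_real t ^ n * (pochhammer (of_real \<beta> + of_nat n) j / fact j * x ^ j)) = of_real (C j n) * b n * z ^ j" for j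
        using pochhammer_of_real[of "\<beta> + real n" j, where 'a=complex]
        by (simp add: C_def x_def power_mult_distrib)
      ultimately show ?thesis by simp
    qed
    then have "(\<lambda>j. \<Sum>n\<le>d. of_real (C j n) * b n * z ^ j) sums (\<Sum>n\<le>d. b n * (of_real t ^ n * (1 - x) powr (- (of_real \<beta> + of_nat n))))"
      by (intro sums_sum)
    moreover have "(\<Sum>n\<le>d. of_real (C j n) * b n * z ^ j) = fps_nth (Abs_fps g) j * z ^ j" for j
      by (simp add: g_def sum_distrib_right)
    moreover have "(\<Sum>n\<le>d. b n * (of_real t ^ n * (1 - x) powr (- (of_real \<beta> + of_nat n)))) = (1 - x) powr (- of_real \<beta>) * poly L (hilbert_map t z)"
    proof -
      have "(1 - x) powr (- (of_real \<beta> + of_nat n)) = (1 - x) powr (- of_real \<beta>) * (1 / (1 - x) ^ n)" for n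
      proof -
        have "(1 - x) powr (- (of_real \<beta> + of_nat n)) = (1 - x) powr (- of_real \<beta> + - of_nat n)" by simp
        also have "\<dots> = (1 - x) powr (- of_real \<beta>) * (1 - x) powr (- of_nat n)" by (rule powr_add)
        also have "(1 - x) powr (- of_nat n) = 1 / (1 - x) ^ n"
          unfolding powr_minus_divide using x(2) by simp
        finally show ?thesis .
      qed
      then show ?thesis
        unfolding poly_altdef hilbert_map_def hilbert_mult_def x_def[symmetric] b_def d_def
        by (simp add: sum_distrib_left power_divide mult_ac)
    qed
    ultimately show "(\<lambda>n. fps_nth (Abs_fps g) n * z ^ n) sums ((1 - of_real (1 - t) * z) powr (- of_real \<beta>) * poly L (hilbert_map t z))"
      by (simp add: x_def)
  qed
  have bsum: "ennreal (\<Sum>n\<le>d. (cmod (b n))\<^sup>2 * \<gamma> n) \<le> (\<integral>\<^sup>+z. ennreal ((cmod (poly L z))\<^sup>2) \<partial>bergman_measure \<alpha>)"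
  proof -
    have "ennreal (\<Sum>n\<le>d. (cmod (b n))\<^sup>2 * \<gamma> n) = (\<Sum>n\<le>d. ennreal ((cmod (b n))\<^sup>2 * \<gamma> n))"
      using \<gamma>p by (simp add: less_imp_le)
    also have "\<dots> \<le> (\<Sum>n. ennreal ((cmod (b n))\<^sup>2 * \<gamma> n))"
      by (rule sum_le_suminf) auto
    also have "\<dots> = (\<integral>\<^sup>+z. ennreal ((cmod (poly L z))\<^sup>2) \<partial>bergman_measure \<alpha>)"
      using bergman_parseval[OF \<alpha> has_disc_fps_poly[of L]] by (simp add: b_def \<gamma>_def)
    finally show ?thesis .
  qed
  have "(\<integral>\<^sup>+z. ennreal ((cmod (1 - of_real (1 - t) * z) powr (- \<beta>) * cmod (poly L (hilbert_map t z)))\<^sup>2) \<partial>bergman_measure \<alpha>)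
     = (\<integral>\<^sup>+z. ennreal ((cmod ((1 - of_real (1 - t) * z) powr (- of_real \<beta>) * poly L (hilbert_map t z)))\<^sup>2) \<partial>bergman_measure \<alpha>)"
    by (simp add: norm_mult norm_powr_real_powr' del: of_real_diff)
  also have "\<dots> = (\<Sum>j. ennreal ((cmod (g j))\<^sup>2 * \<gamma> j))"
    using bergman_parseval[OF \<alpha> fps] by (simp add: \<gamma>_def)
  also have "\<dots> \<le> (\<Sum>j. ennreal ((1 - t) powr (- \<beta>) * (\<Sum>n\<le>d. C j n * ((cmod (b n))\<^sup>2 * \<gamma> n))))"
    by (intro suminf_le ennreal_leI gj) auto
  also have "\<dots> = ennreal ((1 - t) powr (- \<beta>) * (\<Sum>n\<le>d. t powr (- \<beta>) * ((cmod (b n))\<^sup>2 * \<gamma> n)))"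
    by (intro suminf_ennreal_eq mult_nonneg_nonneg sum_nonneg sums_mult sums_sum sums_mult2 col)
       (use C0 \<gamma>p in \<open>auto simp: less_imp_le\<close>)
  also have "(1 - t) powr (- \<beta>) * (\<Sum>n\<le>d. t powr (- \<beta>) * ((cmod (b n))\<^sup>2 * \<gamma> n)) = (t * (1 - t)) powr (- \<beta>) * (\<Sum>n\<le>d. (cmod (b n))\<^sup>2 * \<gamma> n)"
    using t by (simp add: powr_mult sum_distrib_left mult_ac)
  also have "ennreal \<dots> = ennreal ((t * (1 - t)) powr (- \<beta>)) * ennreal (\<Sum>n\<le>d. (cmod (b n))\<^sup>2 * \<gamma> n)"
    by (rule ennreal_mult) (use \<gamma>p in \<open>auto intro!: sum_nonneg simp: less_imp_le\<close>)
  also have "\<dots> \<le> ennreal ((t * (1 - t)) powr (- \<beta>)) * (\<integral>\<^sup>+z. ennreal ((cmod (poly L z))\<^sup>2) \<partial>bergman_measure \<alpha>)"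
    by (intro mult_left_mono bsum) simp
  finally show ?thesis .
qed

context hilbert_bergman
begin

lemma hilbert_kernel_power:
  assumes "0 < t" "t < 1"
  shows "hilbert_kernel a t ^ (2 * m) = t powr (\<alpha> + 2 - 2 * real m) * (1 - t) powr (- (\<alpha> + 2))"
proof -
  have 1: "real (2 * m) * (a - 1) = \<alpha> + 2 - 2 * real m" "real (2 * m) * (- a) = - (\<alpha> + 2)"
    using m1 by (simp_all add: right_diff_distrib)
  have "hilbert_kernel a t ^ (2 * m) = (t powr (a - 1)) ^ (2 * m) * ((1 - t) powr (- a)) ^ (2 * m)"
    by (simp add: hilbert_kernel_def power_mult_distrib)
  also have "\<dots> = t powr (real (2 * m) * (a - 1)) * (1 - t) powr (real (2 * m) * (- a))"
    using assms by (simp only: powr_power[of t] powr_power[of "1 - t"] less_imp_neq[symmetric] diff_gt_0_iff_gt not_False_eq_True)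
  finally show ?thesis unfolding 1 .
qed

text \<open>Of |w_t|^(2m), the part with exponent 2 (\<alpha> + 2) is handled by
  \<open>bergman_composition_le\<close> for q^m. The rest has exponent 2 (m - \<alpha> - 2), which
  is nonnegative exactly if a <= 1/2, and is then at most that power of 1 / t.\<close>

lemma slice_bound_small:
  assumes small: "\<alpha> + 2 \<le> real m" and t: "0 < t" "t < 1"
  shows "(\<integral>\<^sup>+z. ennreal (cmod (hilbert_mult t z * poly q (hilbert_map t z)) ^ (2 * m)) \<partial>M) \<le>
    ennreal ((hilbert_kernel a t * N (poly q)) ^ (2 * m))"
proof -
  define L where "L = q ^ m"
  define c where "c = t powr (- (2 * (real m - (\<alpha> + 2))))"
  have pt: "cmod (hilbert_mult t z * poly q (hilbert_map t z)) ^ (2 * m) \<le>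
     c * (cmod (1 - of_real (1 - t) * z) powr (- (\<alpha> + 2)) * cmod (poly L (hilbert_map t z)))\<^sup>2" if z: "cmod z < 1" for z
  proof -
    define v where "v = cmod (1 - of_real (1 - t) * z)"
    have v: "v > 0" unfolding v_def using hilbert_mult_denom_nonzero(1)[OF z, of t] t by simp
    have vt: "v \<ge> t"
      using norm_hilbert_mult_le[OF z, of t] t v unfolding hilbert_mult_def v_def[symmetric] norm_divide
      by (simp add: field_simps)
    have "cmod (hilbert_mult t z) ^ (2 * m) = v powr (- real (2 * m))"
      unfolding hilbert_mult_def norm_divide v_def[symmetric] powr_minus_divide powr_realpow[OF v]
      by (simp add: power_divide)
    also have "\<dots> = v powr (- (2 * (real m - (\<alpha> + 2)))) * v powr (- (2 * (\<alpha> + 2)))"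
      by (simp add: powr_add[symmetric] algebra_simps)
    also have "\<dots> \<le> c * v powr (- (2 * (\<alpha> + 2)))"
      unfolding c_def using vt t small by (intro mult_right_mono powr_mono2') auto
    also have "v powr (- (2 * (\<alpha> + 2))) = (v powr (- (\<alpha> + 2)))\<^sup>2"
      using v by (simp add: powr_power)
    finally have "cmod (hilbert_mult t z) ^ (2 * m) * cmod (poly q (hilbert_map t z)) ^ (2 * m) \<le>
       c * (v powr (- (\<alpha> + 2)))\<^sup>2 * cmod (poly q (hilbert_map t z)) ^ (2 * m)"
      by (rule mult_right_mono) simp
    moreover have "cmod (poly q (hilbert_map t z)) ^ (2 * m) = (cmod (poly L (hilbert_map t z)))\<^sup>2"
      by (simp add: L_def poly_power norm_power power_mult[symmetric] mult.commute)
    ultimately show ?thesis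
      by (simp add: norm_mult power_mult_distrib v_def mult.assoc)
  qed
  have mm: "(\<lambda>z. ennreal ((cmod (1 - of_real (1 - t) * z) powr (- (\<alpha> + 2)) * cmod (poly L (hilbert_map t z)))\<^sup>2)) \<in> borel_measurable M"
    unfolding hilbert_map_def hilbert_mult_def by (rule borel_measurable_bergman) measurable
  have "(\<integral>\<^sup>+z. ennreal (cmod (hilbert_mult t z * poly q (hilbert_map t z)) ^ (2 * m)) \<partial>M) \<le>
    (\<integral>\<^sup>+z. ennreal c * ennreal ((cmod (1 - of_real (1 - t) * z) powr (- (\<alpha> + 2)) * cmod (poly L (hilbert_map t z)))\<^sup>2) \<partial>M)"
    using pt by (intro nn_integral_mono) (auto simp: ennreal_mult[symmetric] c_def intro!: ennreal_leI)
  also have "\<dots> = ennreal c * (\<integral>\<^sup>+z. ennreal ((cmod (1 - of_real (1 - t) * z) powr (- (\<alpha> + 2)) * cmod (poly L (hilbert_map t z)))\<^sup>2) \<partial>M)"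
    by (rule nn_integral_cmult[OF mm])
  also have "\<dots> \<le> ennreal c * (ennreal ((t * (1 - t)) powr (- (\<alpha> + 2))) * (\<integral>\<^sup>+z. ennreal ((cmod (poly L z))\<^sup>2) \<partial>M))"
    by (intro mult_left_mono bergman_composition_le[OF \<alpha> t]) simp
  also have "(\<integral>\<^sup>+z. ennreal ((cmod (poly L z))\<^sup>2) \<partial>M) = ennreal (N (poly q) ^ (2 * m))"
  proof -
    have "(cmod (poly L z))\<^sup>2 = cmod (poly q z) ^ (2 * m)" for z
      by (simp add: L_def poly_power norm_power power_mult[symmetric] mult.commute)
    then show ?thesis using nn_integral_eq_norm_power[OF poly_in_space[of q]] by simp
  qed
  also have "ennreal c * (ennreal ((t * (1 - t)) powr (- (\<alpha> + 2))) * ennreal (N (poly q) ^ (2 * m))) =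
     ennreal (c * (t * (1 - t)) powr (- (\<alpha> + 2)) * N (poly q) ^ (2 * m))"
    by (simp add: ennreal_mult c_def mult.assoc)
  also have "c * (t * (1 - t)) powr (- (\<alpha> + 2)) = hilbert_kernel a t ^ (2 * m)"
  proof -
    have "c * (t * (1 - t)) powr (- (\<alpha> + 2)) = (t powr (- (2 * (real m - (\<alpha> + 2)))) * t powr (- (\<alpha> + 2))) * (1 - t) powr (- (\<alpha> + 2))"
      unfolding c_def using t by (simp add: powr_mult)
    also have "t powr (- (2 * (real m - (\<alpha> + 2)))) * t powr (- (\<alpha> + 2)) = t powr (\<alpha> + 2 - 2 * real m)"
      by (simp add: powr_add[symmetric] algebra_simps)
    finally show ?thesis using hilbert_kernel_power[OF t] by simp
  qed
  finally show ?thesis by (simp add: power_mult_distrib)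
qed

end

section \<open>The case \<open>a > 1/2\<close>\<close>

lemma Gamma_duplication_real:
  fixes a :: real
  assumes "a > 0"
  shows "Gamma a * Gamma (a + 1 / 2) = 2 powr (1 - 2 * a) * sqrt pi * Gamma (2 * a)"
proof -
  have "complex_of_real a \<notin> \<int>\<^sub>\<le>\<^sub>0" "complex_of_real (a + 1 / 2) \<notin> \<int>\<^sub>\<le>\<^sub>0"
    unfolding of_real_in_nonpos_Ints_iff using assms by (auto dest: nonpos_Ints_nonpos)
  then have "complex_of_real (Gamma a * Gamma (a + 1 / 2)) =
      complex_of_real (exp ((1 - 2 * a) * ln 2) * sqrt pi * Gamma (2 * a))"
    using Gamma_legendre_duplication[of "complex_of_real a"]
      Gamma_complex_of_real[of a] Gamma_complex_of_real[of "a + 1 / 2"] Gamma_complex_of_real[of "2 * a"]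
      exp_of_real[of "(1 - 2 * a) * ln 2", where 'a=complex]
    by simp
  then show ?thesis
    by (simp only: of_real_eq_iff) (simp add: powr_def)
qed

text \<open>Legendre duplication turns the left-hand side into B(a, 1/2); Beta decreases in its
  second argument, and 1 - a <= 1/2.\<close>

lemma four_powr_Beta_le:
  fixes a :: real
  assumes "1 / 2 \<le> a" "a < 1"
  shows "4 powr a * Beta a (1 + a) \<le> Beta a (1 - a)"
proof -
  have a: "a > 0" using assms by simp
  have G1: "Gamma (1 + a) = a * Gamma a" and G2: "Gamma (a + (1 + a)) = 2 * a * Gamma (2 * a)"
    using Gamma_plus1_pos[of a] Gamma_plus1_pos[of "2 * a"] a by (simp_all add: add_ac)
  have pos: "Gamma a > 0" "Gamma (a + 1 / 2) > 0" "Gamma (2 * a) > 0"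
    using a by auto
  have four: "4 powr a * 2 powr (1 - 2 * a) = (2::real)"
  proof -
    have "(4::real) powr a = 2 powr (2 * a)"
      using powr_powr[of 2 2 a] by simp
    then show ?thesis by (simp add: powr_add[symmetric])
  qed
  have "4 powr a * Beta a (1 + a) = 4 powr a * Gamma a * Gamma a / (2 * Gamma (2 * a))"
    unfolding Beta_def G1 G2 using a pos by (simp add: field_simps)
  also have "\<dots> = 4 powr a * Gamma a * Gamma a * (2 powr (1 - 2 * a) * sqrt pi) / (2 * (Gamma a * Gamma (a + 1 / 2)))"
    unfolding Gamma_duplication_real[OF a] using pos by (simp add: field_simps)
  also have "\<dots> = (4 powr a * 2 powr (1 - 2 * a)) * (Gamma a * sqrt pi / (2 * Gamma (a + 1 / 2)))"
    using pos by (simp add: field_simps)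
  also have "\<dots> = Beta a (1 / 2)"
    unfolding four by (simp add: Beta_def Gamma_one_half_real)
  also have "\<dots> \<le> Beta a (1 - a)"
    by (rule Beta_real_mono) (use assms in auto)
  finally show ?thesis .
qed

text \<open>Convexity of exp between 0 and ln y, that is, the weighted inequality of arithmetic and
  geometric means for 1 and y.\<close>

lemma powr_le_weighted:
  fixes y \<theta> :: real
  assumes "y > 0" "0 \<le> \<theta>" "\<theta> \<le> 1"
  shows "y powr \<theta> \<le> 1 - \<theta> + \<theta> * y"
  using convex_onD[OF exp_convex, of \<theta> 0 "ln y"] assms by (simp add: powr_def mult.commute)

text \<open>Here \<open>t = c \<tau>\<close>. The weighted harmonic mean \<open>X\<close> of \<open>1\<close> and \<open>2 (1 - \<tau>)\<close> is at most the
  arithmetic mean, so convexity of \<open>x \<mapsto> x\<^sup>2\<^sup>a\<close> applies; this is where \<open>2 \<delta> \<le> 2 a\<close> is needed.\<close>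

lemma kernel_pointwise:
  fixes a \<alpha> \<delta> c \<tau> :: real
  assumes a: "1 / 2 \<le> a" "a < 1" and \<delta>: "0 \<le> \<delta>" "\<delta> \<le> a" "2 * \<delta> \<le> a + \<alpha>"
    and c: "0 < c" "c < 1" and \<tau>: "0 < \<tau>" "\<tau> < 1"
  shows "c * (hilbert_kernel a (c * \<tau>) * (1 - (1 - c) / (1 - c * \<tau>)) powr \<alpha>) \<le>
    (c / (2 - c)) powr (2 * \<delta>) *
     ((1 - \<delta> / a + \<delta> / a * (c / (2 - c))) * (\<tau> powr (a - 1) * (1 - \<tau>) powr (1 - a - 1)) +
      \<delta> / a * (1 - c / (2 - c)) * 4 powr a * (\<tau> powr (a - 1) * (1 - \<tau>) powr (1 + a - 1)))"
proof -
  define u where "u = 1 - c * \<tau>"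
  \<comment> \<open>\<open>P\<close> is the weight 1 - (1 - c) / (1 - t) at t = c \<tau>, and
    \<open>X\<close> is \<open>P\<close> divided by \<open>l\<close>, so that
    \<open>P powr (2 * \<delta>)\<close> releases the factor demanded on the right.\<close>
  define P where "P = c * (1 - \<tau>) / u"
  define X where "X = (2 - c) * (1 - \<tau>) / u"
  define l where "l = c / (2 - c)"
  have ct: "c * \<tau> < 1"
    using mult_strict_mono[of c 1 \<tau> 1] c \<tau> by simp
  have u: "u > 0" using ct by (simp add: u_def)
  have P: "P > 0" "P \<le> 1"
  proof -
    show "P > 0" unfolding P_def using c \<tau> u by simp
    have "c * (1 - \<tau>) \<le> u" unfolding u_def using c by (simp add: algebra_simps)
    then show "P \<le> 1" unfolding P_def using u by simp
  qed
  have X: "X > 0" unfolding X_def using c \<tau> u by simp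
  have l: "0 < l" "l < 1" unfolding l_def using c by (simp_all add: divide_less_eq)
  have PX: "P = l * X" unfolding P_def X_def l_def using c by simp
  have "1 - (1 - c) / (1 - c * \<tau>) = P"
    unfolding P_def u_def[symmetric] using u by (simp add: field_simps) (simp add: u_def algebra_simps)
  then have "c * (hilbert_kernel a (c * \<tau>) * (1 - (1 - c) / (1 - c * \<tau>)) powr \<alpha>) =
     c * ((c * \<tau>) powr (a - 1) * u powr (- a) * P powr \<alpha>)"
    by (simp add: hilbert_kernel_def u_def)
  also have "\<dots> = (\<tau> powr (a - 1) * (1 - \<tau>) powr (- a)) * (P powr a * P powr \<alpha>)"
  proof -
    have e1: "c * (c * \<tau>) powr (a - 1) = c powr a * \<tau> powr (a - 1)"
      using c \<tau> by (simp add: powr_mult powr_diff)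
    have e2: "P powr a = c powr a * (1 - \<tau>) powr a * u powr (- a)"
      unfolding P_def using c \<tau> u by (simp add: powr_mult powr_divide powr_minus divide_inverse inverse_powr)
    have e3: "(1 - \<tau>) powr (- a) * (1 - \<tau>) powr a = 1"
      using \<tau> by (simp add: powr_add[symmetric])
    have "c * ((c * \<tau>) powr (a - 1) * u powr (- a) * P powr \<alpha>) = c powr a * \<tau> powr (a - 1) * u powr (- a) * P powr \<alpha>"
      by (simp only: mult.assoc[symmetric] e1)
    also have "\<dots> = ((1 - \<tau>) powr (- a) * (1 - \<tau>) powr a) * (c powr a * \<tau> powr (a - 1) * u powr (- a) * P powr \<alpha>)"
      unfolding e3 by simp
    also have "\<dots> = (\<tau> powr (a - 1) * (1 - \<tau>) powr (- a)) * (P powr a * P powr \<alpha>)"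
      unfolding e2 by (simp only: mult_ac)
    finally show ?thesis .
  qed
  also have "P powr a * P powr \<alpha> = P powr (a + \<alpha>)" by (simp add: powr_add)
  \<comment> \<open>As P <= 1, the exponent may be lowered from a + \<alpha> to 2 \<delta>.\<close>
  also have "(\<tau> powr (a - 1) * (1 - \<tau>) powr (- a)) * P powr (a + \<alpha>) \<le> (\<tau> powr (a - 1) * (1 - \<tau>) powr (- a)) * P powr (2 * \<delta>)"
    using P \<delta> by (intro mult_left_mono powr_mono') auto
  also have "P powr (2 * \<delta>) = l powr (2 * \<delta>) * X powr (2 * \<delta>)"
    unfolding PX using l X by (simp add: powr_mult)
  also have "(\<tau> powr (a - 1) * (1 - \<tau>) powr (- a)) * (l powr (2 * \<delta>) * X powr (2 * \<delta>)) \<le>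
     (\<tau> powr (a - 1) * (1 - \<tau>) powr (- a)) * (l powr (2 * \<delta>) * (1 - \<delta> / a + \<delta> / a * (l + (1 - l) * (2 * (1 - \<tau>)) powr (2 * a))))"
  proof (intro mult_left_mono)
    have "X powr (2 * \<delta>) = (X powr (2 * a)) powr (\<delta> / a)"
      using a by (simp add: powr_powr)
    also have "\<dots> \<le> 1 - \<delta> / a + \<delta> / a * X powr (2 * a)"
      using \<delta> a X by (intro powr_le_weighted) auto
    also have "1 - \<delta> / a + \<delta> / a * X powr (2 * a) \<le> 1 - \<delta> / a + \<delta> / a * (l + (1 - l) * (2 * (1 - \<tau>)) powr (2 * a))"
    proof -
      \<comment> \<open>The inequality of the two means with denominators cleared: the difference is
        a nonnegative multiple of the squared difference of the entries 1 and 2 (1 -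
        \<tau>).\<close>
      have "(2 - c) * ((2 - c) * (1 - \<tau>)) \<le> (c + (2 - 2 * c) * (2 * (1 - \<tau>))) * u"
      proof -
        have "(c + (2 - 2 * c) * (2 * (1 - \<tau>))) * u - (2 - c) * ((2 - c) * (1 - \<tau>)) = c * (1 - c) * (1 - 2 * (1 - \<tau>))\<^sup>2"
          by (simp add: u_def power2_eq_square algebra_simps)
        moreover have "c * (1 - c) * (1 - 2 * (1 - \<tau>))\<^sup>2 \<ge> 0" using c by simp
        ultimately show ?thesis by linarith
      qed
      then have "X \<le> (c + (2 - 2 * c) * (2 * (1 - \<tau>))) / (2 - c)"
        unfolding X_def using c u by (simp add: field_simps)
      also have "\<dots> = (1 - (1 - l)) * 1 + (1 - l) * (2 * (1 - \<tau>))"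
      proof -
        have "1 - l = (2 - 2 * c) / (2 - c)" unfolding l_def using c by (simp add: field_simps)
        then have "l + (1 - l) * (2 * (1 - \<tau>)) = c / (2 - c) + (2 - 2 * c) / (2 - c) * (2 * (1 - \<tau>))"
          by (simp only: l_def)
        then show ?thesis by (simp add: add_divide_distrib)
      qed
      finally have "X powr (2 * a) \<le> ((1 - (1 - l)) *\<^sub>R 1 + (1 - l) *\<^sub>R (2 * (1 - \<tau>))) powr (2 * a)"
        using X a by (intro powr_mono2) auto
      also have "\<dots> \<le> (1 - (1 - l)) * 1 powr (2 * a) + (1 - l) * (2 * (1 - \<tau>)) powr (2 * a)"
        by (rule convex_onD[OF powr_convex]) (use a l \<tau> in auto)
      finally have "X powr (2 * a) \<le> l + (1 - l) * (2 * (1 - \<tau>)) powr (2 * a)" by simp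
      then show ?thesis using \<delta> a by (intro add_left_mono mult_left_mono) auto
    qed
    finally show "X powr (2 * \<delta>) \<le> 1 - \<delta> / a + \<delta> / a * (l + (1 - l) * (2 * (1 - \<tau>)) powr (2 * a))" .
  qed auto
  also have "(2 * (1 - \<tau>)) powr (2 * a) = 4 powr a * ((1 - \<tau>) powr a * (1 - \<tau>) powr a)"
  proof -
    have "(2 * (1 - \<tau>)) powr (2 * a) = 2 powr (2 * a) * (1 - \<tau>) powr (2 * a)"
      by (rule powr_mult)
    also have "(2::real) powr (2 * a) = 4 powr a" using powr_powr[of 2 2 a] by simp
    also have "(1 - \<tau>) powr (2 * a) = (1 - \<tau>) powr a * (1 - \<tau>) powr a"
      by (simp add: powr_add[symmetric])
    finally show ?thesis .
  qed
  also have "(\<tau> powr (a - 1) * (1 - \<tau>) powr (- a)) * (l powr (2 * \<delta>) * (1 - \<delta> / a + \<delta> / a * (l + (1 - l) * (4 powr a * ((1 - \<tau>) powr a * (1 - \<tau>) powr a))))) =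
    l powr (2 * \<delta>) * ((1 - \<delta> / a + \<delta> / a * l) * (\<tau> powr (a - 1) * (1 - \<tau>) powr (- a)) +
      \<delta> / a * (1 - l) * 4 powr a * (\<tau> powr (a - 1) * ((1 - \<tau>) powr (- a) * (1 - \<tau>) powr a * (1 - \<tau>) powr a)))"
    by (simp add: algebra_simps add_divide_distrib diff_divide_distrib)
  also have "(1 - \<tau>) powr (- a) * (1 - \<tau>) powr a * (1 - \<tau>) powr a = (1 - \<tau>) powr a"
    using \<tau> by (simp add: powr_add[symmetric])
  finally show ?thesis by (simp add: l_def)
qed

text \<open>The truncated weight vanishes for t >= c, so t = c \<tau> maps its support to the unit
  interval. The pointwise bound integrates to a combination of B(a, 1 - a) and 4^a B(a, 1 + a); the
  latter is at most the former, and the coefficients add up to 1.\<close>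

lemma kernel_integral_le:
  fixes a \<alpha> \<delta> c :: real
  assumes a: "1 / 2 \<le> a" "a < 1" and \<delta>: "0 \<le> \<delta>" "\<delta> \<le> a" "2 * \<delta> \<le> a + \<alpha>" and \<alpha>: "\<alpha> > 0"
    and c: "0 < c" "c < 1"
  shows "(\<integral>\<^sup>+t. ennreal (indicator {0<..<1} t * (hilbert_kernel a t * max 0 (1 - (1 - c) / (1 - t)) powr \<alpha>)) \<partial>lborel)
    \<le> ennreal (Beta a (1 - a) * (c / (2 - c)) powr (2 * \<delta>))"
proof -
  define l where "l = c / (2 - c)"
  define C1 where "C1 = 1 - \<delta> / a + \<delta> / a * l"
  define C2 where "C2 = \<delta> / a * (1 - l) * 4 powr a"
  define F1 where "F1 = (\<lambda>\<tau>::real. indicator {0<..<1} \<tau> * (\<tau> powr (a - 1) * (1 - \<tau>) powr (1 - a - 1)))"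
  define F2 where "F2 = (\<lambda>\<tau>::real. indicator {0<..<1} \<tau> * (\<tau> powr (a - 1) * (1 - \<tau>) powr (1 + a - 1)))"
  have l: "0 < l" "l < 1" unfolding l_def using c by (simp_all add: divide_less_eq)
  have d1: "0 \<le> \<delta> / a" "\<delta> / a \<le> 1" using \<delta> a by simp_all
  have C: "C1 \<ge> 0" "C2 \<ge> 0"
    unfolding C1_def C2_def
    by (intro add_nonneg_nonneg mult_nonneg_nonneg; use d1 l in simp)+
  have F0: "F1 \<tau> \<ge> 0" "F2 \<tau> \<ge> 0" for \<tau> by (simp_all add: F1_def F2_def)
  have [measurable]: "F1 \<in> borel_measurable borel" "F2 \<in> borel_measurable borel"
    unfolding F1_def F2_def by measurable
  have FI: "(\<integral>\<^sup>+\<tau>. ennreal (F1 \<tau>) \<partial>lborel) = ennreal (Beta a (1 - a))" "(\<integral>\<^sup>+\<tau>. ennreal (F2 \<tau>) \<partial>lborel) = ennreal (Beta a (1 + a))"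
    unfolding F1_def F2_def by (rule nn_integral_Beta; use a in simp)+
  have Bp: "Beta a (1 - a) > 0" "Beta a (1 + a) > 0" using a by (auto simp: Beta_def)
  let ?h = "\<lambda>t. indicator {0<..<1} t * (hilbert_kernel a t * max 0 (1 - (1 - c) / (1 - t)) powr \<alpha>)"
  have "(\<integral>\<^sup>+t. ennreal (?h t) \<partial>lborel) = ennreal \<bar>c\<bar> * (\<integral>\<^sup>+\<tau>. ennreal (?h (0 + c * \<tau>)) \<partial>lborel)"
    by (rule nn_integral_real_affine) (use c in auto)
  also have "\<dots> = (\<integral>\<^sup>+\<tau>. ennreal c * ennreal (?h (c * \<tau>)) \<partial>lborel)"
    using c by (subst nn_integral_cmult) auto
  also have "\<dots> \<le> (\<integral>\<^sup>+\<tau>. ennreal (l powr (2 * \<delta>)) * (ennreal C1 * ennreal (F1 \<tau>) + ennreal C2 * ennreal (F2 \<tau>)) \<partial>lborel)"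
  proof (rule nn_integral_mono)
    fix \<tau> :: real
    have "c * ?h (c * \<tau>) \<le> l powr (2 * \<delta>) * (C1 * F1 \<tau> + C2 * F2 \<tau>)"
    proof (cases "0 < \<tau> \<and> \<tau> < 1")
      case True
      have ct: "0 < c * \<tau>" "c * \<tau> < c"
        using c True by (simp_all add: mult_less_cancel_left2)
      have ct1: "c * \<tau> < 1" using ct(2) c(2) by linarith
      have "(1 - c) / (1 - c * \<tau>) \<le> 1" using ct1 True c by (simp add: divide_le_eq)
      then have "max 0 (1 - (1 - c) / (1 - c * \<tau>)) = 1 - (1 - c) / (1 - c * \<tau>)" by simp
      then show ?thesis
        using kernel_pointwise[OF a \<delta> c, of \<tau>] True ct1 c
        by (simp add: C1_def C2_def F1_def F2_def l_def)
    next
      case False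
      have "?h (c * \<tau>) = 0"
      proof (cases "0 < c * \<tau> \<and> c * \<tau> < 1")
        case True
        then have "\<tau> \<ge> 1" using False c by (simp add: zero_less_mult_iff)
        then have "1 \<le> (1 - c) / (1 - c * \<tau>)" using True c by (simp add: le_divide_eq)
        then show ?thesis using \<alpha> by simp
      qed simp
      then have "c * ?h (c * \<tau>) = 0" by (simp only: mult_zero_right)
      moreover have "0 \<le> l powr (2 * \<delta>) * (C1 * F1 \<tau> + C2 * F2 \<tau>)" using C F0[of \<tau>] by simp
      ultimately show ?thesis by linarith
    qed
    moreover have "?h (c * \<tau>) \<ge> 0" by (simp add: indicator_def hilbert_kernel_def)
    ultimately show "ennreal c * ennreal (?h (c * \<tau>)) \<le> ennreal (l powr (2 * \<delta>)) * (ennreal C1 * ennreal (F1 \<tau>) + ennreal C2 * ennreal (F2 \<tau>))"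
      using c C F0[of \<tau>] by (simp add: ennreal_mult[symmetric] ennreal_plus[symmetric] del: ennreal_plus)
  qed
  also have "\<dots> = ennreal (l powr (2 * \<delta>)) * (ennreal C1 * ennreal (Beta a (1 - a)) + ennreal C2 * ennreal (Beta a (1 + a)))"
    by (simp add: nn_integral_cmult nn_integral_add FI)
  also have "\<dots> = ennreal (l powr (2 * \<delta>) * (C1 * Beta a (1 - a) + C2 * Beta a (1 + a)))"
    using C Bp by (simp add: ennreal_mult[symmetric] ennreal_plus[symmetric] del: ennreal_plus)
  also have "\<dots> \<le> ennreal (l powr (2 * \<delta>) * Beta a (1 - a))"
  proof (intro ennreal_leI mult_left_mono)
    have "C2 * Beta a (1 + a) = \<delta> / a * (1 - l) * (4 powr a * Beta a (1 + a))" by (simp add: C2_def)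
    also have "\<dots> \<le> \<delta> / a * (1 - l) * Beta a (1 - a)"
      by (intro mult_left_mono four_powr_Beta_le a mult_nonneg_nonneg) (use d1 l in auto)
    finally have "C1 * Beta a (1 - a) + C2 * Beta a (1 + a) \<le> (C1 + \<delta> / a * (1 - l)) * Beta a (1 - a)"
      by (simp add: distrib_right)
    also have "C1 + \<delta> / a * (1 - l) = 1" by (simp add: C1_def right_diff_distrib)
    finally show "C1 * Beta a (1 - a) + C2 * Beta a (1 + a) \<le> Beta a (1 - a)" by simp
  qed simp
  finally show ?thesis by (simp add: l_def mult.commute)
qed

text \<open>The weight \<open>1 - |z|\<^sup>2\<close> in the variable \<open>w = hilbert_map t z\<close>, up to the factor computed in
  \<open>hilbert_map_geometry\<close>; it is positive exactly on the image of the unit disc.\<close>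

definition hilbert_defect :: "real \<Rightarrow> complex \<Rightarrow> real" where
  "hilbert_defect t w = (1 - (cmod w)\<^sup>2) - (cmod (1 - w))\<^sup>2 / (1 - t)"

text \<open>From |1 - w| >= 1 - |w|, with equality for w in [0, 1): on each circle the positive real
  point is the worst case.\<close>

lemma one_minus_norm_square_ge:
  assumes "cmod w < 1"
  shows "(1 - cmod w) / (1 + cmod w) \<le> (cmod (1 - w))\<^sup>2 / (1 - (cmod w)\<^sup>2)"
proof -
  have "1 - cmod w \<le> cmod (1 - w)" using norm_triangle_ineq2[of 1 w] by simp
  then have "(1 - cmod w)\<^sup>2 \<le> (cmod (1 - w))\<^sup>2" using assms by (intro power_mono) auto
  moreover have "1 - (cmod w)\<^sup>2 = (1 - cmod w) * (1 + cmod w)" by (simp add: power2_eq_square algebra_simps)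
  moreover have "(1 - cmod w) / (1 + cmod w) = (1 - cmod w)\<^sup>2 / ((1 - cmod w) * (1 + cmod w))"
    using assms by (simp add: power2_eq_square)
  ultimately show ?thesis
    using assms by (simp add: divide_right_mono)
qed

text \<open>With s = 1 - |w|^2 and k = |1 - w|^2 / s the defect is s (1 - k / (1 - t)), so w enters
  the integral only through s and c = 1 - k. The gain (c / (2 - c))^(2 \<delta>) is at most |w|^(2
  \<delta>) and cancels the singular factor. For w = 0 the convention \<open>0 powr x = 0\<close>
  makes the left-hand side 0.\<close>

lemma defect_integral_le:
  fixes a \<alpha> \<delta> :: real
  assumes a: "1 / 2 \<le> a" "a < 1" and \<delta>: "0 \<le> \<delta>" "\<delta> \<le> a" "2 * \<delta> \<le> a + \<alpha>" and \<alpha>: "\<alpha> > 0"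
    and w: "cmod w < 1"
  shows "ennreal (cmod w powr (- (2 * \<delta>))) *
     (\<integral>\<^sup>+t. ennreal (indicator {0<..<1} t * (hilbert_kernel a t * max 0 (hilbert_defect t w) powr \<alpha>)) \<partial>lborel)
    \<le> ennreal (Beta a (1 - a) * (1 - (cmod w)\<^sup>2) powr \<alpha>)"
proof (cases "w = 0")
  case False
  define s where "s = 1 - (cmod w)\<^sup>2"
  define k where "k = (cmod (1 - w))\<^sup>2 / s"
  have s: "s > 0" unfolding s_def using w by (simp add: abs_square_less_1)
  have "w \<noteq> 1" using w by auto
  then have k: "k > 0" unfolding k_def using s by simp
  have fac: "max 0 (hilbert_defect t w) powr \<alpha> = s powr \<alpha> * max 0 (1 - k / (1 - t)) powr \<alpha>" for t
  proof -
    have sk: "s * k = (cmod (1 - w))\<^sup>2" using s by (simp add: k_def)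
    have "hilbert_defect t w = s * (1 - k / (1 - t))"
      unfolding hilbert_defect_def s_def[symmetric]
      by (simp only: right_diff_distrib mult_1_right times_divide_eq_right sk)
    then have "max 0 (hilbert_defect t w) = s * max 0 (1 - k / (1 - t))"
      using s by (simp add: max_def zero_le_mult_iff)
    then show ?thesis using s by (simp add: powr_mult)
  qed
  have B: "Beta a (1 - a) > 0" using a by (auto simp: Beta_def)
  let ?h = "\<lambda>t. indicator {0<..<1} t * (hilbert_kernel a t * max 0 (1 - k / (1 - t)) powr \<alpha>)"
  have "(\<integral>\<^sup>+t. ennreal (indicator {0<..<1} t * (hilbert_kernel a t * max 0 (hilbert_defect t w) powr \<alpha>)) \<partial>lborel)
    = (\<integral>\<^sup>+t. ennreal (s powr \<alpha>) * ennreal (?h t) \<partial>lborel)"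
    unfolding fac by (intro nn_integral_cong) (simp add: ennreal_mult'[symmetric] mult_ac)
  also have "\<dots> = ennreal (s powr \<alpha>) * (\<integral>\<^sup>+t. ennreal (?h t) \<partial>lborel)"
    by (rule nn_integral_cmult) measurable
  finally have e: "(\<integral>\<^sup>+t. ennreal (indicator {0<..<1} t * (hilbert_kernel a t * max 0 (hilbert_defect t w) powr \<alpha>)) \<partial>lborel)
    = ennreal (s powr \<alpha>) * (\<integral>\<^sup>+t. ennreal (?h t) \<partial>lborel)" .
  show ?thesis
  proof (cases "k < 1")
    case True
    define c where "c = 1 - k"
    have c: "0 < c" "c < 1" using True k by (simp_all add: c_def)
    have "(\<integral>\<^sup>+t. ennreal (?h t) \<partial>lborel) \<le> ennreal (Beta a (1 - a) * (c / (2 - c)) powr (2 * \<delta>))"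
      using kernel_integral_le[OF a \<delta> \<alpha> c] by (simp add: c_def)
    also have "\<dots> \<le> ennreal (Beta a (1 - a) * cmod w powr (2 * \<delta>))"
    proof (intro ennreal_leI mult_left_mono powr_mono2)
      have "(1 - cmod w) / (1 + cmod w) \<le> k"
        unfolding k_def s_def by (rule one_minus_norm_square_ge[OF w])
      then have "1 - cmod w \<le> k * (1 + cmod w)" by (simp add: divide_le_eq add_pos_nonneg)
      then have "c \<le> cmod w * (2 - c)" by (simp add: c_def algebra_simps)
      then show "c / (2 - c) \<le> cmod w" using c by (simp add: divide_le_eq)
    qed (use c B \<delta> in auto)
    finally have "ennreal (cmod w powr (- (2 * \<delta>))) * (ennreal (s powr \<alpha>) * (\<integral>\<^sup>+t. ennreal (?h t) \<partial>lborel)) \<le>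
       ennreal (cmod w powr (- (2 * \<delta>))) * (ennreal (s powr \<alpha>) * ennreal (Beta a (1 - a) * cmod w powr (2 * \<delta>)))"
      by (intro mult_left_mono) auto
    also have "\<dots> = ennreal (cmod w powr (- (2 * \<delta>)) * (s powr \<alpha> * (Beta a (1 - a) * cmod w powr (2 * \<delta>))))"
      using B by (simp add: ennreal_mult[symmetric] del: mult_less_0_iff)
    also have "cmod w powr (- (2 * \<delta>)) * (s powr \<alpha> * (Beta a (1 - a) * cmod w powr (2 * \<delta>))) =
       (cmod w powr (- (2 * \<delta>)) * cmod w powr (2 * \<delta>)) * (Beta a (1 - a) * s powr \<alpha>)" by simp
    also have "cmod w powr (- (2 * \<delta>)) * cmod w powr (2 * \<delta>) = 1"
      using False by (simp add: powr_add[symmetric])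
    finally show ?thesis unfolding e by (simp add: s_def)
  next
    \<comment> \<open>Here the defect is positive for no t in the interval, so the integrand
      vanishes.\<close>
    case k1: False
    have h0: "?h t = 0" for t
    proof (cases "0 < t \<and> t < 1")
      case True
      then have "1 \<le> k / (1 - t)" using k1 by (simp add: le_divide_eq)
      then show ?thesis using \<alpha> by simp
    qed simp
    have "(\<integral>\<^sup>+t. ennreal (?h t) \<partial>lborel) = 0" unfolding h0 by simp
    then show ?thesis unfolding e by simp
  qed
qed simp

text \<open>Everything rests on the identity |d|^2 - t^2 - (1 - t) |1 - z|^2 = t (1 - t) (1 - |z|^2)
  with d = 1 - (1 - t) z. It shows that the defect is positive at the image point, and this in turn
  forces the image point into the disc.\<close>

lemma hilbert_map_geometry:
  assumes z: "cmod z < 1" and t: "0 < t" "t < 1"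
  shows "hilbert_defect t (hilbert_map t z) = t * (1 - t) * (1 - (cmod z)\<^sup>2) / (cmod (1 - of_real (1 - t) * z))\<^sup>2"
    and "cmod (hilbert_map t z) < 1"
    and "deriv (hilbert_map t) z = of_real (t * (1 - t)) * hilbert_mult t z ^ 2"
proof -
  define d where "d = 1 - of_real (1 - t) * z"
  have d: "d \<noteq> 0" unfolding d_def using hilbert_mult_denom_nonzero(1)[OF z, of t] t by simp
  have v2: "(cmod d)\<^sup>2 = (1 - (1 - t) * Re z)\<^sup>2 + ((1 - t) * Im z)\<^sup>2"
    by (simp add: cmod_power2 d_def)
  have v: "(cmod d)\<^sup>2 > 0" using d by simp
  have \<phi>: "hilbert_map t z = of_real t / d" by (simp add: hilbert_map_def hilbert_mult_def d_def)
  have n1: "(cmod (hilbert_map t z))\<^sup>2 = t\<^sup>2 / (cmod d)\<^sup>2"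
    unfolding \<phi> using t by (simp add: norm_divide power_divide)
  have "1 - hilbert_map t z = of_real (1 - t) * (1 - z) / d"
    unfolding \<phi> using d by (simp add: field_simps d_def)
  then have n2: "(cmod (1 - hilbert_map t z))\<^sup>2 = (1 - t)\<^sup>2 * (cmod (1 - z))\<^sup>2 / (cmod d)\<^sup>2"
    using t by (simp add: norm_divide norm_mult power_divide power_mult_distrib del: of_real_diff)
  have "hilbert_defect t (hilbert_map t z) = 1 - t\<^sup>2 / (cmod d)\<^sup>2 - (1 - t)\<^sup>2 * (cmod (1 - z))\<^sup>2 / (cmod d)\<^sup>2 / (1 - t)"
    unfolding hilbert_defect_def n1 n2 ..
  also have "\<dots> = ((cmod d)\<^sup>2 - t\<^sup>2 - (1 - t) * (cmod (1 - z))\<^sup>2) / (cmod d)\<^sup>2"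
    using v t by (simp add: diff_divide_distrib power2_eq_square[of "1 - t"])
  also have "(cmod d)\<^sup>2 - t\<^sup>2 - (1 - t) * (cmod (1 - z))\<^sup>2 = t * (1 - t) * (1 - (cmod z)\<^sup>2)"
    unfolding v2 cmod_power2[of z] cmod_power2[of "1 - z"] by (simp add: power2_eq_square algebra_simps)
  finally show def: "hilbert_defect t (hilbert_map t z) = t * (1 - t) * (1 - (cmod z)\<^sup>2) / (cmod (1 - of_real (1 - t) * z))\<^sup>2"
    by (simp add: d_def)
  have "1 - (cmod z)\<^sup>2 > 0" using z by (simp add: abs_square_less_1)
  then have "hilbert_defect t (hilbert_map t z) > 0"
    unfolding def using t v by (simp add: d_def)
  moreover have "(cmod (1 - hilbert_map t z))\<^sup>2 / (1 - t) \<ge> 0" using t by simp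
  ultimately have "(cmod (hilbert_map t z))\<^sup>2 < 1" unfolding hilbert_defect_def by linarith
  then show "cmod (hilbert_map t z) < 1" by (simp add: abs_square_less_1)
  have "((\<lambda>z. of_real t * (1 / (1 - of_real (1 - t) * z))) has_field_derivative
     (of_real (t * (1 - t)) * (1 / (1 - of_real (1 - t) * z)) ^ 2)) (at z)"
    using d unfolding d_def by (auto intro!: derivative_eq_intros simp: power2_eq_square field_simps)
  then show "deriv (hilbert_map t) z = of_real (t * (1 - t)) * hilbert_mult t z ^ 2"
    unfolding hilbert_map_def[abs_def] hilbert_mult_def[abs_def] by (rule DERIV_imp_deriv)
qed

lemma hilbert_map_inj_holomorphic:
  assumes t: "0 < t" "t < 1"
  shows "hilbert_map t holomorphic_on ball 0 1" "inj_on (hilbert_map t) (ball 0 1)"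
proof -
  have nz: "1 - of_real (1 - t) * z \<noteq> 0" if "z \<in> ball 0 1" for z :: complex
    using hilbert_mult_denom_nonzero(1)[of z t] that t by simp
  show "hilbert_map t holomorphic_on ball 0 1"
    unfolding hilbert_map_def[abs_def] hilbert_mult_def[abs_def]
    by (intro holomorphic_intros) (use nz in auto)
  show "inj_on (hilbert_map t) (ball 0 1)"
  proof (rule inj_onI)
    fix x y :: complex assume xy: "x \<in> ball 0 1" "y \<in> ball 0 1" "hilbert_map t x = hilbert_map t y"
    then have "1 - of_real (1 - t) * x = 1 - of_real (1 - t) * y"
      using nz[OF xy(1)] nz[OF xy(2)] t
      by (simp add: hilbert_map_def hilbert_mult_def field_simps del: of_real_diff)
    moreover have "complex_of_real (1 - t) \<noteq> 0" using t by (simp only: of_real_eq_0_iff)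
    ultimately show "x = y" by (simp del: of_real_diff)
  qed
qed

section \<open>Slices in the variable w = phi_t(z)\<close>

context hilbert_bergman
begin

text \<open>What remains of the weighted slice after the substitution once k(t)^(2m) is factored
  out. The power of |w| stems from |w_t| = |w| / t, and \<open>max 0\<close> gives the value 0
  wherever the defect is not positive, since \<open>0 powr \<alpha> = 0\<close>.\<close>

definition slice_density :: "complex poly \<Rightarrow> real \<Rightarrow> complex \<Rightarrow> real" where
  "slice_density q t w = (\<alpha> + 1) / pi * cmod w powr (- (2 * (\<alpha> + 2 - real m))) *
     max 0 (hilbert_defect t w) powr \<alpha> * cmod (poly q w) ^ (2 * m)"

lemma slice_density_nonneg: "slice_density q t w \<ge> 0"
  using \<alpha> by (simp add: slice_density_def)

text \<open>A count of exponents, done in \<open>T\<close>, \<open>U\<close> and \<open>V\<close>: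
  the powers of t and of 1 - t from the Jacobian, the kernel, |phi_t| and the defect cancel, and
  those of v = |1 - (1 - t) z| add up to -2m, which is |w_t|^(2m).\<close>

lemma slice_density_map:
  assumes z: "cmod z < 1" and t: "0 < t" "t < 1"
  shows "bergman_weight \<alpha> z * cmod (hilbert_mult t z * poly q (hilbert_map t z)) ^ (2 * m) =
    (cmod (deriv (hilbert_map t) z))\<^sup>2 * (hilbert_kernel a t ^ (2 * m) * slice_density q t (hilbert_map t z))"
proof -
  define v where "v = cmod (1 - of_real (1 - t) * z)"
  define s where "s = 1 - (cmod z)\<^sup>2"
  define \<delta> where "\<delta> = \<alpha> + 2 - real m"
  have v: "v > 0" unfolding v_def using hilbert_mult_denom_nonzero(1)[OF z, of t] t by simp
  have s: "s > 0" unfolding s_def using z by (simp add: abs_square_less_1)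
  have w: "cmod (hilbert_mult t z) = 1 / v" by (simp add: hilbert_mult_def norm_divide v_def)
  have \<phi>: "cmod (hilbert_map t z) = t / v" using t w by (simp add: hilbert_map_def norm_mult)
  have "deriv (hilbert_map t) z = of_real (t * (1 - t)) * hilbert_mult t z ^ 2"
    by (rule hilbert_map_geometry(3)[OF z t])
  then have d: "cmod (deriv (hilbert_map t) z) = t * (1 - t) / v\<^sup>2"
    using t w by (simp add: norm_mult norm_power power_divide del: of_real_mult of_real_diff)
  have df: "max 0 (hilbert_defect t (hilbert_map t z)) = t * (1 - t) * s / v\<^sup>2"
    unfolding hilbert_map_geometry(1)[OF z t] v_def[symmetric] s_def[symmetric] using t s v by simp
  have T: "t\<^sup>2 * t powr (\<alpha> + 2 - 2 * real m) * t powr (- (2 * \<delta>)) * t powr \<alpha> = 1"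
  proof -
    have "t\<^sup>2 = t powr 2" using t by simp
    then show ?thesis using t by (simp only: powr_add[symmetric]) (simp add: \<delta>_def)
  qed
  have U: "(1 - t)\<^sup>2 * (1 - t) powr (- (\<alpha> + 2)) * (1 - t) powr \<alpha> = 1"
  proof -
    have "(1 - t)\<^sup>2 = (1 - t) powr 2" using t by simp
    then show ?thesis using t by (simp only: powr_add[symmetric]) simp
  qed
  have V: "(1 / v\<^sup>2)\<^sup>2 * v powr (2 * \<delta>) * (1 / v\<^sup>2) powr \<alpha> = (1 / v) ^ (2 * m)"
  proof -
    have e: "1 / v\<^sup>2 = v powr (- 2)" using v by (simp add: powr_minus divide_inverse)
    have "(1 / v\<^sup>2)\<^sup>2 = v powr (- 4)" unfolding e using v by (simp add: powr_power)
    moreover have "(1 / v\<^sup>2) powr \<alpha> = v powr (- (2 * \<alpha>))" unfolding e by (simp add: powr_powr)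
    moreover have "(1 / v) ^ (2 * m) = v powr (- real (2 * m))"
      unfolding powr_minus_divide powr_realpow[OF v] by (simp add: power_divide)
    ultimately show ?thesis by (simp add: powr_add[symmetric] \<delta>_def algebra_simps)
  qed
  have p1: "(t * (1 - t) * s / v\<^sup>2) powr \<alpha> = t powr \<alpha> * (1 - t) powr \<alpha> * s powr \<alpha> * (1 / v\<^sup>2) powr \<alpha>"
  proof -
    have "t * (1 - t) * s / v\<^sup>2 = t * (1 - t) * s * (1 / v\<^sup>2)" by simp
    then show ?thesis by (simp only: powr_mult)
  qed
  have p2: "(t / v) powr (- (2 * \<delta>)) = t powr (- (2 * \<delta>)) * v powr (2 * \<delta>)"
  proof -
    have "t / v = t * v powr (- 1)" using v by (simp add: powr_minus divide_inverse)
    then show ?thesis by (simp only: powr_mult powr_powr) simp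
  qed
  define Q where "Q = cmod (poly q (hilbert_map t z)) ^ (2 * m)"
  have "(cmod (deriv (hilbert_map t) z))\<^sup>2 * (hilbert_kernel a t ^ (2 * m) * slice_density q t (hilbert_map t z)) =
     (t * (1 - t) / v\<^sup>2)\<^sup>2 * (t powr (\<alpha> + 2 - 2 * real m) * (1 - t) powr (- (\<alpha> + 2)) *
       ((\<alpha> + 1) / pi * (t powr (- (2 * \<delta>)) * v powr (2 * \<delta>)) *
        (t powr \<alpha> * (1 - t) powr \<alpha> * s powr \<alpha> * (1 / v\<^sup>2) powr \<alpha>) * Q))"
    unfolding slice_density_def d hilbert_kernel_power[OF t] \<phi> df p1 p2[symmetric] \<delta>_def[symmetric] Q_def[symmetric] ..
  also have "(t * (1 - t) / v\<^sup>2)\<^sup>2 = t\<^sup>2 * (1 - t)\<^sup>2 * (1 / v\<^sup>2)\<^sup>2"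
    by (simp add: power_mult_distrib power_divide)
  also have "t\<^sup>2 * (1 - t)\<^sup>2 * (1 / v\<^sup>2)\<^sup>2 * (t powr (\<alpha> + 2 - 2 * real m) * (1 - t) powr (- (\<alpha> + 2)) *
       ((\<alpha> + 1) / pi * (t powr (- (2 * \<delta>)) * v powr (2 * \<delta>)) *
        (t powr \<alpha> * (1 - t) powr \<alpha> * s powr \<alpha> * (1 / v\<^sup>2) powr \<alpha>) * Q)) =
     (t\<^sup>2 * t powr (\<alpha> + 2 - 2 * real m) * t powr (- (2 * \<delta>)) * t powr \<alpha>) *
     ((1 - t)\<^sup>2 * (1 - t) powr (- (\<alpha> + 2)) * (1 - t) powr \<alpha>) *
     ((1 / v\<^sup>2)\<^sup>2 * v powr (2 * \<delta>) * (1 / v\<^sup>2) powr \<alpha>) * ((\<alpha> + 1) / pi * s powr \<alpha> * Q)"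
    by (simp only: mult_ac)
  also have "\<dots> = bergman_weight \<alpha> z * ((1 / v) ^ (2 * m) * Q)"
    unfolding T U V bergman_weight_def s_def[symmetric] by simp
  finally show ?thesis
    by (simp only: norm_mult power_mult_distrib w Q_def)
qed

lemma slice_density_measurable [measurable]:
  "slice_density q t \<in> borel_measurable borel"
  unfolding slice_density_def hilbert_defect_def by measurable

text \<open>After the substitution the domain is the image of the disc under phi_t; it is enlarged
  to the whole disc to become independent of t, in preparation for exchanging the integrals.\<close>

lemma slice_integral_le:
  assumes t: "0 < t" "t < 1"
  shows "(\<integral>\<^sup>+z. ennreal (cmod (hilbert_mult t z * poly q (hilbert_map t z)) ^ (2 * m)) \<partial>M) \<le>
    ennreal (hilbert_kernel a t ^ (2 * m)) * (\<integral>\<^sup>+w. ennreal (indicator (ball 0 1) w * slice_density q t w) \<partial>lborel)"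
proof -
  let ?K = "hilbert_kernel a t ^ (2 * m)"
  have K: "?K \<ge> 0" using hilbert_kernel_pos[OF t, of a] by simp
  have "(\<integral>\<^sup>+z. ennreal (cmod (hilbert_mult t z * poly q (hilbert_map t z)) ^ (2 * m)) \<partial>M) =
    (\<integral>\<^sup>+z. ennreal (bergman_weight \<alpha> z) * ennreal (cmod (hilbert_mult t z * poly q (hilbert_map t z)) ^ (2 * m)) * indicator (ball 0 1) z \<partial>lborel)"
    unfolding hilbert_mult_def hilbert_map_def by (rule nn_integral_bergman[OF \<alpha>]) measurable
  also have "\<dots> = (\<integral>\<^sup>+z. ennreal (indicator (ball 0 1) z * ((cmod (deriv (hilbert_map t) z))\<^sup>2 * (?K * slice_density q t (hilbert_map t z)))) \<partial>lborel)"
  proof (rule nn_integral_cong)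
    fix z
    show "ennreal (bergman_weight \<alpha> z) * ennreal (cmod (hilbert_mult t z * poly q (hilbert_map t z)) ^ (2 * m)) * indicator (ball 0 1) z =
      ennreal (indicator (ball 0 1) z * ((cmod (deriv (hilbert_map t) z))\<^sup>2 * (?K * slice_density q t (hilbert_map t z))))"
    proof (cases "cmod z < 1")
      case True
      then show ?thesis
        using \<alpha> unfolding slice_density_map[OF True t, of q, symmetric] by (simp add: ennreal_mult)
    qed simp
  qed
  also have "\<dots> = (\<integral>\<^sup>+w. ennreal (indicator (hilbert_map t ` ball 0 1) w * (?K * slice_density q t w)) \<partial>lborel)"
    by (rule nn_integral_holomorphic_substitution)
       (use hilbert_map_inj_holomorphic[OF t] K slice_density_nonneg in auto)
  also have "\<dots> \<le> (\<integral>\<^sup>+w. ennreal ?K * ennreal (indicator (ball 0 1) w * slice_density q t w) \<partial>lborel)"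
  proof (rule nn_integral_mono)
    fix w
    have "indicator (hilbert_map t ` ball 0 1) w \<le> (indicator (ball 0 1) w :: real)"
      using hilbert_map_geometry(2)[OF _ t] by (auto simp: indicator_def)
    then have "indicator (hilbert_map t ` ball 0 1) w * (?K * slice_density q t w) \<le> indicator (ball 0 1) w * (?K * slice_density q t w)"
      using K slice_density_nonneg by (intro mult_right_mono) auto
    then show "ennreal (indicator (hilbert_map t ` ball 0 1) w * (?K * slice_density q t w)) \<le> ennreal ?K * ennreal (indicator (ball 0 1) w * slice_density q t w)"
      using K slice_density_nonneg[of q t w] by (simp add: ennreal_mult[symmetric] ennreal_leI mult.left_commute)
  qed
  also have "\<dots> = ennreal ?K * (\<integral>\<^sup>+w. ennreal (indicator (ball 0 1) w * slice_density q t w) \<partial>lborel)"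
    by (rule nn_integral_cmult) measurable
  finally show ?thesis .
qed

text \<open>Tonelli moves the integral over t inside, where \<open>defect_integral_le\<close> bounds
  the averaged weight at w by B(a, 1 - a) times the Bergman weight.\<close>

lemma slices_integral_large:
  assumes large: "real m < \<alpha> + 2" and a_le: "\<alpha> + 2 - real m \<le> a" and m2: "m \<ge> 2"
  shows "(\<integral>\<^sup>+t. ennreal (indicator {0<..<1} t * hilbert_kernel a t) *
      (\<integral>\<^sup>+w. ennreal (indicator (ball 0 1) w * slice_density q t w) \<partial>lborel) \<partial>lborel)
    \<le> ennreal (Beta a (1 - a) * N (poly q) ^ (2 * m))"
proof -
  define \<delta> where "\<delta> = \<alpha> + 2 - real m"
  have a2: "2 * real m * a = \<alpha> + 2" using m1 by simp
  have a: "1 / 2 \<le> a" "a < 1" using large m1 a_bounds by (auto simp: le_divide_eq)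
  \<comment> \<open>The third inequality is the sum of \<delta> <= a and \<delta> = \<alpha> + 2 - m
    <= \<alpha>; the latter holds because m >= 2.\<close>
  have \<delta>: "0 \<le> \<delta>" "\<delta> \<le> a" "2 * \<delta> \<le> a + \<alpha>"
    using large a_le m2 by (auto simp: \<delta>_def)
  have \<alpha>0: "\<alpha> > 0" using large m2 by simp
  have B: "Beta a (1 - a) > 0" using a_bounds by (simp add: Beta_def)
  let ?k = "\<lambda>t. indicator {0<..<1} t * hilbert_kernel a t"
  have k0: "?k t \<ge> 0" for t by (simp add: indicator_def hilbert_kernel_def)
  let ?c = "\<lambda>w. indicator (ball 0 1) w * ((\<alpha> + 1) / pi * cmod (poly q w) ^ (2 * m))"
  let ?d = "\<lambda>w t. indicator {0<..<1} t * (hilbert_kernel a t * max 0 (hilbert_defect t w) powr \<alpha>)"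
  have c0: "?c w \<ge> 0" for w using \<alpha> by (simp add: indicator_def)
  have d0: "?d w t \<ge> 0" for w t by (simp add: indicator_def hilbert_kernel_def)
  let ?f = "\<lambda>w t. ennreal (?c w) * (ennreal (cmod w powr (- (2 * \<delta>))) * ennreal (?d w t))"
  have "(\<integral>\<^sup>+t. ennreal (?k t) * (\<integral>\<^sup>+w. ennreal (indicator (ball 0 1) w * slice_density q t w) \<partial>lborel) \<partial>lborel) =
    (\<integral>\<^sup>+t. \<integral>\<^sup>+w. ?f w t \<partial>lborel \<partial>lborel)"
  proof (rule nn_integral_cong)
    fix t
    have "ennreal (?k t) * (\<integral>\<^sup>+w. ennreal (indicator (ball 0 1) w * slice_density q t w) \<partial>lborel) =
      (\<integral>\<^sup>+w. ennreal (?k t) * ennreal (indicator (ball 0 1) w * slice_density q t w) \<partial>lborel)"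
      by (rule nn_integral_cmult[symmetric]) measurable
    also have "\<dots> = (\<integral>\<^sup>+w. ?f w t \<partial>lborel)"
    proof (rule nn_integral_cong)
      fix w
      have "?k t * (indicator (ball 0 1) w * slice_density q t w) = ?c w * (cmod w powr (- (2 * \<delta>)) * ?d w t)"
        by (simp add: slice_density_def \<delta>_def)
      then show "ennreal (?k t) * ennreal (indicator (ball 0 1) w * slice_density q t w) = ?f w t"
        using k0[of t] c0[of w] d0[of t w] slice_density_nonneg[of q t w]
        by (simp only: ennreal_mult[symmetric] mult_nonneg_nonneg powr_ge_zero indicator_pos_le)
    qed
    finally show "ennreal (?k t) * (\<integral>\<^sup>+w. ennreal (indicator (ball 0 1) w * slice_density q t w) \<partial>lborel) = (\<integral>\<^sup>+w. ?f w t \<partial>lborel)" .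
  qed
  also have "\<dots> = (\<integral>\<^sup>+w. \<integral>\<^sup>+t. ?f w t \<partial>lborel \<partial>lborel)"
  proof (rule lborel_pair.Fubini')
    show "case_prod ?f \<in> borel_measurable (lborel \<Otimes>\<^sub>M lborel)"
      unfolding hilbert_defect_def case_prod_beta by measurable
  qed
  also have "\<dots> \<le> (\<integral>\<^sup>+w. ennreal (Beta a (1 - a)) * (ennreal (bergman_weight \<alpha> w) * ennreal (cmod (poly q w) ^ (2 * m)) * indicator (ball 0 1) w) \<partial>lborel)"
  proof (rule nn_integral_mono)
    fix w :: complex
    have [measurable]: "(\<lambda>t. ennreal (?d w t)) \<in> borel_measurable lborel"
      unfolding hilbert_defect_def by measurable
    have e: "(\<integral>\<^sup>+t. ?f w t \<partial>lborel) = ennreal (?c w) * (ennreal (cmod w powr (- (2 * \<delta>))) * (\<integral>\<^sup>+t. ennreal (?d w t) \<partial>lborel))"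
      by (simp add: nn_integral_cmult del: ennreal_mult)
    show "(\<integral>\<^sup>+t. ?f w t \<partial>lborel) \<le> ennreal (Beta a (1 - a)) * (ennreal (bergman_weight \<alpha> w) * ennreal (cmod (poly q w) ^ (2 * m)) * indicator (ball 0 1) w)"
    proof (cases "cmod w < 1")
      case True
      have "(\<integral>\<^sup>+t. ?f w t \<partial>lborel) \<le> ennreal (?c w) * ennreal (Beta a (1 - a) * (1 - (cmod w)\<^sup>2) powr \<alpha>)"
        unfolding e by (intro mult_left_mono defect_integral_le a \<delta> \<alpha>0 True) simp
      also have "\<dots> = ennreal (?c w * (Beta a (1 - a) * (1 - (cmod w)\<^sup>2) powr \<alpha>))"
        by (rule ennreal_mult[symmetric]) (use c0 B in auto)
      also have "?c w * (Beta a (1 - a) * (1 - (cmod w)\<^sup>2) powr \<alpha>) = Beta a (1 - a) * (bergman_weight \<alpha> w * cmod (poly q w) ^ (2 * m))"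
        using True by (simp add: bergman_weight_def)
      also have "ennreal \<dots> = ennreal (Beta a (1 - a)) * (ennreal (bergman_weight \<alpha> w) * ennreal (cmod (poly q w) ^ (2 * m)) * indicator (ball 0 1) w)"
        using True B \<alpha> by (simp add: ennreal_mult)
      finally show ?thesis .
    qed (simp add: e)
  qed
  also have "\<dots> = ennreal (Beta a (1 - a)) * (\<integral>\<^sup>+w. ennreal (bergman_weight \<alpha> w) * ennreal (cmod (poly q w) ^ (2 * m)) * indicator (ball 0 1) w \<partial>lborel)"
    by (rule nn_integral_cmult) measurable
  also have "(\<integral>\<^sup>+w. ennreal (bergman_weight \<alpha> w) * ennreal (cmod (poly q w) ^ (2 * m)) * indicator (ball 0 1) w \<partial>lborel) = ennreal (N (poly q) ^ (2 * m))"
    using nn_integral_bergman[OF \<alpha>, of "\<lambda>z. ennreal (cmod (poly q z) ^ (2 * m))"] nn_integral_eq_norm_power[OF poly_in_space[of q]]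
    by simp
  also have "ennreal (Beta a (1 - a)) * ennreal (N (poly q) ^ (2 * m)) = ennreal (Beta a (1 - a) * N (poly q) ^ (2 * m))"
    by (rule ennreal_mult[symmetric]) (use B in auto)
  finally show ?thesis .
qed

text \<open>Jensen contributes B^(2m - 1). In the average, k / k^(2m) meets a slice bound
  proportional to k^(2m), leaving the weight k and with it one more factor B.\<close>

lemma hilbert_ext_poly_bound:
  assumes a_le: "\<alpha> + 2 - real m \<le> a" and m2: "m \<ge> 2"
  shows "(\<integral>\<^sup>+z. ennreal (cmod (hilbert_ext (poly q) z) ^ (2 * m)) \<partial>M) \<le> ennreal ((Beta a (1 - a) * N (poly q)) ^ (2 * m))"
proof -
  let ?B = "Beta a (1 - a)"
  let ?g = "\<lambda>t z. cmod (hilbert_mult t z * poly q (hilbert_map t z))"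
  let ?k = "\<lambda>t. indicator {0<..<1} t * hilbert_kernel a t"
  have B: "?B > 0" using a_bounds by (simp add: Beta_def)
  have k0: "?k t \<ge> 0" for t by (simp add: indicator_def hilbert_kernel_def)
  \<comment> \<open>A common form for both cases: R is the constant N(q)^(2m) if a <= 1/2, and the
    t-dependent integral of \<open>slice_density\<close> otherwise.\<close>
  have slice: "(\<integral>\<^sup>+z. ennreal (indicator {0<..<1} t * (hilbert_kernel a t * (?g t z / hilbert_kernel a t) ^ (2 * m))) \<partial>M) \<le> ennreal (?k t) * R"
    if R: "0 < t \<Longrightarrow> t < 1 \<Longrightarrow> (\<integral>\<^sup>+z. ennreal (?g t z ^ (2 * m)) \<partial>M) \<le> ennreal (hilbert_kernel a t ^ (2 * m)) * R" for t R
  proof (cases "0 < t \<and> t < 1")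
    case True
    define K where "K = hilbert_kernel a t"
    have K: "K > 0" unfolding K_def using hilbert_kernel_pos True by simp
    have m: "(\<lambda>z. ennreal (?g t z ^ (2 * m))) \<in> borel_measurable M"
      unfolding hilbert_map_def hilbert_mult_def by (rule borel_measurable_bergman) measurable
    have "(\<integral>\<^sup>+z. ennreal (indicator {0<..<1} t * (hilbert_kernel a t * (?g t z / hilbert_kernel a t) ^ (2 * m))) \<partial>M)
      = (\<integral>\<^sup>+z. ennreal (K / K ^ (2 * m)) * ennreal (?g t z ^ (2 * m)) \<partial>M)"
      using True K by (intro nn_integral_cong) (simp add: K_def[symmetric] ennreal_mult[symmetric] power_divide)
    also have "\<dots> = ennreal (K / K ^ (2 * m)) * (\<integral>\<^sup>+z. ennreal (?g t z ^ (2 * m)) \<partial>M)"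
      by (rule nn_integral_cmult[OF m])
    also have "\<dots> \<le> ennreal (K / K ^ (2 * m)) * (ennreal (K ^ (2 * m)) * R)"
      unfolding K_def by (intro mult_left_mono R) (use True in auto)
    also have "\<dots> = ennreal (K / K ^ (2 * m) * K ^ (2 * m)) * R"
      using K by (simp add: ennreal_mult mult.assoc del: times_divide_eq_left nonzero_eq_divide_eq)
    also have "K / K ^ (2 * m) * K ^ (2 * m) = ?k t" using K True by (simp add: K_def)
    finally show ?thesis .
  qed auto
  have "(\<integral>\<^sup>+t. \<integral>\<^sup>+z. ennreal (indicator {0<..<1} t * (hilbert_kernel a t * (?g t z / hilbert_kernel a t) ^ (2 * m))) \<partial>M \<partial>lborel)
    \<le> ennreal (?B * N (poly q) ^ (2 * m))"
  proof (cases "\<alpha> + 2 \<le> real m")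
    case True
    have "(\<integral>\<^sup>+t. \<integral>\<^sup>+z. ennreal (indicator {0<..<1} t * (hilbert_kernel a t * (?g t z / hilbert_kernel a t) ^ (2 * m))) \<partial>M \<partial>lborel)
      \<le> (\<integral>\<^sup>+t. ennreal (?k t) * ennreal (N (poly q) ^ (2 * m)) \<partial>lborel)"
    proof (intro nn_integral_mono slice)
      fix t :: real assume t: "0 < t" "t < 1"
      show "(\<integral>\<^sup>+z. ennreal (?g t z ^ (2 * m)) \<partial>M) \<le> ennreal (hilbert_kernel a t ^ (2 * m)) * ennreal (N (poly q) ^ (2 * m))"
        using slice_bound_small[OF True t, of q] hilbert_kernel_pos[OF t, of a]
        by (simp add: power_mult_distrib ennreal_mult[symmetric])
    qed
    also have "\<dots> = (\<integral>\<^sup>+t. ennreal (?k t) \<partial>lborel) * ennreal (N (poly q) ^ (2 * m))"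
      by (rule nn_integral_multc) measurable
    also have "\<dots> = ennreal (?B * N (poly q) ^ (2 * m))"
      unfolding nn_integral_hilbert_kernel[OF a_bounds] by (rule ennreal_mult[symmetric]) (use B in auto)
    finally show ?thesis .
  next
    case False
    have "(\<integral>\<^sup>+t. \<integral>\<^sup>+z. ennreal (indicator {0<..<1} t * (hilbert_kernel a t * (?g t z / hilbert_kernel a t) ^ (2 * m))) \<partial>M \<partial>lborel)
      \<le> (\<integral>\<^sup>+t. ennreal (?k t) * (\<integral>\<^sup>+w. ennreal (indicator (ball 0 1) w * slice_density q t w) \<partial>lborel) \<partial>lborel)"
      by (intro nn_integral_mono slice slice_integral_le)
    also have "\<dots> \<le> ennreal (?B * N (poly q) ^ (2 * m))"
      by (rule slices_integral_large) (use False a_le m2 in auto)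
    finally show ?thesis .
  qed
  then have "ennreal (?B ^ (2 * m - 1)) * (\<integral>\<^sup>+t. \<integral>\<^sup>+z. ennreal (indicator {0<..<1} t * (hilbert_kernel a t * (?g t z / hilbert_kernel a t) ^ (2 * m))) \<partial>M \<partial>lborel)
    \<le> ennreal (?B ^ (2 * m - 1)) * ennreal (?B * N (poly q) ^ (2 * m))"
    by (intro mult_left_mono) auto
  also have "\<dots> = ennreal (?B ^ (2 * m - 1) * (?B * N (poly q) ^ (2 * m)))"
    by (rule ennreal_mult[symmetric]) (use B in auto)
  also have "?B ^ (2 * m - 1) * (?B * N (poly q) ^ (2 * m)) = (?B * N (poly q)) ^ (2 * m)"
  proof -
    have "?B ^ (2 * m) = ?B ^ (2 * m - 1) * ?B" using m1 by (cases "2 * m") auto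
    then show ?thesis by (simp add: power_mult_distrib)
  qed
  finally show ?thesis using hilbert_ext_power_le[of q] by (rule order_trans[rotated])
qed

theorem hilbert_ext_bound_Beta:
  assumes a_le: "\<alpha> + 2 - real m \<le> a" and m2: "m \<ge> 2" and f: "f \<in> S"
  shows "hilbert_ext f \<in> S" "N (hilbert_ext f) \<le> Beta a (1 - a) * N f"
proof -
  have B: "Beta a (1 - a) \<ge> 0" using a_bounds by (simp add: Beta_def)
  show "hilbert_ext f \<in> S" "N (hilbert_ext f) \<le> Beta a (1 - a) * N f"
    using hilbert_ext_norm_le[OF B hilbert_ext_poly_bound[OF a_le m2] f] by auto
qed

end

section \<open>The lower bound\<close>

text \<open>Valid for every real a: at integers both sides are 0 by the conventions for poles and
  division. Being unconditional, it can be applied by rewriting.\<close>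

lemma Beta_reflection_sin:
  fixes a :: real
  shows "Beta a (1 - a) = pi / sin (pi * a)"
proof -
  have "complex_of_real (Gamma a * Gamma (1 - a)) = complex_of_real (pi / sin (pi * a))"
    using Gamma_reflection_complex[of "complex_of_real a"]
      Gamma_complex_of_real[of a] Gamma_complex_of_real[of "1 - a"] sin_of_real[of "pi * a", where 'a=complex]
    by simp
  then have "Gamma a * Gamma (1 - a) = pi / sin (pi * a)"
    by (simp only: of_real_eq_iff)
  then show ?thesis by (simp add: Beta_def)
qed

lemma fps_power_majorant:
  fixes F :: "complex fps" and Y :: "real fps"
  assumes "\<And>n. cmod (fps_nth F n) \<le> fps_nth Y n"
  shows "cmod (fps_nth (F ^ m) n) \<le> fps_nth (Y ^ m) n"
proof (induction m arbitrary: n)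
  case (Suc m)
  have "cmod (fps_nth (F ^ Suc m) n) \<le> (\<Sum>i=0..n. cmod (fps_nth F i * fps_nth (F ^ m) (n - i)))"
    by (simp add: fps_mult_nth norm_sum)
  also have "\<dots> \<le> (\<Sum>i=0..n. fps_nth Y i * fps_nth (Y ^ m) (n - i))"
    unfolding norm_mult by (intro sum_mono mult_mono assms Suc.IH) (auto intro: order_trans[OF norm_ge_zero assms])
  finally show ?case by (simp add: fps_mult_nth)
qed (simp add: fps_one_nth)

lemma fps_power_of_real:
  fixes Y :: "real fps"
  shows "fps_nth (Abs_fps (\<lambda>n. complex_of_real (fps_nth Y n)) ^ m) n = complex_of_real (fps_nth (Y ^ m) n)"
  by (induction m arbitrary: n) (simp_all add: fps_mult_nth fps_one_nth)

lemma binomial_series_complex: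
  fixes s :: real and z :: complex
  assumes "cmod z < 1"
  shows "(\<lambda>n. complex_of_real (pochhammer s n / fact n) * z ^ n) sums (1 - z) powr (- of_real s)"
proof -
  have "complex_of_real (pochhammer s n / fact n) = pochhammer (of_real s) n / fact n" for n
    by (simp add: pochhammer_of_real)
  then show ?thesis using one_minus_powr_complex_sums[OF assms, of "of_real s"] by simp
qed

context even_bergman
begin

text \<open>Coefficients of F^m are sums of products of those of F, hence dominated by the
  coefficients of the m-th power of the nonnegative majorant; Parseval for the m-th powers then
  compares the norms.\<close>

lemma norm_majorant:
  assumes F: "has_disc_fps F f" and G: "has_disc_fps (Abs_fps (\<lambda>n. complex_of_real (y n))) g"
    and le: "\<And>n. cmod (fps_nth F n) \<le> y n" and g: "g \<in> S"
  shows "f \<in> S" "N f \<le> N g"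
proof -
  define Y where "Y = Abs_fps y"
  have G': "has_disc_fps (Abs_fps (\<lambda>n. complex_of_real (fps_nth Y n))) g"
    using G by (simp add: Y_def)
  have "(\<integral>\<^sup>+z. ennreal (cmod (f z) ^ (2 * m)) \<partial>M) = (\<Sum>n. ennreal ((cmod (fps_nth (F ^ m) n))\<^sup>2 * bergman_moment \<alpha> n))"
    by (rule parseval_power[OF F])
  also have "\<dots> \<le> (\<Sum>n. ennreal ((cmod (fps_nth (Abs_fps (\<lambda>n. complex_of_real (fps_nth Y n)) ^ m) n))\<^sup>2 * bergman_moment \<alpha> n))"
  proof (intro suminf_le ennreal_leI mult_right_mono power_mono)
    fix n
    have "cmod (fps_nth (F ^ m) n) \<le> fps_nth (Y ^ m) n"
      by (rule fps_power_majorant) (simp add: le Y_def)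
    also have "\<dots> \<le> cmod (fps_nth (Abs_fps (\<lambda>n. complex_of_real (fps_nth Y n)) ^ m) n)"
      unfolding fps_power_of_real by simp
    finally show "cmod (fps_nth (F ^ m) n) \<le> cmod (fps_nth (Abs_fps (\<lambda>n. complex_of_real (fps_nth Y n)) ^ m) n)" .
  qed (use bergman_moment_pos[OF \<alpha>] in \<open>auto simp: less_imp_le\<close>)
  also have "\<dots> = ennreal (N g ^ (2 * m))"
    using parseval_power[OF G'] nn_integral_eq_norm_power[OF g] by simp
  finally have le: "(\<integral>\<^sup>+z. ennreal (cmod (f z) ^ (2 * m)) \<partial>M) \<le> ennreal (N g ^ (2 * m))" .
  show "f \<in> S" "N f \<le> N g"
    using spaceI[OF has_disc_fps_holomorphic[OF F] le] by auto
qed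

end

section \<open>Norms of the test functions\<close>

context hilbert_bergman
begin

definition test_fun :: "real \<Rightarrow> complex \<Rightarrow> complex" where
  "test_fun \<kappa> z = (1 - z) powr (- of_real \<kappa>)"

text \<open>The Parseval terms of (1 - z)^(-m \<kappa>), the m-th power of the test function; they
  add up to its norm to the power 2m.\<close>

definition test_term :: "real \<Rightarrow> nat \<Rightarrow> real" where
  "test_term \<kappa> n = (pochhammer (real m * \<kappa>) n / fact n)\<^sup>2 * bergman_moment \<alpha> n"

lemma test_fun_fps: "has_disc_fps (Abs_fps (\<lambda>n. complex_of_real (pochhammer \<kappa> n / fact n))) (test_fun \<kappa>)"
  unfolding has_disc_fps_def test_fun_def using binomial_series_complex by simp

lemma test_fun_nn_integral:
  "(\<integral>\<^sup>+z. ennreal (cmod (test_fun \<kappa> z) ^ (2 * m)) \<partial>M) = (\<Sum>n. ennreal (test_term \<kappa> n))"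
proof -
  let ?g = "\<lambda>z::complex. (1 - z) powr (- of_real (real m * \<kappa>))"
  have F: "has_disc_fps (Abs_fps (\<lambda>n. complex_of_real (pochhammer (real m * \<kappa>) n / fact n))) ?g"
    unfolding has_disc_fps_def fps_nth_Abs_fps by (intro allI impI binomial_series_complex)
  have "cmod (test_fun \<kappa> z) ^ (2 * m) = (cmod (?g z))\<^sup>2" if "cmod z < 1" for z
  proof -
    have "1 - z \<noteq> 0" using that by auto
    then have "test_fun \<kappa> z ^ m = ?g z"
      unfolding test_fun_def by (simp add: powr_power)
    then have "(cmod (?g z))\<^sup>2 = (cmod (test_fun \<kappa> z ^ m))\<^sup>2" by simp
    then show ?thesis by (simp add: norm_power power_mult[symmetric] mult.commute)
  qed
  then have "(\<integral>\<^sup>+z. ennreal (cmod (test_fun \<kappa> z) ^ (2 * m)) \<partial>M) = (\<integral>\<^sup>+z. ennreal ((cmod (?g z))\<^sup>2) \<partial>M)"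
    by (intro nn_integral_cong) simp
  also have "\<dots> = (\<Sum>n. ennreal ((cmod (complex_of_real (pochhammer (real m * \<kappa>) n / fact n)))\<^sup>2 * bergman_moment \<alpha> n))"
    using bergman_parseval[OF \<alpha> F] by simp
  also have "\<dots> = (\<Sum>n. ennreal (test_term \<kappa> n))"
    unfolding test_term_def norm_of_real power2_abs ..
  finally show ?thesis .
qed

lemma test_term_pos: "\<kappa> > 0 \<Longrightarrow> test_term \<kappa> n > 0"
  unfolding test_term_def using bergman_moment_pos[OF \<alpha>, of n] m1
  by (intro mult_pos_pos zero_less_power divide_pos_pos pochhammer_pos) auto

lemma test_term_Suc:
  "test_term \<kappa> (Suc n) * (real (Suc n) * (\<alpha> + 2 + real n)) = test_term \<kappa> n * (real m * \<kappa> + real n)\<^sup>2"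
proof -
  have p: "pochhammer (\<alpha> + 2) n > 0" "\<alpha> + 2 + real n > 0" using \<alpha> by (auto intro!: pochhammer_pos)
  have "test_term \<kappa> (Suc n) = test_term \<kappa> n * ((real m * \<kappa> + real n)\<^sup>2 / (real (Suc n) * (\<alpha> + 2 + real n)))"
    unfolding test_term_def bergman_moment_eq_pochhammer[OF \<alpha>] pochhammer_Suc fact_Suc of_nat_mult
      power_divide power_mult_distrib
    using p by (simp add: divide_simps power2_eq_square del: of_nat_Suc)
  then show ?thesis using p by (simp del: of_nat_Suc)
qed

text \<open>Raabe's test: n times (the ratio of the n-th to the next term, minus 1) tends to \<beta>
  + 1 - 2 x with x = m \<kappa>, and this exceeds 1 exactly when \<kappa> < a.\<close>

lemma test_term_summable:
  assumes \<kappa>: "0 < \<kappa>" "\<kappa> < a"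
  shows "summable (test_term \<kappa>)"
proof (rule raabes_test_convergence)
  show "eventually (\<lambda>n. test_term \<kappa> n > 0) sequentially"
    using test_term_pos[OF \<kappa>(1)] by simp
  define x where "x = real m * \<kappa>"
  define \<beta> where "\<beta> = \<alpha> + 2"
  have x: "x > 0" "2 * x < \<beta>"
  proof -
    show "x > 0" using \<kappa> m1 by (simp add: x_def)
    show "2 * x < \<beta>" using \<kappa>(2) m1 by (simp add: x_def \<beta>_def less_divide_eq mult_ac)
  qed
  have "(\<lambda>n. ((\<beta> + 1 - 2 * x) + (\<beta> - x\<^sup>2) * (1 / real n)) / (x * (1 / real n) + 1)\<^sup>2) \<longlonglongrightarrow>
     ((\<beta> + 1 - 2 * x) + (\<beta> - x\<^sup>2) * 0) / (x * 0 + 1)\<^sup>2"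
    by (intro tendsto_intros lim_1_over_n) auto
  then have L: "(\<lambda>n. ((\<beta> + 1 - 2 * x) + (\<beta> - x\<^sup>2) * (1 / real n)) / (x * (1 / real n) + 1)\<^sup>2) \<longlonglongrightarrow> \<beta> + 1 - 2 * x"
    by simp
  have "eventually (\<lambda>n. ((\<beta> + 1 - 2 * x) + (\<beta> - x\<^sup>2) * (1 / real n)) / (x * (1 / real n) + 1)\<^sup>2 =
     real n * (test_term \<kappa> n / test_term \<kappa> (Suc n) - 1)) sequentially"
    using eventually_gt_at_top[of 0]
  proof eventually_elim
    case (elim n)
    have n: "real n > 0" using elim by simp
    have xn: "x + real n > 0" using x n by simp
    have "test_term \<kappa> (Suc n) * (real (Suc n) * (\<beta> + real n)) = test_term \<kappa> n * (x + real n)\<^sup>2"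
      using test_term_Suc[of \<kappa> n] by (simp add: x_def \<beta>_def)
    then have "test_term \<kappa> n / test_term \<kappa> (Suc n) = (real (Suc n) * (\<beta> + real n)) / (x + real n)\<^sup>2"
      using test_term_pos[OF \<kappa>(1), of "Suc n"] xn by (simp add: frac_eq_eq mult_ac)
    then have "real n * (test_term \<kappa> n / test_term \<kappa> (Suc n) - 1) =
       real n * ((real (Suc n) * (\<beta> + real n) - (x + real n)\<^sup>2) / (x + real n)\<^sup>2)"
      using xn by (simp add: diff_divide_distrib)
    also have "real (Suc n) * (\<beta> + real n) - (x + real n)\<^sup>2 = (\<beta> + 1 - 2 * x) * real n + (\<beta> - x\<^sup>2)"
      by (simp add: power2_eq_square algebra_simps)
    also have "real n * (((\<beta> + 1 - 2 * x) * real n + (\<beta> - x\<^sup>2)) / (x + real n)\<^sup>2) =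
       ((\<beta> + 1 - 2 * x) + (\<beta> - x\<^sup>2) * (1 / real n)) / (x * (1 / real n) + 1)\<^sup>2"
    proof -
      have 1: "(\<beta> + 1 - 2 * x) + (\<beta> - x\<^sup>2) * (1 / real n) = ((\<beta> + 1 - 2 * x) * real n + (\<beta> - x\<^sup>2)) / real n"
        using n by (simp add: add_divide_distrib)
      have 2: "x * (1 / real n) + 1 = (x + real n) / real n" using n by (simp add: add_divide_distrib)
      show ?thesis unfolding 1 2 using n xn by (simp add: power_divide power2_eq_square)
    qed
    finally show ?case by simp
  qed
  then have "(\<lambda>n. real n * (test_term \<kappa> n / test_term \<kappa> (Suc n) - 1)) \<longlonglongrightarrow> \<beta> + 1 - 2 * x"
    using L by (rule Lim_transform_eventually[rotated])
  then have "(\<lambda>n. ereal (real n * (test_term \<kappa> n / test_term \<kappa> (Suc n) - 1))) \<longlonglongrightarrow> ereal (\<beta> + 1 - 2 * x)"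
    by simp
  then have "liminf (\<lambda>n. ereal (real n * (test_term \<kappa> n / test_term \<kappa> (Suc n) - 1))) = ereal (\<beta> + 1 - 2 * x)"
    by (rule lim_imp_Liminf[OF sequentially_bot])
  then show "1 < liminf (\<lambda>n. ereal (of_nat n * (test_term \<kappa> n / test_term \<kappa> (Suc n) - 1)))"
    using x by simp
qed

text \<open>At the critical exponent, \<open>n\<close> times the \<open>n\<close>-th term is increasing.\<close>

lemma test_term_critical_not_summable: "\<not> summable (test_term a)"
proof
  assume s: "summable (test_term a)"
  define x where "x = (\<alpha> + 2) / 2"
  have x: "x > 0" "real m * a = x" "\<alpha> + 2 = 2 * x" using \<alpha> m1 by (auto simp: x_def)
  \<comment> \<open>The inductive step is the recursion combined with k (2 x + k) <= (x + k)^2. The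
    comparison starts at index 1, because n times the n-th term is 0 at index 0.\<close>
  have inc: "test_term a (Suc 0) \<le> real (Suc n) * test_term a (Suc n)" for n
  proof (induction n)
    case (Suc n)
    let ?k = "real (Suc n)"
    have "test_term a (Suc (Suc n)) * (real (Suc (Suc n)) * (2 * x + ?k)) = test_term a (Suc n) * (x + ?k)\<^sup>2"
      unfolding x(3)[symmetric] by (rule test_term_Suc[of a "Suc n", unfolded x(2)])
    moreover have "test_term a (Suc n) * (?k * (2 * x + ?k)) \<le> test_term a (Suc n) * (x + ?k)\<^sup>2"
      using test_term_pos[OF a_bounds(1), of "Suc n"] by (intro mult_left_mono) (auto simp: power2_eq_square algebra_simps)
    ultimately have "(?k * test_term a (Suc n)) * (2 * x + ?k) \<le> (real (Suc (Suc n)) * test_term a (Suc (Suc n))) * (2 * x + ?k)"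
      by (simp add: mult_ac)
    then have "?k * test_term a (Suc n) \<le> real (Suc (Suc n)) * test_term a (Suc (Suc n))"
      using x(1) by (subst (asm) mult_le_cancel_right_pos) auto
    then show ?case using Suc.IH by linarith
  qed simp
  have "summable (\<lambda>n. test_term a (Suc 0) * (1 / real (Suc n)))"
  proof (rule summable_comparison_test'[where g="\<lambda>n. test_term a (Suc n)" and N=0])
    show "summable (\<lambda>n. test_term a (Suc n))" using s by (subst summable_Suc_iff)
    fix n
    have "test_term a (Suc 0) * (1 / real (Suc n)) \<le> test_term a (Suc n)"
      using inc[of n] by (simp add: divide_le_eq mult.commute del: of_nat_Suc)
    moreover have "0 \<le> test_term a (Suc 0) * (1 / real (Suc n))"
      using test_term_pos[OF a_bounds(1), of "Suc 0"] by simp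
    ultimately show "norm (test_term a (Suc 0) * (1 / real (Suc n))) \<le> test_term a (Suc n)" by simp
  qed
  then have "summable (\<lambda>n. 1 / real (Suc n))"
    using summable_cmult_iff[of "test_term a (Suc 0)" "\<lambda>n. 1 / real (Suc n)"] test_term_pos[OF a_bounds(1), of "Suc 0"]
    by (metis less_irrefl)
  then have "summable (\<lambda>n. 1 / real n)" by (subst (asm) summable_Suc_iff)
  then show False using not_summable_harmonic[where 'a=real] by (simp add: inverse_eq_divide)
qed

lemma test_fun_in_space:
  assumes \<kappa>: "0 < \<kappa>" "\<kappa> < a"
  shows "test_fun \<kappa> \<in> S" "N (test_fun \<kappa>) ^ (2 * m) = (\<Sum>n. test_term \<kappa> n)"
proof -
  have s: "(\<Sum>n. ennreal (test_term \<kappa> n)) = ennreal (\<Sum>n. test_term \<kappa> n)"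
    by (rule suminf_ennreal_eq[OF _ summable_sums[OF test_term_summable[OF \<kappa>]]])
       (use test_term_pos[OF \<kappa>(1)] in \<open>auto simp: less_imp_le\<close>)
  have nn: "(\<Sum>n. test_term \<kappa> n) \<ge> 0"
    by (rule suminf_nonneg[OF test_term_summable[OF \<kappa>]]) (use test_term_pos[OF \<kappa>(1)] in \<open>auto simp: less_imp_le\<close>)
  define C where "C = (\<Sum>n. test_term \<kappa> n) powr (1 / (2 * real m))"
  have C: "C ^ (2 * m) = (\<Sum>n. test_term \<kappa> n)" "C \<ge> 0"
    unfolding C_def by (rule powr_root_power[OF nn m1]) simp
  show S: "test_fun \<kappa> \<in> S"
    by (rule spaceI(1)[OF has_disc_fps_holomorphic[OF test_fun_fps] _ C(2)]) (simp add: test_fun_nn_integral s C(1))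
  show "N (test_fun \<kappa>) ^ (2 * m) = (\<Sum>n. test_term \<kappa> n)"
    using nn_integral_eq_norm_power[OF S] nn by (simp add: test_fun_nn_integral s)
qed

lemma eventually_at_left_a: "eventually (\<lambda>\<kappa>. 0 < \<kappa> \<and> \<kappa> < a) (at_left a)"
  using eventually_at_left_real[OF a_bounds(1)] by simp

text \<open>Divergence at \<kappa> = a provides a finite partial sum above any given bound; being
  continuous in \<kappa>, it stays above that bound for \<kappa> near a, and there it bounds the
  convergent full sum from below.\<close>

lemma test_fun_norm_at_top: "filterlim (\<lambda>\<kappa>. N (test_fun \<kappa>)) at_top (at_left a)"
  unfolding filterlim_at_top_ge[where c=0]
proof (intro allI impI)
  fix K :: real assume K: "K \<ge> 0"
  obtain L where L: "(\<Sum>n<L. test_term a n) > K ^ (2 * m)"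
  proof (rule ccontr)
    assume "\<not> thesis"
    then have b: "(\<Sum>n<L. test_term a n) \<le> K ^ (2 * m)" for L using that not_le by blast
    have "summable (test_term a)"
      by (rule bounded_imp_summable[where B="K ^ (2 * m)"])
         (use test_term_pos[OF a_bounds(1)] b[of "Suc _"] in \<open>auto simp: less_imp_le lessThan_Suc_atMost\<close>)
    then show False using test_term_critical_not_summable by simp
  qed
  have "continuous_on UNIV (\<lambda>\<kappa>. \<Sum>n<L. test_term \<kappa> n)"
    unfolding test_term_def pochhammer_prod by (intro continuous_intros) auto
  then have "isCont (\<lambda>\<kappa>. \<Sum>n<L. test_term \<kappa> n) a"
    by (simp add: continuous_on_eq_continuous_at)
  then have "((\<lambda>\<kappa>. \<Sum>n<L. test_term \<kappa> n) \<longlongrightarrow> (\<Sum>n<L. test_term a n)) (at_left a)"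
    unfolding isCont_def by (rule filterlim_mono) (auto simp: at_within_le_nhds at_le)
  then have "eventually (\<lambda>\<kappa>. (\<Sum>n<L. test_term \<kappa> n) > K ^ (2 * m)) (at_left a)"
    using L by (rule order_tendstoD)
  then show "eventually (\<lambda>\<kappa>. K \<le> N (test_fun \<kappa>)) (at_left a)"
    using eventually_at_left_a
  proof eventually_elim
    case (elim \<kappa>)
    then have \<kappa>: "0 < \<kappa>" "\<kappa> < a" by auto
    have "K ^ (2 * m) \<le> (\<Sum>n<L. test_term \<kappa> n)" using elim by simp
    also have "\<dots> \<le> (\<Sum>n. test_term \<kappa> n)"
      by (rule sum_le_suminf[OF test_term_summable[OF \<kappa>]]) (use test_term_pos[OF \<kappa>(1)] in \<open>auto simp: less_imp_le\<close>)
    also have "\<dots> = N (test_fun \<kappa>) ^ (2 * m)" using test_fun_in_space(2)[OF \<kappa>] by simp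
    finally show ?case using K m1 by (subst (asm) power_mono_iff) auto
  qed
qed

section \<open>The operator on the test functions\<close>

lemma radial_moment_test_fun:
  assumes \<kappa>: "0 < \<kappa>" "\<kappa> < 1"
  shows "radial_moment (test_fun \<kappa>) n = complex_of_real (Beta (real (Suc n)) (1 - \<kappa>))"
proof -
  have e: "complex_of_real t ^ n * test_fun \<kappa> (complex_of_real t) = complex_of_real (t powr (real (Suc n) - 1) * (1 - t) powr ((1 - \<kappa>) - 1))"
    if "t \<in> {0<..<1}" for t
  proof -
    have "test_fun \<kappa> (complex_of_real t) = complex_of_real (1 - t) powr complex_of_real (- \<kappa>)"
      by (simp add: test_fun_def)
    also have "\<dots> = complex_of_real ((1 - t) powr (- \<kappa>))"
      using that by (subst powr_of_real) auto
    finally show ?thesis using that by (simp add: powr_realpow)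
  qed
  have "set_integrable lborel {0..1} (\<lambda>t. t powr (real (Suc n) - 1) * (1 - t) powr ((1 - \<kappa>) - 1))"
    by (rule integrable_Beta) (use \<kappa> in auto)
  then have si: "set_integrable lborel {0<..<1} (\<lambda>t. t powr (real (Suc n) - 1) * (1 - t) powr ((1 - \<kappa>) - 1))"
    by (rule set_integrable_subset) auto
  have "radial_moment (test_fun \<kappa>) n = (LINT t:{0<..<1}|lborel. complex_of_real (t powr (real (Suc n) - 1) * (1 - t) powr ((1 - \<kappa>) - 1)))"
    unfolding radial_moment_def by (rule set_lebesgue_integral_cong) (use e in auto)
  also have "\<dots> = complex_of_real (LINT t:{0<..<1}|lborel. t powr (real (Suc n) - 1) * (1 - t) powr ((1 - \<kappa>) - 1))"
    by (rule set_integral_complex_of_real)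
  also have "(LINT t:{0<..<1}|lborel. t powr (real (Suc n) - 1) * (1 - t) powr ((1 - \<kappa>) - 1)) =
     integral {0<..<1} (\<lambda>t. t powr (real (Suc n) - 1) * (1 - t) powr ((1 - \<kappa>) - 1))"
    by (rule set_borel_integral_eq_integral(2)[OF si])
  also have "\<dots> = Beta (real (Suc n)) (1 - \<kappa>)"
  proof (rule integral_unique)
    have "((\<lambda>t. t powr (real (Suc n) - 1) * (1 - t) powr ((1 - \<kappa>) - 1)) has_integral Beta (real (Suc n)) (1 - \<kappa>)) {0..1}"
      by (rule has_integral_Beta_real) (use \<kappa> in auto)
    then show "((\<lambda>t. t powr (real (Suc n) - 1) * (1 - t) powr ((1 - \<kappa>) - 1)) has_integral Beta (real (Suc n)) (1 - \<kappa>)) {0<..<1}"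
      by (subst has_integral_Icc_iff_Ioo[symmetric])
  qed
  finally show ?thesis .
qed

text \<open>B(\<kappa>, 1 - \<kappa>) times the coefficient of the test function is B(\<kappa> + n,
  1 - \<kappa>), which is larger than the wanted B(n + 1, 1 - \<kappa>). Passing through B(n, 1 -
  \<kappa>) costs only the factor n / (n + 1), which tends to 1.\<close>

lemma Beta_coefficient_ge:
  fixes \<kappa> :: real
  assumes \<kappa>: "0 < \<kappa>" "\<kappa> < 1" and n: "n \<ge> 1"
  shows "real n / real (n + 1) * (Beta \<kappa> (1 - \<kappa>) * (pochhammer \<kappa> n / fact n)) \<le> Beta (real (Suc n)) (1 - \<kappa>)"
proof -
  have G: "Gamma (real (Suc n)) = fact n" using Gamma_fact[of n, where 'a=real] by (simp add: add.commute)
  have "Beta \<kappa> (1 - \<kappa>) * (pochhammer \<kappa> n / fact n) = Beta (\<kappa> + real n) (1 - \<kappa>)"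
    unfolding pochhammer_eq_Gamma_quotient[OF \<kappa>(1)] Beta_def using \<kappa> G Gamma_real_pos[of \<kappa>]
    by (simp add: add.commute less_imp_neq[symmetric])
  also have "\<dots> \<le> Beta (real n) (1 - \<kappa>)"
    by (rule Beta_real_mono) (use \<kappa> n in auto)
  finally have 1: "Beta \<kappa> (1 - \<kappa>) * (pochhammer \<kappa> n / fact n) \<le> Beta (real n) (1 - \<kappa>)" .
  have B: "Beta (real n) (1 - \<kappa>) > 0" using \<kappa> n by (simp add: Beta_def)
  have g1: "Gamma (real (Suc n)) = real n * Gamma (real n)"
    using Gamma_plus1_pos[of "real n"] n by (simp add: add.commute)
  have g2: "Gamma (real (Suc n) + (1 - \<kappa>)) = (real n + (1 - \<kappa>)) * Gamma (real n + (1 - \<kappa>))"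
    using Gamma_plus1_pos[of "real n + (1 - \<kappa>)"] n \<kappa> by (simp add: add_ac)
  have "Beta (real (Suc n)) (1 - \<kappa>) = real n / (real n + (1 - \<kappa>)) * Beta (real n) (1 - \<kappa>)"
    unfolding Beta_def g1 g2 by simp
  moreover have "real n / real (n + 1) * Beta (real n) (1 - \<kappa>) \<le> real n / (real n + (1 - \<kappa>)) * Beta (real n) (1 - \<kappa>)"
    using B \<kappa> n by (intro mult_right_mono divide_left_mono) (auto intro!: mult_pos_pos)
  moreover have "real n / real (n + 1) * (Beta \<kappa> (1 - \<kappa>) * (pochhammer \<kappa> n / fact n)) \<le> real n / real (n + 1) * Beta (real n) (1 - \<kappa>)"
    by (intro mult_left_mono 1) simp
  ultimately show ?thesis by linarith
qed

text \<open>Dropping the first k terms of the test function makes k / (k + 1) a valid factor for all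
  remaining coefficients. The dropped polynomial has k coefficients in [0, 1], so its norm is at
  most k uniformly in \<kappa>, as the limit \<kappa> -> a requires.\<close>

lemma hilbert_ext_test_fun_ge:
  assumes \<kappa>: "0 < \<kappa>" "\<kappa> < a" and hS: "hilbert_ext (test_fun \<kappa>) \<in> S" and k: "k \<ge> 1"
  shows "real k / real (k + 1) * Beta \<kappa> (1 - \<kappa>) * (N (test_fun \<kappa>) - real k) \<le> N (hilbert_ext (test_fun \<kappa>))"
proof -
  define d where "d = (\<lambda>n. pochhammer \<kappa> n / fact n)"
  define c where "c = real k / real (k + 1) * Beta \<kappa> (1 - \<kappa>)"
  define P where "P = (\<Sum>n<k. monom (complex_of_real (d n)) n)"
  have \<kappa>1: "\<kappa> < 1" using \<kappa> a_bounds by simp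
  have B: "Beta \<kappa> (1 - \<kappa>) > 0" using \<kappa> \<kappa>1 by (simp add: Beta_def)
  have c0: "c \<ge> 0" using B by (simp add: c_def)
  have d0: "d n \<ge> 0" and d1: "d n \<le> 1" for n
  proof -
    show "d n \<ge> 0" unfolding d_def using \<kappa> by (simp add: pochhammer_nonneg)
    have "pochhammer \<kappa> n \<le> fact n"
      unfolding pochhammer_fact pochhammer_prod using \<kappa> \<kappa>1 by (intro prod_mono) auto
    then show "d n \<le> 1" by (simp add: d_def)
  qed
  have PS: "poly P \<in> S" by (rule poly_in_space)
  have Pz: "poly P z = (\<Sum>n<k. complex_of_real (d n) * z ^ n)" for z
    by (simp add: P_def poly_sum poly_monom)
  have PN: "N (poly P) \<le> real k"
  proof (rule spaceI_bounded(2))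
    fix z :: complex assume z: "cmod z < 1"
    have "cmod (poly P z) \<le> (\<Sum>n<k. cmod (complex_of_real (d n) * z ^ n))"
      unfolding Pz by (rule norm_sum)
    also have "\<dots> \<le> (\<Sum>n<k. 1)"
    proof (rule sum_mono)
      fix n
      have "d n * cmod z ^ n \<le> 1 * 1" using d0[of n] d1[of n] z by (intro mult_mono power_le_one) auto
      then show "cmod (complex_of_real (d n) * z ^ n) \<le> 1" using d0[of n] by (simp add: norm_mult norm_power)
    qed
    finally show "cmod (poly P z) \<le> real k" by simp
  qed (auto intro!: holomorphic_intros)
  have fS: "test_fun \<kappa> \<in> S" by (rule test_fun_in_space(1)[OF \<kappa>])
  define r where "r = (\<lambda>z. test_fun \<kappa> z - poly P z)"
  have rS: "r \<in> S" unfolding r_def by (rule bnorm_diff(1)[OF fS PS])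
  have "N (\<lambda>z. r z + poly P z) \<le> N r + N (poly P)" by (rule bnorm_add(2)[OF rS PS])
  then have Nr: "N (test_fun \<kappa>) - real k \<le> N r" using PN by (simp add: r_def)
  have rF: "has_disc_fps (Abs_fps (\<lambda>n. complex_of_real (if n < k then 0 else d n))) r"
    unfolding has_disc_fps_def
  proof (intro allI impI)
    fix z :: complex assume z: "cmod z < 1"
    have s1: "(\<lambda>n. complex_of_real (d n) * z ^ n) sums test_fun \<kappa> z"
      using test_fun_fps z unfolding has_disc_fps_def d_def by simp
    have s2: "(\<lambda>n. if n \<in> {..<k} then complex_of_real (d n) * z ^ n else 0) sums poly P z"
      unfolding Pz by (rule sums_If_finite_set) simp
    have "(\<lambda>n. complex_of_real (d n) * z ^ n - (if n \<in> {..<k} then complex_of_real (d n) * z ^ n else 0)) sums r z"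
      unfolding r_def by (rule sums_diff[OF s1 s2])
    moreover have "complex_of_real (d n) * z ^ n - (if n \<in> {..<k} then complex_of_real (d n) * z ^ n else 0) =
       fps_nth (Abs_fps (\<lambda>n. complex_of_real (if n < k then 0 else d n))) n * z ^ n" for n by simp
    ultimately show "(\<lambda>n. fps_nth (Abs_fps (\<lambda>n. complex_of_real (if n < k then 0 else d n))) n * z ^ n) sums r z"
      by simp
  qed
  have crF: "has_disc_fps (Abs_fps (\<lambda>n. complex_of_real c * complex_of_real (if n < k then 0 else d n))) (\<lambda>z. complex_of_real c * r z)"
    using rF unfolding has_disc_fps_def by (auto simp: mult.assoc intro!: sums_mult)
  have hF: "has_disc_fps (Abs_fps (\<lambda>n. complex_of_real (Beta (real (Suc n)) (1 - \<kappa>)))) (hilbert_ext (test_fun \<kappa>))"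
    using hilbert_ext_fps[OF fS] unfolding radial_moment_test_fun[OF \<kappa>(1) \<kappa>1, abs_def] .
  have "N (\<lambda>z. complex_of_real c * r z) \<le> N (hilbert_ext (test_fun \<kappa>))"
  proof (rule norm_majorant(2)[OF crF hF _ hS])
    fix n
    show "cmod (fps_nth (Abs_fps (\<lambda>n. complex_of_real c * complex_of_real (if n < k then 0 else d n))) n) \<le> Beta (real (Suc n)) (1 - \<kappa>)"
    proof (cases "n < k")
      case True
      have "Beta (real (Suc n)) (1 - \<kappa>) > 0" using \<kappa>1 by (simp add: Beta_def)
      then show ?thesis using True by simp
    next
      case False
      have "real k * real (n + 1) \<le> real n * real (k + 1)" using False by (simp add: algebra_simps)
      then have "real k / real (k + 1) \<le> real n / real (n + 1)" by (simp add: divide_le_eq le_divide_eq mult_ac)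
      then have "c * d n \<le> real n / real (n + 1) * Beta \<kappa> (1 - \<kappa>) * d n"
        unfolding c_def using B d0[of n] by (intro mult_right_mono) auto
      also have "\<dots> \<le> Beta (real (Suc n)) (1 - \<kappa>)"
        using Beta_coefficient_ge[OF \<kappa>(1) \<kappa>1, of n] False k by (simp add: d_def mult.assoc)
      finally show ?thesis using False c0 d0[of n] by (simp add: norm_mult)
    qed
  qed
  then have "c * N r \<le> N (hilbert_ext (test_fun \<kappa>))"
    using bnorm_cmult(2)[OF rS, of "complex_of_real c"] c0 by simp
  then show ?thesis
    using mult_left_mono[OF Nr c0] unfolding c_def by linarith
qed

text \<open>The lower bound takes two limits. As \<kappa> tends to a, the norm of the test function
  tends to infinity and the cut-off error k / N disappears; afterwards k tends to infinity and k /
  (k + 1) to 1.\<close>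

theorem hilbert_onorm:
  assumes a_le: "\<alpha> + 2 - real m \<le> a" and m2: "m \<ge> 2"
    and T: "is_hilbert_operator (2 * real m) \<alpha> T"
  shows "bergman_onorm (2 * real m) \<alpha> T = Beta a (1 - a)"
proof -
  let ?B = "Beta a (1 - a)"
  have B: "?B > 0" using a_bounds by (simp add: Beta_def)
  have TN: "N (T f) = N (hilbert_ext f)" if "f \<in> S" for f
    by (rule bnorm_cong) (rule hilbert_operator_unique[OF T that])
  have up: "N (T f) / N f \<le> ?B" if f: "f \<in> S" for f
  proof (cases "N f = 0")
    case False
    then have "N f > 0" using bnorm_nonneg[of f] by linarith
    then show ?thesis using hilbert_ext_bound_Beta(2)[OF a_le m2 f] TN[OF f] by (simp add: divide_le_eq)
  qed (use B in simp)
  have ne: "S \<noteq> {}" using poly_in_space[of 0] by blast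
  have bdd: "bdd_above ((\<lambda>f. N (T f) / N f) ` S)" using up by (intro bdd_aboveI2)
  let ?n = "bergman_onorm (2 * real m) \<alpha> T"
  have le: "?n \<le> ?B"
    unfolding bergman_onorm_def by (rule cSUP_least[OF ne up])
  have ge: "N (hilbert_ext f) / N f \<le> ?n" if f: "f \<in> S" for f
    unfolding bergman_onorm_def using cSUP_upper[OF f bdd] TN[OF f] by simp
  have step: "real k / real (k + 1) * ?B \<le> ?n" if k: "k \<ge> 1" for k
  proof -
    let ?c = "real k / real (k + 1)"
    have "pi * a > 0" using a_bounds(1) by (intro mult_pos_pos) auto
    moreover have "pi * a < pi" using mult_strict_left_mono[OF a_bounds(2) pi_gt_zero] by (simp only: mult_1_right)
    ultimately have sin: "sin (pi * a) \<noteq> 0" using sin_gt_zero[of "pi * a"] by simp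
    have inv: "((\<lambda>\<kappa>. real k / N (test_fun \<kappa>)) \<longlongrightarrow> 0) (at_left a)"
      by (rule real_tendsto_divide_at_top[OF tendsto_const test_fun_norm_at_top])
    \<comment> \<open>Beta is written as a quotient with the sine so that its continuity at a is
      immediate.\<close>
    have "((\<lambda>\<kappa>. ?c * (pi / sin (pi * \<kappa>)) * (1 - real k / N (test_fun \<kappa>))) \<longlongrightarrow> ?c * (pi / sin (pi * a)) * (1 - 0)) (at_left a)"
      by (intro tendsto_intros inv sin)
    moreover have "eventually (\<lambda>\<kappa>. ?c * (pi / sin (pi * \<kappa>)) * (1 - real k / N (test_fun \<kappa>)) \<le> ?n) (at_left a)"
      using eventually_at_left_a filterlim_at_top_dense[THEN iffD1, OF test_fun_norm_at_top, rule_format, of 0]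
    proof eventually_elim
      case (elim \<kappa>)
      then have \<kappa>: "0 < \<kappa>" "\<kappa> < a" and Np: "N (test_fun \<kappa>) > 0" by auto
      have fS: "test_fun \<kappa> \<in> S" by (rule test_fun_in_space(1)[OF \<kappa>])
      have "?c * Beta \<kappa> (1 - \<kappa>) * (N (test_fun \<kappa>) - real k) / N (test_fun \<kappa>) \<le> N (hilbert_ext (test_fun \<kappa>)) / N (test_fun \<kappa>)"
        using hilbert_ext_test_fun_ge[OF \<kappa> hilbert_ext_bound_Beta(1)[OF a_le m2 fS] k] Np
        by (intro divide_right_mono) auto
      also have "\<dots> \<le> ?n" by (rule ge[OF fS])
      also have "?c * Beta \<kappa> (1 - \<kappa>) * (N (test_fun \<kappa>) - real k) / N (test_fun \<kappa>) = ?c * Beta \<kappa> (1 - \<kappa>) * (1 - real k / N (test_fun \<kappa>))"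
      proof -
        have "1 - real k / N (test_fun \<kappa>) = (N (test_fun \<kappa>) - real k) / N (test_fun \<kappa>)"
          using Np by (simp add: diff_divide_distrib)
        then show ?thesis by (simp only: times_divide_eq_right)
      qed
      finally show ?case unfolding Beta_reflection_sin .
    qed
    ultimately have "?c * (pi / sin (pi * a)) * (1 - 0) \<le> ?n"
      by (rule tendsto_upperbound) simp
    then show ?thesis unfolding Beta_reflection_sin by simp
  qed
  have "(\<lambda>k. real (Suc k) / real (Suc k + 1) * ?B) \<longlonglongrightarrow> 1 * ?B"
  proof (intro tendsto_intros)
    have "(\<lambda>k. 1 - 1 / real (k + 2)) \<longlonglongrightarrow> 1 - 0"
      using LIMSEQ_ignore_initial_segment[OF lim_1_over_n, of 2] by (intro tendsto_intros) simp
    moreover have "1 - 1 / real (k + 2) = real (Suc k) / real (Suc k + 1)" for k by (simp add: field_simps)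
    ultimately show "(\<lambda>k. real (Suc k) / real (Suc k + 1)) \<longlonglongrightarrow> 1" by simp
  qed
  then have "1 * ?B \<le> ?n"
    by (rule LIMSEQ_le_const2) (use step[of "Suc _"] in auto)
  then show ?thesis using le by simp
qed

end

theorem theorem1p3:
  fixes m :: nat and p \<alpha> a :: real
  assumes "m \<ge> 2" and "p = 2 * real m" and "\<alpha> > -1" and "a = (\<alpha> + 2) / (2 * real m)"
  shows "((0 < a \<and> a \<le> real m / (2 * real m - 1)) \<longleftrightarrow>
            (-1 < \<alpha> \<and> \<alpha> \<le> 2 * (real m - 1)\<^sup>2 / (2 * real m - 1))) \<and>
         (0 < a \<and> a \<le> real m / (2 * real m - 1) \<longrightarrow>
            (\<exists>T. is_hilbert_operator p \<alpha> T) \<and>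
            (\<forall>T. is_hilbert_operator p \<alpha> T \<longrightarrow> bergman_onorm p \<alpha> T = Beta a (1 - a)) \<and>
            Beta a (1 - a) = pi / sin (pi * a))"
proof -
  have m: "real m \<ge> 2" "2 * real m - 1 > 0" using assms(1) by auto
  have am: "a * (2 * real m) = \<alpha> + 2" using m by (simp add: assms(4))
  have a0: "a > 0" using m assms(3,4) by simp
  have sq: "2 * (real m - 1)\<^sup>2 / (2 * real m - 1) = 2 * real m * (real m / (2 * real m - 1)) - 2"
    using m by (simp add: field_simps power2_eq_square)
  have iff: "a \<le> real m / (2 * real m - 1) \<longleftrightarrow> \<alpha> \<le> 2 * (real m - 1)\<^sup>2 / (2 * real m - 1)"
  proof -
    have "a \<le> real m / (2 * real m - 1) \<longleftrightarrow> a * (2 * real m) \<le> real m / (2 * real m - 1) * (2 * real m)"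
      using m by (intro mult_le_cancel_right_pos[symmetric]) simp
    then show ?thesis unfolding sq am by (auto simp: mult_ac)
  qed
  have main: "(\<exists>T. is_hilbert_operator p \<alpha> T) \<and>
      (\<forall>T. is_hilbert_operator p \<alpha> T \<longrightarrow> bergman_onorm p \<alpha> T = Beta a (1 - a)) \<and>
      Beta a (1 - a) = pi / sin (pi * a)"
    if a: "a \<le> real m / (2 * real m - 1)"
  proof -
    have "a * (2 * real m - 1) \<le> real m" using a m by (simp add: le_divide_eq)
    \<comment> \<open>Since 2 m a = \<alpha> + 2, the upper bound on a is the condition \<delta> <=
      a in disguise.\<close>
    then have a_le: "\<alpha> + 2 - real m \<le> a" using am by (simp add: algebra_simps)
    \<comment> \<open>As m > 1, the admissible range of a lies below 1, which is the assumption of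
      the locale.\<close>
    have "real m / (2 * real m - 1) < 1" using m by (simp add: divide_less_eq)
    then have "a < 1" using a by linarith
    then have "a * (2 * real m) < 1 * (2 * real m)" using m by (intro mult_strict_right_mono) auto
    then have lt: "\<alpha> + 2 < 2 * real m" using am by simp
    interpret hilbert_bergman m \<alpha>
      by unfold_locales (use assms(1,3) lt in auto)
    note bound = hilbert_ext_bound_Beta[OF a_le[unfolded assms(4)] assms(1)]
    have "is_hilbert_operator p \<alpha> hilbert_ext"
      unfolding assms(2) by (rule is_hilbert_operator_hilbert_ext[OF bound])
    moreover have "bergman_onorm p \<alpha> T = Beta a (1 - a)" if "is_hilbert_operator p \<alpha> T" for T
      using hilbert_onorm[OF a_le[unfolded assms(4)] assms(1)] that unfolding assms(2,4) by simp
    ultimately show ?thesis using Beta_reflection_sin[of a] by blast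
  qed
  show ?thesis using iff main a0 assms(3) by blast
qed

end
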